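(* Under the standing assumptions below, the linear operator $\mathcal{A}:H_0^1(\Omega)\to H^{-1}(\Omega)$ is an isomorphism.
   Context: Standing assumption (Assumption 1): Let $n\in\{2,3\}$ and let $\Omega\subset\mathbb{R}^n$ be a bounded open domain with Lipschitz boundary $\Gamma$. Let $Ay=-\sum_{i,j=1}^n\partial_{x_j}(a_{ij}(x)\partial_{x_i}y)$ with $a_{ij}\in L^\infty(\Omega)$, and assume there is $\Lambda>0$ with $\sum_{i,j=1}^n a_{ij}(x)\xi_i\xi_j\ge\Lambda|\xi|^2$ for all $\xi\in\mathbb{R}^n$ and a.e. $x\in\Omega$. Let $b\in L^p(\Omega)^n$, where $p\ge 3$ if $n=3$ and $p>2$ if $n=2$. Let $a_0\in L^q(\Omega)$ with $a_0\ge 0$ a.e., where $q>1$ if $n=2$ and $q\ge 3/2$ if $n=3$. The space $H_0^1(\Omega)$ is normed by $\|\nabla y\|_{L^2(\Omega)^n}$ and $H^{-1}(\Omega)$ is its dual. The operator $\mathcal{A}y=Ay+b(x)\cdot\nabla y+a_0(x)y$ is understood weakly: $\langle\mathcal{A}y,z\rangle=\int_\Omega\big(\sum_{i,j}a_{ij}\partial_{x_i}y\,\partial_{x_j}z+(b\cdot\nabla y)z+a_0yz\big)\,dx$ for $y,z\in H_0^1(\Omega)$. *)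

theory Defs
  imports "HOL-Analysis.Analysis"
begin

definition partial :: "'n::finite \<Rightarrow> (real^'n \<Rightarrow> real) \<Rightarrow> real^'n \<Rightarrow> real" where
  "partial i f x = frechet_derivative f (at x) (axis i 1)"

fun iter_partial :: "'n::finite list \<Rightarrow> (real^'n \<Rightarrow> real) \<Rightarrow> real^'n \<Rightarrow> real" where
  "iter_partial [] f = f"
| "iter_partial (i # is) f = partial i (iter_partial is f)"

definition smooth :: "(real^'n::finite \<Rightarrow> real) \<Rightarrow> bool" where
  "smooth f \<longleftrightarrow> (\<forall>is. iter_partial is f differentiable_on UNIV)"

definition tsupport :: "(real^'n::finite \<Rightarrow> real) \<Rightarrow> (real^'n) set" where
  "tsupport f = closure {x. f x \<noteq> 0}"

definition test_fun :: "(real^'n::finite) set \<Rightarrow> (real^'n \<Rightarrow> real) \<Rightarrow> bool" where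
  "test_fun \<Omega> \<phi> \<longleftrightarrow> smooth \<phi> \<and> compact (tsupport \<phi>) \<and> tsupport \<phi> \<subseteq> \<Omega>"

definition grad :: "(real^'n::finite \<Rightarrow> real) \<Rightarrow> real^'n \<Rightarrow> real^'n" where
  "grad f x = (\<chi> i. partial i f x)"

definition Lp :: "real \<Rightarrow> (real^'n::finite) set \<Rightarrow> (real^'n \<Rightarrow> real) \<Rightarrow> bool" where
  "Lp p \<Omega> f \<longleftrightarrow> f \<in> borel_measurable (lebesgue_on \<Omega>)
      \<and> integrable (lebesgue_on \<Omega>) (\<lambda>x. \<bar>f x\<bar> powr p)"

definition Linf :: "(real^'n::finite) set \<Rightarrow> (real^'n \<Rightarrow> real) \<Rightarrow> bool" where
  "Linf \<Omega> f \<longleftrightarrow> f \<in> borel_measurable (lebesgue_on \<Omega>)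
      \<and> (\<exists>K. AE x in lebesgue_on \<Omega>. \<bar>f x\<bar> \<le> K)"

text \<open>y is in H_0^1(Omega) with (weak) gradient g: y and g are in L^2(Omega), and there are
  test functions phi_k with phi_k \<rightarrow> y and grad phi_k \<rightarrow> g in L^2(Omega)
  (i.e. H_0^1 is the closure of C_c^infinity(Omega) in the H^1 norm).\<close>
definition H01_grad :: "(real^'n::finite) set \<Rightarrow> (real^'n \<Rightarrow> real) \<Rightarrow> (real^'n \<Rightarrow> real^'n) \<Rightarrow> bool" where
  "H01_grad \<Omega> y g \<longleftrightarrow> Lp 2 \<Omega> y \<and> (\<forall>i. Lp 2 \<Omega> (\<lambda>x. g x $ i)) \<and>
     (\<exists>\<phi>::nat \<Rightarrow> real^'n \<Rightarrow> real. (\<forall>k. test_fun \<Omega> (\<phi> k)) \<and>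
        (\<lambda>k. integral\<^sup>L (lebesgue_on \<Omega>) (\<lambda>x. (\<phi> k x - y x)\<^sup>2)) \<longlonglongrightarrow> 0 \<and>
        (\<lambda>k. integral\<^sup>L (lebesgue_on \<Omega>) (\<lambda>x. (norm (grad (\<phi> k) x - g x))\<^sup>2)) \<longlonglongrightarrow> 0)"

definition H01 :: "(real^'n::finite) set \<Rightarrow> (real^'n \<Rightarrow> real) \<Rightarrow> bool" where
  "H01 \<Omega> y \<longleftrightarrow> (\<exists>g. H01_grad \<Omega> y g)"

text \<open>The weak gradient (unique up to a.e. equality; integrals do not depend on the choice).\<close>
definition wgrad :: "(real^'n::finite) set \<Rightarrow> (real^'n \<Rightarrow> real) \<Rightarrow> real^'n \<Rightarrow> real^'n" where
  "wgrad \<Omega> y = (SOME g. H01_grad \<Omega> y g)"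

definition H01_norm :: "(real^'n::finite) set \<Rightarrow> (real^'n \<Rightarrow> real) \<Rightarrow> real" where
  "H01_norm \<Omega> y = sqrt (integral\<^sup>L (lebesgue_on \<Omega>) (\<lambda>x. (norm (wgrad \<Omega> y x))\<^sup>2))"

definition Hminus1 :: "(real^'n::finite) set \<Rightarrow> ((real^'n \<Rightarrow> real) \<Rightarrow> real) \<Rightarrow> bool" where
  "Hminus1 \<Omega> F \<longleftrightarrow>
     (\<forall>y z. H01 \<Omega> y \<longrightarrow> H01 \<Omega> z \<longrightarrow> F (\<lambda>x. y x + z x) = F y + F z) \<and>
     (\<forall>c y. H01 \<Omega> y \<longrightarrow> F (\<lambda>x. c * y x) = c * F y) \<and>
     (\<exists>M. \<forall>z. H01 \<Omega> z \<longrightarrow> \<bar>F z\<bar> \<le> M * H01_norm \<Omega> z)"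

text \<open>Integrand of the weak form of \<A>y = Ay + b.grad y + a0 y tested with z.\<close>
definition opA_integrand ::
  "('n::finite \<Rightarrow> 'n \<Rightarrow> real^'n \<Rightarrow> real) \<Rightarrow> (real^'n \<Rightarrow> real^'n) \<Rightarrow> (real^'n \<Rightarrow> real) \<Rightarrow>
   (real^'n) set \<Rightarrow> (real^'n \<Rightarrow> real) \<Rightarrow> (real^'n \<Rightarrow> real) \<Rightarrow> real^'n \<Rightarrow> real" where
  "opA_integrand a b a0 \<Omega> y z x =
     (\<Sum>i\<in>UNIV. \<Sum>j\<in>UNIV. a i j x * (wgrad \<Omega> y x $ i) * (wgrad \<Omega> z x $ j))
     + (b x \<bullet> wgrad \<Omega> y x) * z x + a0 x * y x * z x"

definition opA ::
  "('n::finite \<Rightarrow> 'n \<Rightarrow> real^'n \<Rightarrow> real) \<Rightarrow> (real^'n \<Rightarrow> real^'n) \<Rightarrow> (real^'n \<Rightarrow> real) \<Rightarrow>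
   (real^'n) set \<Rightarrow> (real^'n \<Rightarrow> real) \<Rightarrow> (real^'n \<Rightarrow> real) \<Rightarrow> real" where
  "opA a b a0 \<Omega> y z = integral\<^sup>L (lebesgue_on \<Omega>) (opA_integrand a b a0 \<Omega> y z)"

definition drop_coord :: "'n::finite \<Rightarrow> real^'n \<Rightarrow> real^'n" where
  "drop_coord k v = (\<chi> i. if i = k then 0 else v $ i)"

text \<open>Omega has Lipschitz boundary: near each boundary point x0, after a rigid change of
  coordinates (x \<mapsto> R (x - x0) with R orthogonal), Omega is the region strictly below the
  graph of a Lipschitz function of the remaining n-1 coordinates.\<close>
definition lipschitz_boundary :: "(real^'n::finite) set \<Rightarrow> bool" where
  "lipschitz_boundary \<Omega> \<longleftrightarrow>
     (\<forall>x0\<in>frontier \<Omega>. \<exists>R k h L V. orthogonal_transformation (R :: real^'n \<Rightarrow> real^'n) \<and> open V \<and> x0 \<in> V \<and>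
        L-lipschitz_on UNIV h \<and>
        (\<forall>x\<in>V. x \<in> \<Omega> \<longleftrightarrow> R (x - x0) $ k < h (drop_coord k (R (x - x0)))))"

definition lipschitz_domain :: "(real^'n::finite) set \<Rightarrow> bool" where
  "lipschitz_domain \<Omega> \<longleftrightarrow> open \<Omega> \<and> connected \<Omega> \<and> bounded \<Omega> \<and> \<Omega> \<noteq> {} \<and> lipschitz_boundary \<Omega>"

end

theory Submission
  imports Defs
begin

text \<open>Neither compactness nor the Fredholm alternative is needed: a bound of \<open>y\<close> by \<open>\<A>y\<close> holds
  directly, with a constant that depends only on the ellipticity constant, the norm of \<open>b\<close> and the
  Sobolev constant (the slicing argument of Bottaro and Marina). Cut \<open>y\<close> into
  finitely many slices \<open>y\<^sub>j\<close> between levels of \<open>\<bar>y\<bar>\<close> such that \<open>b\<close> is small on each set \<open>\<nabla>y\<^sub>j \<noteq> 0\<close>.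
  Testing with \<open>y\<^sub>j\<close> bounds \<open>\<nabla>y\<^sub>j\<close> by the data and the gradients of the slices above it, because
  \<open>y\<^sub>j\<close> vanishes below its level and \<open>a\<^sub>0 y y\<^sub>j \<ge> 0\<close>. The levels exist since \<open>\<nabla>y = 0\<close> almost everywhere
  on level sets. This bound is uniform along the segment joining the Dirichlet form to the form of \<open>\<A>\<close>,
  so the method of continuity carries surjectivity over from the Riesz representation theorem.
  It suffices to prove it for test functions.\<close>

section \<open>Smooth functions and test functions\<close>

text \<open>The form of \<A> need not be coercive: the drift term has no sign, and in three
  dimensions \<open>p = 3\<close> is exactly the exponent at which the Hoelder and Sobolev
  inequalities bound it by the two gradient norms, with nothing to spare. Smallness can therefore
  only come from localising \<open>b\<close>. Cutting along the values of \<open>y\<close> instead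
  of in space keeps the pieces in H01 and creates no commutator terms. It also makes the system of
  estimates triangular: tested with a slice, the drift term sees only that slice and the ones above
  it, so the slices are bounded from the top downwards. How many slices are needed is fixed before
  \<open>y\<close>; only the levels depend on \<open>y\<close>, which is what makes the constant
  uniform. Test functions have a bounded range, hence a top level, and boundedness of the form
  extends the estimate by density. All exponents are tied to one integer \<open>m\<close>: the
  Sobolev inequality is proved for the power \<open>2 * m\<close>, and the conditions dual to it are
  the powers \<open>2 * m / (m - 1)\<close> for \<open>b\<close> and \<open>m / (m - 1)\<close> for
  \<open>a0\<close>. Three dimensions take \<open>m = 3\<close>, two dimensions a large
  \<open>m\<close>, and the rest of the argument is common to both.\<close>

lemma partial_eqI: "(f has_derivative f') (at x) \<Longrightarrow> partial i f x = f' (axis i 1)"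
  unfolding partial_def by (metis frechet_derivative_at)

text \<open>\<open>smooth\<close> speaks of all iterated partial derivatives. An invariant stable
  under a single one replaces any formula for the iterated derivatives of a compound
  function.\<close>

lemma smooth_coinduct:
  assumes "X f" "\<And>f. X f \<Longrightarrow> f differentiable_on UNIV" "\<And>f i. X f \<Longrightarrow> X (partial i f)"
  shows "smooth f"
proof -
  have "X (iter_partial is f)" for "is" by (induction "is") (use assms in auto)
  then show ?thesis using assms(2) by (auto simp: smooth_def)
qed

lemma smooth_differentiable: "smooth f \<Longrightarrow> f differentiable (at x)"
  unfolding smooth_def by (metis differentiable_on_def iter_partial.simps(1) UNIV_I)

lemma smooth_partial: assumes "smooth f" shows "smooth (partial i f)"
proof -
  \<comment> \<open>\<open>iter_partial\<close> applies the head of its list last, so a derivative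
    taken beforehand goes to the end of the list.\<close>
  have "iter_partial is (partial i f) = iter_partial (is @ [i]) f" for "is" by (induction "is") auto
  then show ?thesis using assms by (auto simp: smooth_def)
qed

lemma smooth_has_derivative: "smooth f \<Longrightarrow> (f has_derivative frechet_derivative f (at x)) (at x)"
  using smooth_differentiable frechet_derivative_works by blast

lemma smooth_continuous: "smooth f \<Longrightarrow> continuous_on S f"
  by (meson continuous_at_imp_continuous_on differentiable_imp_continuous_within smooth_differentiable)

lemma smooth_directional:
  assumes "smooth f" shows "((\<lambda>t. f (x + t *\<^sub>R axis i 1)) has_real_derivative partial i f x) (at 0)"
proof -
  have d: "((\<lambda>t::real. f (x + t *\<^sub>R axis i 1)) has_derivative (\<lambda>t. frechet_derivative f (at x) (t *\<^sub>R axis i 1))) (at 0)"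
    by (rule has_derivative_compose[of "\<lambda>t. x + t *\<^sub>R axis i 1" "\<lambda>t. t *\<^sub>R axis i 1"])
       (use smooth_has_derivative[OF assms, of x] in \<open>auto intro!: derivative_eq_intros\<close>)
  have "linear (frechet_derivative f (at x))"
    using smooth_has_derivative[OF assms] has_derivative_linear by blast
  then have "(\<lambda>t. frechet_derivative f (at x) (t *\<^sub>R axis i 1)) = (*) (partial i f x)"
    by (auto simp: linear_scale partial_def)
  with d show ?thesis by (simp add: has_field_derivative_def)
qed

lemma smooth_const: "smooth (\<lambda>x. c)"
proof (rule smooth_coinduct[where X = "\<lambda>f. \<exists>c. f = (\<lambda>x. c)"])
  fix f :: "real^'a \<Rightarrow> real" and i :: 'a assume "\<exists>c. f = (\<lambda>x. c)"
  then obtain c where f: "f = (\<lambda>x. c)" by blast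
  have "partial i f = (\<lambda>x. 0)" unfolding f
    by (rule ext, rule partial_eqI) (rule has_derivative_const)
  then show "\<exists>c. partial i f = (\<lambda>x. c)" by auto
qed auto

lemma partial_add:
  assumes "f differentiable (at x)" "g differentiable (at x)"
  shows "partial i (\<lambda>x. f x + g x) x = partial i f x + partial i g x"
  unfolding partial_def[of i f] partial_def[of i g]
  by (rule partial_eqI, rule has_derivative_add) (use assms frechet_derivative_works in auto)

lemma smooth_add: assumes "smooth f" "smooth g" shows "smooth (\<lambda>x. f x + g x)"
proof (rule smooth_coinduct[where X = "\<lambda>h. \<exists>f g. smooth f \<and> smooth g \<and> h = (\<lambda>x. f x + g x)"])
  fix h i assume "\<exists>f g. smooth f \<and> smooth g \<and> h = (\<lambda>x. f x + g x)"
  then obtain f g where fg: "smooth f" "smooth g" "h = (\<lambda>x. f x + g x)" by blast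
  then have "partial i h = (\<lambda>x. partial i f x + partial i g x)"
    by (auto simp: partial_add smooth_differentiable)
  then show "\<exists>f g. smooth f \<and> smooth g \<and> partial i h = (\<lambda>x. f x + g x)"
    using fg smooth_partial by blast
next
  show "h differentiable_on UNIV" if "\<exists>f g. smooth f \<and> smooth g \<and> h = (\<lambda>x. f x + g x)" for h
    using that by (auto simp: differentiable_on_def smooth_differentiable)
qed (use assms in blast)

lemma partial_mult:
  assumes "f differentiable (at x)" "g differentiable (at x)"
  shows "partial i (\<lambda>x. f x * g x) x = f x * partial i g x + partial i f x * g x"
  unfolding partial_def[of i f] partial_def[of i g]
  by (rule partial_eqI, rule has_derivative_mult) (use assms frechet_derivative_works in auto)

text \<open>A derivative of a product is a sum of two products, so products alone are not stable
  under \<open>partial\<close>. Closing them under addition yields an invariant for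
  \<open>smooth_coinduct\<close>.\<close>

inductive sum_of_products :: "(real^'n::finite \<Rightarrow> real) \<Rightarrow> bool" where
  mult: "smooth f \<Longrightarrow> smooth g \<Longrightarrow> sum_of_products (\<lambda>x. f x * g x)"
| add: "sum_of_products f \<Longrightarrow> sum_of_products g \<Longrightarrow> sum_of_products (\<lambda>x. f x + g x)"

lemma smooth_mult: assumes "smooth f" "smooth g" shows "smooth (\<lambda>x. f x * g x)"
proof (rule smooth_coinduct[where X = sum_of_products])
  have d: "(\<forall>x. h differentiable (at x)) \<and> (\<forall>i. sum_of_products (partial i h))"
    if "sum_of_products h" for h :: "real^'n \<Rightarrow> real"
    using that
  proof induction
    case (mult f g)
    have "partial i (\<lambda>x. f x * g x) = (\<lambda>x. f x * partial i g x + partial i f x * g x)" for i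
      using mult by (auto simp: partial_mult smooth_differentiable)
    then show ?case
      using mult by (auto intro!: sum_of_products.intros smooth_partial simp: smooth_differentiable)
  next
    case (add f g)
    then have "partial i (\<lambda>x. f x + g x) = (\<lambda>x. partial i f x + partial i g x)" for i
      by (auto simp: partial_add)
    then show ?case using add by (auto intro!: sum_of_products.intros)
  qed
  show "h differentiable_on UNIV" if "sum_of_products h" for h :: "real^'n \<Rightarrow> real"
    using d[OF that] by (auto simp: differentiable_on_def)
  show "sum_of_products (partial i h)" if "sum_of_products h" for h :: "real^'n \<Rightarrow> real" and i
    using d[OF that] by auto
qed (use assms in \<open>auto intro: sum_of_products.intros\<close>)

lemma smooth_power: "smooth f \<Longrightarrow> smooth (\<lambda>x. f x ^ k)"
  by (induction k) (auto intro: smooth_const smooth_mult)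

lemma smooth_sum: "(\<And>i. i \<in> I \<Longrightarrow> smooth (f i)) \<Longrightarrow> smooth (\<lambda>x. \<Sum>i\<in>I. f i x)"
  by (induction I rule: infinite_finite_induct) (auto intro: smooth_const smooth_add)

lemma test_fun_smooth: "test_fun \<Omega> \<phi> \<Longrightarrow> smooth \<phi>"
  by (simp add: test_fun_def)

lemma test_fun_zero: "test_fun \<Omega> (\<lambda>x. 0)"
  by (simp add: test_fun_def smooth_const tsupport_def)

text \<open>One criterion for all constructions of test functions: sums use two different functions,
  while multiples, powers and polynomials use the same one twice.\<close>

lemma test_fun_support:
  assumes "test_fun \<Omega> \<phi>" "test_fun \<Omega> \<psi>" "smooth f" "\<And>x. \<phi> x = 0 \<Longrightarrow> \<psi> x = 0 \<Longrightarrow> f x = 0"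
  shows "test_fun \<Omega> f"
proof -
  have "tsupport f \<subseteq> tsupport \<phi> \<union> tsupport \<psi>"
    unfolding tsupport_def closure_Un[symmetric] by (rule closure_mono) (use assms(4) in auto)
  moreover have "compact (tsupport \<phi> \<union> tsupport \<psi>)" using assms by (auto simp: test_fun_def)
  moreover have "closed (tsupport f)" by (simp add: tsupport_def)
  ultimately show ?thesis using assms compact_Int_closed[of "tsupport \<phi> \<union> tsupport \<psi>" "tsupport f"]
    by (auto simp: test_fun_def Int_absorb1)
qed

lemma test_fun_add: "test_fun \<Omega> \<phi> \<Longrightarrow> test_fun \<Omega> \<psi> \<Longrightarrow> test_fun \<Omega> (\<lambda>x. \<phi> x + \<psi> x)"
  by (rule test_fun_support[of \<Omega> \<phi> \<psi>]) (auto intro: smooth_add test_fun_smooth)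

lemma test_fun_cmult: "test_fun \<Omega> \<phi> \<Longrightarrow> test_fun \<Omega> (\<lambda>x. c * \<phi> x)"
  by (rule test_fun_support[of \<Omega> \<phi> \<phi>]) (auto intro: smooth_mult smooth_const test_fun_smooth)

text \<open>The exponents start at one because a constant term would destroy the compact
  support.\<close>

lemma test_fun_poly:
  assumes "test_fun \<Omega> \<phi>" shows "test_fun \<Omega> (\<lambda>x. \<Sum>i\<le>n. a i * \<phi> x ^ Suc i)"
proof (rule test_fun_support[OF assms assms])
  show "smooth (\<lambda>x. \<Sum>i\<le>n. a i * \<phi> x ^ Suc i)"
    by (intro smooth_sum smooth_mult[of "\<lambda>x. a _"] smooth_const smooth_power test_fun_smooth[OF assms])
qed simp

lemma grad_add:
  assumes "smooth f" "smooth g" shows "grad (\<lambda>x. f x + g x) x = grad f x + grad g x"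
  by (simp add: grad_def vec_eq_iff partial_add smooth_differentiable assms)

lemma grad_comp:
  assumes "smooth f" "(P has_real_derivative P') (at (f x))"
  shows "grad (\<lambda>x. P (f x)) x = P' *\<^sub>R grad f x"
proof -
  have "((\<lambda>x. P (f x)) has_derivative (\<lambda>h. P' * frechet_derivative f (at x) h)) (at x)"
    by (rule has_derivative_compose[OF smooth_has_derivative[OF assms(1)] assms(2)[unfolded has_field_derivative_def]])
  then show ?thesis by (simp add: grad_def vec_eq_iff partial_eqI partial_def[of _ f])
qed

lemma grad_cmult:
  assumes "smooth f" shows "grad (\<lambda>x. c * f x) x = c *\<^sub>R grad f x"
  by (rule grad_comp[OF assms, of "\<lambda>s. c * s"]) (auto intro!: derivative_eq_intros)

lemma grad_continuous: "smooth f \<Longrightarrow> continuous_on S (grad f)"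
  unfolding grad_def[abs_def]
  by (intro continuous_on_vec_lambda smooth_continuous smooth_partial)

lemma test_fun_eq_0:
  assumes "test_fun \<Omega> \<phi>" "x \<notin> tsupport \<phi>" shows "\<phi> x = 0" "partial i \<phi> x = 0" "grad \<phi> x = 0"
proof -
  have x: "x \<in> - tsupport \<phi>" and o: "open (- tsupport \<phi>)" using assms(2) by (auto simp: tsupport_def)
  have z: "\<phi> z = 0" if "z \<in> - tsupport \<phi>" for z
    using that closure_subset[of "{x. \<phi> x \<noteq> 0}"] by (auto simp: tsupport_def)
  show "\<phi> x = 0" using z[OF x] .
  have "((\<lambda>x. 0) has_derivative (\<lambda>h. 0)) (at x)" by simp
  then have "(\<phi> has_derivative (\<lambda>h. 0)) (at x)"
    by (rule has_derivative_transform_within_open[OF _ o x]) (use z in simp)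
  then have p: "partial i \<phi> x = 0" for i by (simp add: partial_eqI)
  then show "partial i \<phi> x = 0" .
  show "grad \<phi> x = 0" using p by (simp add: grad_def vec_eq_iff)
qed

lemma test_fun_outside:
  assumes "test_fun \<Omega> \<phi>" "x \<notin> \<Omega>" shows "\<phi> x = 0" "partial i \<phi> x = 0" "grad \<phi> x = 0"
proof -
  have "x \<notin> tsupport \<phi>" using assms by (auto simp: test_fun_def)
  from test_fun_eq_0[OF assms(1) this] show "\<phi> x = 0" "partial i \<phi> x = 0" "grad \<phi> x = 0" .
qed

section \<open>Integration by parts for test functions\<close>

lemma continuous_compact_support_bounded:
  fixes f :: "'a::euclidean_space \<Rightarrow> 'b::real_normed_vector"
  assumes "continuous_on UNIV f" "compact K" "\<And>x. x \<notin> K \<Longrightarrow> f x = 0"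
  obtains B where "B > 0" "\<And>x. norm (f x) \<le> B"
proof -
  have "bounded (f ` K)"
    using assms by (meson compact_continuous_image compact_imp_bounded continuous_on_subset subset_UNIV)
  then obtain B where "B > 0" "\<And>x. x \<in> K \<Longrightarrow> norm (f x) \<le> B" by (auto simp: bounded_pos)
  then show thesis by (intro that[of B]) (metis assms(3) less_eq_real_def norm_zero)+
qed

lemma integrable_continuous_compact_support:
  fixes f :: "'a::euclidean_space \<Rightarrow> 'b::{banach, second_countable_topology}"
  assumes "continuous_on UNIV f" "compact K" "\<And>x. x \<notin> K \<Longrightarrow> f x = 0"
  shows "integrable lborel f"
proof -
  have "integrable lborel (\<lambda>x. indicator K x *\<^sub>R f x)"
    using assms by (intro borel_integrable_compact) (auto intro: continuous_on_subset)
  moreover have "(\<lambda>x. indicator K x *\<^sub>R f x) = f" using assms(3) by (auto simp: indicator_def)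
  ultimately show ?thesis by simp
qed

text \<open>By translation invariance every difference quotient has integral zero. The mean value
  theorem bounds the quotients by the maximum of the derivative, so dominated convergence carries
  the zero over to the derivative.\<close>

lemma integral_directional_derivative_eq_0:
  fixes u :: "'a::euclidean_space \<Rightarrow> real"
  assumes cu: "continuous_on UNIV u" and cu': "continuous_on UNIV u'" and K: "compact K"
    and z: "\<And>x. x \<notin> K \<Longrightarrow> u x = 0" and z': "\<And>x. x \<notin> K \<Longrightarrow> u' x = 0"
    and d: "\<And>x. ((\<lambda>t. u (x + t *\<^sub>R e)) has_real_derivative u' x) (at 0)"
  shows "(\<integral>x. u' x \<partial>lborel) = 0"
proof -
  obtain L where L: "L > 0" "\<And>x. norm (u' x) \<le> L"
    using continuous_compact_support_bounded[OF cu' K z'] by blast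
  obtain R where R: "\<And>x. x \<in> K \<Longrightarrow> norm x \<le> R" using compact_imp_bounded[OF K] by (auto simp: bounded_iff)
  have dt: "((\<lambda>t. u (x + t *\<^sub>R e)) has_real_derivative u' (x + t *\<^sub>R e)) (at t)" for x t
    using d[of "x + t *\<^sub>R e"] DERIV_shift[of "\<lambda>t. u (x + t *\<^sub>R e)" _ 0 t]
    by (simp add: algebra_simps)
  define h where "h k = inverse (real (Suc k))" for k
  have h0: "h k > 0" "h k \<le> 1" for k by (auto simp: h_def inverse_le_1_iff)
  define q where "q k x = (u (x + h k *\<^sub>R e) - u x) / h k" for k x
  have int_u: "integrable lborel u" by (rule integrable_continuous_compact_support[OF cu K z])
  have int_s: "integrable lborel (\<lambda>x. u (x + c))" "(\<integral>x. u (x + c) \<partial>lborel) = (\<integral>x. u x \<partial>lborel)" for c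
  proof -
    have [measurable]: "u \<in> borel_measurable borel" using cu by (rule borel_measurable_continuous_onI)
    show "integrable lborel (\<lambda>x. u (x + c))"
      using int_u integrable_distr_eq[of "(+) c" lborel borel u] lborel_distr_plus[of c] by (simp add: add.commute)
    show "(\<integral>x. u (x + c) \<partial>lborel) = (\<integral>x. u x \<partial>lborel)"
      using integral_distr[of "(+) c" lborel borel u] lborel_distr_plus[of c] by (simp add: add.commute)
  qed
  have q0: "(\<integral>x. q k x \<partial>lborel) = 0" for k
    unfolding q_def using int_s int_u by simp
  have qb: "\<bar>q k x\<bar> \<le> L" for k x
  proof -
    obtain s where "0 < s" "s < h k" "u (x + h k *\<^sub>R e) - u (x + 0 *\<^sub>R e) = (h k - 0) * u' (x + s *\<^sub>R e)"
      using MVT2[of 0 "h k" "\<lambda>t. u (x + t *\<^sub>R e)" "\<lambda>t. u' (x + t *\<^sub>R e)"] h0(1)[of k] dt by blast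
    then have "q k x = u' (x + s *\<^sub>R e)" using h0(1)[of k] by (simp add: q_def)
    then show ?thesis using L(2) by simp
  qed
  \<comment> \<open>The shifts have length at most \<open>norm e\<close> because
    \<open>h k \<le> 1\<close>, so all quotients live in one ball and share an integrable
    majorant.\<close>
  have qs: "q k x = 0" if "norm x > R + norm e" for k x
  proof -
    have "norm x > R" using that norm_ge_zero[of e] by linarith
    moreover have "norm (h k *\<^sub>R e) \<le> norm e" using h0[of k] by (simp add: mult_left_le_one_le)
    then have "norm (x + h k *\<^sub>R e) > R" using that norm_triangle_ineq4[of "x + h k *\<^sub>R e" "h k *\<^sub>R e"] by simp
    ultimately have "x \<notin> K" "x + h k *\<^sub>R e \<notin> K" using R[of x] R[of "x + h k *\<^sub>R e"] by auto
    then show ?thesis using z by (simp add: q_def)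
  qed
  have "(\<lambda>k. \<integral>x. q k x \<partial>lborel) \<longlonglongrightarrow> (\<integral>x. u' x \<partial>lborel)"
  proof (rule integral_dominated_convergence[where w = "\<lambda>x. indicator (cball 0 (R + norm e)) x * L"])
    show "u' \<in> borel_measurable lborel" using borel_measurable_continuous_onI[OF cu'] by simp
    have [measurable]: "u \<in> borel_measurable borel" using cu by (rule borel_measurable_continuous_onI)
    show "q k \<in> borel_measurable lborel" for k unfolding q_def by measurable
    show "integrable lborel (\<lambda>x. indicator (cball 0 (R + norm e)) x * L)"
      by (intro integrable_mult_left integrable_real_indicator) (simp_all add: emeasure_lborel_cball_finite[unfolded infinity_ennreal_def])
    show "AE x in lborel. (\<lambda>k. q k x) \<longlonglongrightarrow> u' x"
    proof (rule AE_I2)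
      fix x
      have "((\<lambda>s. (u (x + s *\<^sub>R e) - u x) / s) \<longlongrightarrow> u' x) (at 0)"
        using d[of x] by (simp add: DERIV_def)
      moreover have "filterlim h (at 0) sequentially"
        using h0(1) LIMSEQ_inverse_real_of_nat unfolding filterlim_at h_def
        by (auto simp: eventually_sequentially)
      ultimately show "(\<lambda>k. q k x) \<longlonglongrightarrow> u' x" unfolding q_def by (rule filterlim_compose)
    qed
    show "AE x in lborel. norm (q k x) \<le> indicator (cball 0 (R + norm e)) x * L" for k
      using qb qs L(1) by (auto simp: indicator_def)
  qed
  then show ?thesis unfolding q0 using LIMSEQ_unique tendsto_const by blast
qed

text \<open>Polynomials are the partners of weak gradients in the integrations by parts below. The
  derivative falls on them, so it has to be continuous again.\<close>

lemma real_polynomial_function_directional: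
  fixes \<psi> :: "'a::euclidean_space \<Rightarrow> real"
  assumes "real_polynomial_function \<psi>"
  shows "\<exists>d. real_polynomial_function d \<and> (\<forall>x. ((\<lambda>t. \<psi> (x + t *\<^sub>R e)) has_real_derivative d x) (at 0))"
  using assms
proof induction
  case (linear h)
  then interpret bounded_linear h .
  show ?case
    by (rule exI[of _ "\<lambda>x. h e"]) (auto simp: add scaleR intro!: derivative_eq_intros)
next
  case (const c)
  then show ?case by (intro exI[of _ "\<lambda>x. 0"]) auto
next
  case (add f g)
  then obtain df dg where "real_polynomial_function df" "real_polynomial_function dg"
    "\<And>x. ((\<lambda>t. f (x + t *\<^sub>R e)) has_real_derivative df x) (at 0)"
    "\<And>x. ((\<lambda>t. g (x + t *\<^sub>R e)) has_real_derivative dg x) (at 0)" by blast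
  then show ?case by (intro exI[of _ "\<lambda>x. df x + dg x"]) (auto intro: DERIV_add)
next
  case (mult f g)
  then obtain df dg where "real_polynomial_function df" "real_polynomial_function dg"
    "\<And>x. ((\<lambda>t. f (x + t *\<^sub>R e)) has_real_derivative df x) (at 0)"
    "\<And>x. ((\<lambda>t. g (x + t *\<^sub>R e)) has_real_derivative dg x) (at 0)" by blast
  then have "((\<lambda>t. f (x + t *\<^sub>R e) * g (x + t *\<^sub>R e)) has_real_derivative df x * g x + dg x * f x) (at 0)" for x
    using DERIV_mult[of "\<lambda>t. f (x + t *\<^sub>R e)" "df x" 0 UNIV "\<lambda>t. g (x + t *\<^sub>R e)" "dg x"] by simp
  moreover have "real_polynomial_function (\<lambda>x. df x * g x + dg x * f x)"
    using mult.hyps \<open>real_polynomial_function df\<close> \<open>real_polynomial_function dg\<close>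
    by (intro real_polynomial_function.intros(3,4))
  ultimately show ?case by blast
qed

text \<open>The product inherits the compact support of \<phi>, so \<psi> is not restricted at the
  boundary of \<Omega>. This is how zero boundary values enter the theory.\<close>

lemma test_fun_integration_by_parts:
  assumes \<phi>: "test_fun \<Omega> \<phi>" and \<psi>: "continuous_on UNIV \<psi>" "continuous_on UNIV d"
    and d: "\<And>x. ((\<lambda>t. \<psi> (x + t *\<^sub>R axis i 1)) has_real_derivative d x) (at 0)"
  shows "(\<integral>x. partial i \<phi> x * \<psi> x + \<phi> x * d x \<partial>lborel) = 0"
proof (rule integral_directional_derivative_eq_0[where u = "\<lambda>x. \<phi> x * \<psi> x" and K = "tsupport \<phi>" and e = "axis i 1"])
  have s: "smooth \<phi>" using \<phi> by (rule test_fun_smooth)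
  show "continuous_on UNIV (\<lambda>x. \<phi> x * \<psi> x)" "continuous_on UNIV (\<lambda>x. partial i \<phi> x * \<psi> x + \<phi> x * d x)"
    by (intro continuous_intros smooth_continuous smooth_partial s \<psi>)+
  show "((\<lambda>t. \<phi> (x + t *\<^sub>R axis i 1) * \<psi> (x + t *\<^sub>R axis i 1)) has_real_derivative partial i \<phi> x * \<psi> x + \<phi> x * d x) (at 0)" for x
    using DERIV_mult[OF smooth_directional[OF s, of x i] d[of x]] by (simp add: mult.commute add.commute)
qed (use \<phi> in \<open>auto simp: test_fun_def test_fun_eq_0[OF \<phi>]\<close>)

text \<open>The definitions integrate over \<open>lebesgue_on\<close>, whereas translation
  invariance and Fubini are applied to \<open>lborel\<close>. A Borel function that vanishes outside
  \<open>S\<close> does not see the difference.\<close>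

lemma lebesgue_on_lborel:
  fixes f :: "'a::euclidean_space \<Rightarrow> 'b::{banach, second_countable_topology}"
  assumes "S \<in> sets lebesgue" "f \<in> borel_measurable borel" "\<And>x. x \<notin> S \<Longrightarrow> f x = 0"
  shows "integrable (lebesgue_on S) f \<longleftrightarrow> integrable lborel f"
    and "integral\<^sup>L (lebesgue_on S) f = integral\<^sup>L lborel f"
proof -
  have *: "(\<lambda>x. indicator S x *\<^sub>R f x) = f" using assms(3) by (auto simp: indicator_def)
  show "integrable (lebesgue_on S) f \<longleftrightarrow> integrable lborel f"
    using assms by (simp add: integrable_restrict_space * integrable_completion)
  show "integral\<^sup>L (lebesgue_on S) f = integral\<^sup>L lborel f"
    using assms by (simp add: integral_restrict_space * integral_completion)
qed

section \<open>Square integrable functions\<close>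

text \<open>The values are Euclidean vectors, so that one theory serves functions and their
  gradients.\<close>

definition L2 :: "'a measure \<Rightarrow> ('a \<Rightarrow> 'b::euclidean_space) \<Rightarrow> bool" where
  "L2 M f \<longleftrightarrow> f \<in> borel_measurable M \<and> integrable M (\<lambda>x. (norm (f x))\<^sup>2)"

definition l2 :: "'a measure \<Rightarrow> ('a \<Rightarrow> 'b::euclidean_space) \<Rightarrow> real" where
  "l2 M f = sqrt (\<integral>x. (norm (f x))\<^sup>2 \<partial>M)"

lemma L2_integrable: "L2 M f \<Longrightarrow> integrable M (\<lambda>x. (norm (f x))\<^sup>2)"
  by (simp add: L2_def)

lemma l2_nonneg: "0 \<le> l2 M f"
  by (simp add: l2_def)

lemma l2_power2: "(l2 M f)\<^sup>2 = (\<integral>x. (norm (f x))\<^sup>2 \<partial>M)"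
  by (simp add: l2_def)

lemma L2_bound:
  assumes "g \<in> borel_measurable M" "L2 M f" "AE x in M. norm (g x) \<le> norm (f x)"
  shows "L2 M g"
  unfolding L2_def
proof
  show "integrable M (\<lambda>x. (norm (g x))\<^sup>2)"
    by (rule Bochner_Integration.integrable_bound[OF L2_integrable[OF assms(2)]])
       (use assms in \<open>auto intro!: power_mono\<close>)
qed fact

lemma L2_norm_mult:
  assumes "L2 M f" "L2 M g"
  shows "integrable M (\<lambda>x. norm (f x) * norm (g x))"
proof (rule Bochner_Integration.integrable_bound)
  show "integrable M (\<lambda>x. (norm (f x))\<^sup>2 + (norm (g x))\<^sup>2)"
    using assms by (auto simp: L2_def)
  have [measurable]: "f \<in> borel_measurable M" "g \<in> borel_measurable M" using assms by (auto simp: L2_def)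
  show "(\<lambda>x. norm (f x) * norm (g x)) \<in> borel_measurable M" by measurable
  have "norm (f x) * norm (g x) \<le> (norm (f x))\<^sup>2 + (norm (g x))\<^sup>2" for x
    using sum_squares_bound[of "norm (f x)" "norm (g x)"] mult_nonneg_nonneg[OF norm_ge_zero[of "f x"] norm_ge_zero[of "g x"]]
    by linarith
  then show "AE x in M. norm (norm (f x) * norm (g x)) \<le> norm ((norm (f x))\<^sup>2 + (norm (g x))\<^sup>2)"
    by auto
qed

lemma Cauchy_Schwarz_L2:
  assumes "L2 M f" "L2 M g"
  shows "(\<integral>x. norm (f x) * norm (g x) \<partial>M) \<le> l2 M f * l2 M g"
proof -
  have [measurable]: "f \<in> borel_measurable M" "g \<in> borel_measurable M" using assms by (auto simp: L2_def)
  have "(\<integral>\<^sup>+x. ennreal (norm (f x)) * ennreal (norm (g x)) \<partial>M)\<^sup>2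
      \<le> (\<integral>\<^sup>+x. ennreal (norm (f x)) ^ 2 \<partial>M) * (\<integral>\<^sup>+x. ennreal (norm (g x)) ^ 2 \<partial>M)"
    by (rule Cauchy_Schwarz_nn_integral) auto
  also have "(\<integral>\<^sup>+x. ennreal (norm (f x)) * ennreal (norm (g x)) \<partial>M)
      = ennreal (\<integral>x. norm (f x) * norm (g x) \<partial>M)"
    by (subst nn_integral_eq_integral[symmetric])
       (use L2_norm_mult[OF assms] in \<open>auto simp: ennreal_mult\<close>)
  also have "(\<integral>\<^sup>+x. ennreal (norm (f x)) ^ 2 \<partial>M) = ennreal ((l2 M f)\<^sup>2)"
    unfolding l2_power2
    by (subst nn_integral_eq_integral[symmetric]) (use assms in \<open>auto simp: L2_def ennreal_power\<close>)
  also have "(\<integral>\<^sup>+x. ennreal (norm (g x)) ^ 2 \<partial>M) = ennreal ((l2 M g)\<^sup>2)"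
    unfolding l2_power2
    by (subst nn_integral_eq_integral[symmetric]) (use assms in \<open>auto simp: L2_def ennreal_power\<close>)
  finally have "(\<integral>x. norm (f x) * norm (g x) \<partial>M)\<^sup>2 \<le> (l2 M f * l2 M g)\<^sup>2"
    by (simp add: ennreal_power power_mult_distrib flip: ennreal_mult)
  then show ?thesis
    by (rule power2_le_imp_le) (simp add: l2_nonneg)
qed

lemma L2_inner: "L2 M f \<Longrightarrow> L2 M g \<Longrightarrow> integrable M (\<lambda>x. f x \<bullet> g x)"
  by (rule Bochner_Integration.integrable_bound[OF L2_norm_mult[of M f g]])
     (auto simp: L2_def Cauchy_Schwarz_ineq2)

lemma L2_inner_le:
  assumes "L2 M f" "L2 M g" shows "\<bar>\<integral>x. f x \<bullet> g x \<partial>M\<bar> \<le> l2 M f * l2 M g"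
proof -
  have "\<bar>\<integral>x. f x \<bullet> g x \<partial>M\<bar> \<le> (\<integral>x. \<bar>f x \<bullet> g x\<bar> \<partial>M)"
    using integral_norm_bound[of M "\<lambda>x. f x \<bullet> g x"] by simp
  also have "\<dots> \<le> (\<integral>x. norm (f x) * norm (g x) \<partial>M)"
    by (intro integral_mono)
       (use L2_inner[OF assms] L2_norm_mult[OF assms] in \<open>auto simp: Cauchy_Schwarz_ineq2\<close>)
  finally show ?thesis using Cauchy_Schwarz_L2[OF assms] by linarith
qed

lemma L2_add:
  assumes "L2 M f" "L2 M g" shows "L2 M (\<lambda>x. f x + g x)"
proof -
  have [measurable]: "f \<in> borel_measurable M" "g \<in> borel_measurable M" using assms by (auto simp: L2_def)
  have "integrable M (\<lambda>x. (norm (f x))\<^sup>2 + 2 * (f x \<bullet> g x) + (norm (g x))\<^sup>2)"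
    using assms L2_inner[OF assms] by (auto simp: L2_def)
  then show ?thesis
    by (simp add: L2_def power2_norm_eq_inner inner_add_left inner_add_right inner_commute algebra_simps)
qed

lemma L2_scaleR: "L2 M f \<Longrightarrow> L2 M (\<lambda>x. c *\<^sub>R f x)"
  by (auto simp: L2_def power_mult_distrib)

lemma L2_zero: "L2 M (\<lambda>x. 0)"
  by (simp add: L2_def)

lemma L2_minus: "L2 M f \<Longrightarrow> L2 M (\<lambda>x. - f x)"
  by (auto simp: L2_def)

lemma L2_diff: "L2 M f \<Longrightarrow> L2 M g \<Longrightarrow> L2 M (\<lambda>x. f x - g x)"
  using L2_add[of M f "\<lambda>x. - g x"] L2_minus[of M g] by simp

lemma L2_sum: "(\<And>i. i \<in> I \<Longrightarrow> L2 M (f i)) \<Longrightarrow> L2 M (\<lambda>x. \<Sum>i\<in>I. f i x)"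
  by (induction I rule: infinite_finite_induct) (auto intro: L2_zero L2_add)

lemma l2_scaleR: "l2 M (\<lambda>x. c *\<^sub>R f x) = \<bar>c\<bar> * l2 M f"
  by (simp add: l2_def power_mult_distrib real_sqrt_mult)

lemma l2_commute: "l2 M (\<lambda>x. f x - g x) = l2 M (\<lambda>x. g x - f x)"
  by (simp add: l2_def norm_minus_commute)

lemma l2_triangle:
  assumes "L2 M f" "L2 M g" shows "l2 M (\<lambda>x. f x + g x) \<le> l2 M f + l2 M g"
proof -
  have "(l2 M (\<lambda>x. f x + g x))\<^sup>2 = (\<integral>x. (norm (f x))\<^sup>2 + 2 * (f x \<bullet> g x) + (norm (g x))\<^sup>2 \<partial>M)"
    unfolding l2_power2
    by (simp add: power2_norm_eq_inner inner_add_left inner_add_right inner_commute algebra_simps)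
  also have "\<dots> = (l2 M f)\<^sup>2 + 2 * (\<integral>x. f x \<bullet> g x \<partial>M) + (l2 M g)\<^sup>2"
    using assms L2_inner[OF assms] unfolding l2_power2 by (subst Bochner_Integration.integral_add) (auto simp: L2_def)
  also have "\<dots> \<le> (l2 M f)\<^sup>2 + 2 * (l2 M f * l2 M g) + (l2 M g)\<^sup>2"
    using L2_inner_le[OF assms] by linarith
  finally have "(l2 M (\<lambda>x. f x + g x))\<^sup>2 \<le> (l2 M f + l2 M g)\<^sup>2"
    by (simp add: power2_sum algebra_simps)
  then show ?thesis by (rule power2_le_imp_le) (simp add: l2_nonneg)
qed

lemma l2_triangle_diff:
  assumes "L2 M f" "L2 M g" "L2 M h"
  shows "l2 M (\<lambda>x. f x - h x) \<le> l2 M (\<lambda>x. f x - g x) + l2 M (\<lambda>x. g x - h x)"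
  using l2_triangle[OF L2_diff[OF assms(1,2)] L2_diff[OF assms(2,3)]] by simp

lemma l2_mono:
  assumes "g \<in> borel_measurable M" "L2 M f" "AE x in M. norm (g x) \<le> norm (f x)"
  shows "l2 M g \<le> l2 M f"
  unfolding l2_def
  by (intro real_sqrt_le_mono integral_mono_AE L2_integrable L2_bound[OF assms] assms(2))
     (use assms(3) in \<open>auto intro!: power_mono\<close>)

lemma l2_cong_AE:
  assumes "f \<in> borel_measurable M" "g \<in> borel_measurable M" "AE x in M. f x = g x"
  shows "l2 M f = l2 M g"
  unfolding l2_def by (intro arg_cong[where f=sqrt] integral_cong_AE) (use assms in auto)

lemma l2_eq_0: 
  assumes "L2 M f" shows "l2 M f = 0 \<longleftrightarrow> (AE x in M. f x = 0)"
  using assms by (simp add: l2_def L2_def integral_nonneg_eq_0_iff_AE)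

lemma l2_inner_tendsto:
  assumes "\<And>k. L2 M (f k)" "L2 M g" "L2 M h" "(\<lambda>k. l2 M (\<lambda>x. f k x - g x)) \<longlonglongrightarrow> 0"
  shows "(\<lambda>k. \<integral>x. f k x \<bullet> h x \<partial>M) \<longlonglongrightarrow> (\<integral>x. g x \<bullet> h x \<partial>M)"
proof (rule Lim_transform2[OF tendsto_const], rule Lim_null_comparison)
  show "(\<lambda>k. l2 M (\<lambda>x. f k x - g x) * l2 M h) \<longlonglongrightarrow> 0"
    using tendsto_mult_right[OF assms(4), of "l2 M h"] by simp
  have "norm ((\<integral>x. g x \<bullet> h x \<partial>M) - (\<integral>x. f k x \<bullet> h x \<partial>M)) \<le> l2 M (\<lambda>x. f k x - g x) * l2 M h" for k
    using L2_inner_le[OF L2_diff[OF assms(1)[of k] assms(2)] assms(3)] L2_inner[OF assms(1)[of k] assms(3)]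
      L2_inner[OF assms(2,3)]
    by (simp add: inner_diff_left abs_minus_commute)
  then show "\<forall>\<^sub>F k in sequentially. norm ((\<integral>x. g x \<bullet> h x \<partial>M) - (\<integral>x. f k x \<bullet> h x \<partial>M)) \<le> l2 M (\<lambda>x. f k x - g x) * l2 M h"
    by simp
qed

lemma l2_tendsto:
  assumes "\<And>k. L2 M (f k)" "L2 M g" "(\<lambda>k. l2 M (\<lambda>x. f k x - g x)) \<longlonglongrightarrow> 0"
  shows "(\<lambda>k. l2 M (f k)) \<longlonglongrightarrow> l2 M g"
proof (rule Lim_transform2[OF tendsto_const], rule Lim_null_comparison[OF _ assms(3)])
  have "norm (l2 M g - l2 M (f k)) \<le> l2 M (\<lambda>x. f k x - g x)" for k
    using l2_triangle[OF assms(2) L2_diff[OF assms(1)[of k] assms(2)]]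
          l2_triangle[OF assms(1)[of k] L2_diff[OF assms(2) assms(1)[of k]]]
    by (simp add: l2_commute[of M g])
  then show "\<forall>\<^sub>F k in sequentially. norm (l2 M g - l2 M (f k)) \<le> l2 M (\<lambda>x. f k x - g x)" by simp
qed

lemma l2_AE_subseq:
  assumes "\<And>k. L2 M (f k)" "L2 M g" "(\<lambda>k. l2 M (\<lambda>x. f k x - g x)) \<longlonglongrightarrow> 0"
  shows "\<exists>r::nat\<Rightarrow>nat. strict_mono r \<and> (AE x in M. (\<lambda>k. f (r k) x) \<longlonglongrightarrow> g x)"
proof -
  have "\<exists>r::nat\<Rightarrow>nat. strict_mono r \<and> (AE x in M. (\<lambda>k. (norm (f (r k) x - g x))\<^sup>2) \<longlonglongrightarrow> 0)"
  proof (rule tendsto_L1_AE_subseq)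
    show "integrable M (\<lambda>x. (norm (f k x - g x))\<^sup>2)" for k
      using L2_diff[OF assms(1)[of k] assms(2)] by (simp add: L2_def)
    show "(\<lambda>k. \<integral>x. norm ((norm (f k x - g x))\<^sup>2) \<partial>M) \<longlonglongrightarrow> 0"
      using tendsto_power[OF assms(3), of 2] by (simp add: l2_power2)
  qed
  moreover have "(\<lambda>k. f (r k) x) \<longlonglongrightarrow> g x" if "(\<lambda>k. (norm (f (r k) x - g x))\<^sup>2) \<longlonglongrightarrow> 0" for r :: "nat \<Rightarrow> nat" and x
    using that by (metis LIM_zero_cancel tendsto_norm_zero_iff tendsto_null_power zero_less_numeral power_tendsto_0_iff)
  ultimately show ?thesis by (metis (mono_tags, lifting) AE_mp AE_I2)
qed

text \<open>The bound may vary with \<open>k\<close>: constant bounds give completeness, convergent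
  ones carry a norm inequality from approximating test functions to their limit.\<close>

lemma L2_Fatou:
  assumes "\<And>k. L2 M (f k)" "g \<in> borel_measurable M" "AE x in M. (\<lambda>k. f k x) \<longlonglongrightarrow> g x"
    and "\<And>k. l2 M (f k) \<le> C k" "C \<longlonglongrightarrow> C'"
  shows "L2 M g \<and> l2 M g \<le> C'"
proof -
  have C0: "0 \<le> C k" for k using assms(4)[of k] l2_nonneg[of M "f k"] by linarith
  then have C'0: "0 \<le> C'" using assms(5) by (metis LIMSEQ_le_const)
  have fm[measurable]: "f k \<in> borel_measurable M" for k using assms(1) by (auto simp: L2_def)
  note assms(2)[measurable]
  have "(\<integral>\<^sup>+x. ennreal ((norm (g x))\<^sup>2) \<partial>M) = (\<integral>\<^sup>+x. liminf (\<lambda>k. ennreal ((norm (f k x))\<^sup>2)) \<partial>M)"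
  proof (rule nn_integral_cong_AE, use assms(3) in eventually_elim)
    fix x assume "(\<lambda>k. f k x) \<longlonglongrightarrow> g x"
    then have "(\<lambda>k. ennreal ((norm (f k x))\<^sup>2)) \<longlonglongrightarrow> ennreal ((norm (g x))\<^sup>2)"
      by (intro tendsto_intros)
    then show "ennreal ((norm (g x))\<^sup>2) = liminf (\<lambda>k. ennreal ((norm (f k x))\<^sup>2))"
      by (rule lim_imp_Liminf[OF trivial_limit_sequentially, symmetric])
  qed
  also have "\<dots> \<le> liminf (\<lambda>k. \<integral>\<^sup>+x. ennreal ((norm (f k x))\<^sup>2) \<partial>M)"
    by (rule nn_integral_liminf) simp
  also have "\<dots> \<le> liminf (\<lambda>k. ennreal ((C k)\<^sup>2))"
  proof (rule Liminf_mono, rule always_eventually, rule allI)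
    fix k
    have "(\<integral>\<^sup>+x. ennreal ((norm (f k x))\<^sup>2) \<partial>M) = ennreal ((l2 M (f k))\<^sup>2)"
      unfolding l2_power2 using assms(1)[of k] by (intro nn_integral_eq_integral) (auto simp: L2_def)
    also have "\<dots> \<le> ennreal ((C k)\<^sup>2)"
      using assms(4)[of k] by (intro ennreal_leI power_mono) (auto simp: l2_nonneg)
    finally show "(\<integral>\<^sup>+x. ennreal ((norm (f k x))\<^sup>2) \<partial>M) \<le> ennreal ((C k)\<^sup>2)" .
  qed
  also have "\<dots> = ennreal (C'\<^sup>2)"
    by (rule lim_imp_Liminf) (auto intro!: tendsto_intros assms(5))
  finally have le: "(\<integral>\<^sup>+x. ennreal ((norm (g x))\<^sup>2) \<partial>M) \<le> ennreal (C'\<^sup>2)" .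
  then have i: "integrable M (\<lambda>x. (norm (g x))\<^sup>2)"
    by (intro integrableI_bounded) (auto simp: le_less_trans)
  have "(l2 M g)\<^sup>2 \<le> C'\<^sup>2"
    unfolding l2_power2 using le nn_integral_eq_integral[OF i] by (simp add: ennreal_le_iff)
  then have "l2 M g \<le> C'" using C'0 by (rule power2_le_imp_le)
  then show ?thesis using i assms(2) by (simp add: L2_def)
qed

section \<open>Completeness and dominated convergence over a finite measure\<close>

lemma (in finite_measure) L2_L1:
  assumes "L2 M f" shows "integrable M f" "(\<integral>x. norm (f x) \<partial>M) \<le> l2 M f * sqrt (measure M (space M))"
proof -
  have 1: "L2 M (\<lambda>x. 1::real)" by (simp add: L2_def)
  show "integrable M f"
    using L2_norm_mult[OF assms 1] assms by (simp add: L2_def integrable_norm_iff)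
  show "(\<integral>x. norm (f x) \<partial>M) \<le> l2 M f * sqrt (measure M (space M))"
    using Cauchy_Schwarz_L2[OF assms 1] by (simp add: l2_def)
qed

text \<open>Over a finite measure an L2 Cauchy sequence is L1 Cauchy, so some subsequence converges
  almost everywhere. Fatou's lemma, applied to the differences from a fixed late member, turns this
  into L2 convergence of the whole sequence.\<close>

theorem (in finite_measure) L2_complete:
  fixes f :: "nat \<Rightarrow> 'a \<Rightarrow> 'b::euclidean_space"
  assumes L: "\<And>k. L2 M (f k)"
    and C: "\<And>e. e > 0 \<Longrightarrow> \<exists>N. \<forall>i\<ge>N. \<forall>j\<ge>N. l2 M (\<lambda>x. f i x - f j x) < e"
  obtains g where "L2 M g" "(\<lambda>k. l2 M (\<lambda>x. f k x - g x)) \<longlonglongrightarrow> 0"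
proof -
  have [measurable]: "f k \<in> borel_measurable M" for k using L by (auto simp: L2_def)
  obtain r where r: "strict_mono r" "AE x in M. Cauchy (\<lambda>i. f (r i) x)"
  proof (rule cauchy_L1_AE_cauchy_subseq[of M f])
    show "integrable M (f k)" for k using L2_L1(1)[OF L] .
    fix e :: real assume e: "e > 0"
    define K where "K = sqrt (measure M (space M)) + 1"
    have K: "K > 0" by (simp add: K_def add_nonneg_pos)
    then obtain N where N: "\<And>i j. i \<ge> N \<Longrightarrow> j \<ge> N \<Longrightarrow> l2 M (\<lambda>x. f i x - f j x) < e / K"
      using C[of "e / K"] e by auto
    show "\<exists>N. \<forall>i\<ge>N. \<forall>j\<ge>N. (LINT x|M. norm (f i x - f j x)) < e"
    proof (intro exI[of _ N] allI impI)
      fix i j assume ij: "i \<ge> N" "j \<ge> N"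
      have "(LINT x|M. norm (f i x - f j x)) \<le> l2 M (\<lambda>x. f i x - f j x) * sqrt (measure M (space M))"
        by (rule L2_L1(2)[OF L2_diff[OF L L]])
      also have "\<dots> \<le> l2 M (\<lambda>x. f i x - f j x) * K"
        by (rule mult_left_mono) (auto simp: K_def l2_nonneg)
      also have "\<dots> < e" using N[OF ij] K by (simp add: field_simps)
      finally show "(LINT x|M. norm (f i x - f j x)) < e" .
    qed
  qed
  \<comment> \<open>The value 0 off the set of convergence makes \<open>g\<close> a measurable
    function defined everywhere.\<close>
  define g where "g x = (if Cauchy (\<lambda>i. f (r i) x) then lim (\<lambda>i. f (r i) x) else 0)" for x
  have gm[measurable]: "g \<in> borel_measurable M" unfolding g_def by measurable
  have lim: "AE x in M. (\<lambda>i. f (r i) x) \<longlonglongrightarrow> g x"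
    using r(2) by eventually_elim (auto simp: g_def Cauchy_convergent_iff convergent_LIMSEQ_iff)
  have key: "\<exists>N. \<forall>k\<ge>N. L2 M (\<lambda>x. f k x - g x) \<and> l2 M (\<lambda>x. f k x - g x) \<le> e" if e: "e > 0" for e
  proof -
    obtain N where N: "\<And>i j. i \<ge> N \<Longrightarrow> j \<ge> N \<Longrightarrow> l2 M (\<lambda>x. f i x - f j x) < e"
      using C[OF e] by auto
    have "L2 M (\<lambda>x. f k x - g x) \<and> l2 M (\<lambda>x. f k x - g x) \<le> e" if k: "k \<ge> N" for k
    proof (rule L2_Fatou[where f = "\<lambda>i x. f k x - f (r (i + N)) x" and C = "\<lambda>_. e"])
      show "L2 M (\<lambda>x. f k x - f (r (i + N)) x)" for i by (rule L2_diff[OF L L])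
      show "AE x in M. (\<lambda>i. f k x - f (r (i + N)) x) \<longlonglongrightarrow> f k x - g x"
        using lim by eventually_elim (intro tendsto_intros LIMSEQ_ignore_initial_segment)
      show "l2 M (\<lambda>x. f k x - f (r (i + N)) x) \<le> e" for i
        using N[OF k, of "r (i + N)"] seq_suble[OF r(1), of "i + N"] by simp
    qed auto
    then show ?thesis by blast
  qed
  obtain N where "L2 M (\<lambda>x. f N x - g x)" using key[of 1] by auto
  then have "L2 M (\<lambda>x. f N x - (f N x - g x))" by (rule L2_diff[OF L])
  then have g: "L2 M g" by simp
  show thesis
  proof (rule that[OF g])
    show "(\<lambda>k. l2 M (\<lambda>x. f k x - g x)) \<longlonglongrightarrow> 0"
    proof (rule LIMSEQ_I)
      fix e :: real assume "e > 0"
      then obtain N where "\<forall>k\<ge>N. l2 M (\<lambda>x. f k x - g x) \<le> e / 2" using key[of "e / 2"] by auto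
      then show "\<exists>no. \<forall>n\<ge>no. norm (l2 M (\<lambda>x. f n x - g x) - 0) < e"
        using \<open>e > 0\<close> by (intro exI[of _ N]) (auto simp: l2_nonneg intro: le_less_trans)
    qed
  qed
qed

lemma (in finite_measure) L2_bounded:
  assumes "f \<in> borel_measurable M" "AE x in M. norm (f x) \<le> B" shows "L2 M f"
  unfolding L2_def
proof
  show "integrable M (\<lambda>x. (norm (f x))\<^sup>2)"
    by (rule integrable_const_bound[where B = "B\<^sup>2"]) (use assms in \<open>auto intro!: power_mono\<close>)
qed fact

lemma (in finite_measure) l2_dominated_tendsto:
  assumes "\<And>k. f k \<in> borel_measurable M" "g \<in> borel_measurable M"
    and "\<And>x. x \<in> space M \<Longrightarrow> (\<lambda>k. f k x) \<longlonglongrightarrow> g x" "\<And>k x. x \<in> space M \<Longrightarrow> norm (f k x) \<le> B"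
  shows "(\<lambda>k. l2 M (\<lambda>x. f k x - g x)) \<longlonglongrightarrow> 0"
proof -
  note assms(1,2)[measurable]
  have gB: "norm (g x) \<le> B" if "x \<in> space M" for x
    by (rule tendsto_upperbound[OF tendsto_norm[OF assms(3)[OF that]]]) (use assms(4) that in auto)
  have "(\<lambda>k. \<integral>x. (norm (f k x - g x))\<^sup>2 \<partial>M) \<longlonglongrightarrow> (\<integral>x. 0 \<partial>M)"
  proof (rule integral_dominated_convergence[where w = "\<lambda>x. (2 * B)\<^sup>2"])
    show "AE x in M. (\<lambda>k. (norm (f k x - g x))\<^sup>2) \<longlonglongrightarrow> 0"
    proof (rule AE_I2)
      fix x assume "x \<in> space M"
      from tendsto_norm_zero[OF LIM_zero[OF assms(3)[OF this]]]
      show "(\<lambda>k. (norm (f k x - g x))\<^sup>2) \<longlonglongrightarrow> 0" by (rule tendsto_null_power) simp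
    qed
    show "AE x in M. norm ((norm (f k x - g x))\<^sup>2) \<le> (2 * B)\<^sup>2" for k
    proof (rule AE_I2)
      fix x assume "x \<in> space M"
      then have "norm (f k x - g x) \<le> 2 * B"
        using norm_triangle_ineq4[of "f k x" "g x"] assms(4)[of x k] gB[of x] by linarith
      from power_mono[OF this norm_ge_zero, of 2]
      show "norm ((norm (f k x - g x))\<^sup>2) \<le> (2 * B)\<^sup>2" by simp
    qed
  qed auto
  then show ?thesis unfolding l2_def by (auto intro!: tendsto_eq_intros)
qed

section \<open>Riesz representation and the method of continuity\<close>

text \<open>Elements of H01 are functions and not classes of functions equal almost everywhere. The
  norm may therefore vanish on nonzero functions, and limits are only required to exist.\<close>

locale function_semi_inner =
  fixes V :: "('x \<Rightarrow> real) \<Rightarrow> bool" and ip :: "('x \<Rightarrow> real) \<Rightarrow> ('x \<Rightarrow> real) \<Rightarrow> real"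
    and nm :: "('x \<Rightarrow> real) \<Rightarrow> real"
  assumes V_zero: "V (\<lambda>x. 0)"
    and V_add: "V y \<Longrightarrow> V z \<Longrightarrow> V (\<lambda>x. y x + z x)"
    and V_scale: "V y \<Longrightarrow> V (\<lambda>x. c * y x)"
    and ip_add: "V y \<Longrightarrow> V z \<Longrightarrow> V w \<Longrightarrow> ip (\<lambda>x. y x + z x) w = ip y w + ip z w"
    and ip_scale: "V y \<Longrightarrow> V w \<Longrightarrow> ip (\<lambda>x. c * y x) w = c * ip y w"
    and ip_sym: "V y \<Longrightarrow> V w \<Longrightarrow> ip y w = ip w y"
    and ip_nonneg: "V y \<Longrightarrow> 0 \<le> ip y y"
    and nm_eq: "nm y = sqrt (ip y y)"
    and complete: "(\<And>k::nat. V (f k)) \<Longrightarrow> (\<And>e. e > 0 \<Longrightarrow> \<exists>N. \<forall>i\<ge>N. \<forall>j\<ge>N. nm (\<lambda>x. f i x - f j x) < e)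
       \<Longrightarrow> \<exists>g. V g \<and> (\<lambda>k. nm (\<lambda>x. f k x - g x)) \<longlonglongrightarrow> 0"
begin

text \<open>Has the same shape as \<open>Hminus1\<close>, so that for \<open>H01\<close> the two
  notions coincide by unfolding.\<close>

definition bounded_functional :: "(('x \<Rightarrow> real) \<Rightarrow> real) \<Rightarrow> bool" where
  "bounded_functional F \<longleftrightarrow>
     (\<forall>y z. V y \<longrightarrow> V z \<longrightarrow> F (\<lambda>x. y x + z x) = F y + F z) \<and>
     (\<forall>c y. V y \<longrightarrow> F (\<lambda>x. c * y x) = c * F y) \<and>
     (\<exists>M. \<forall>z. V z \<longrightarrow> \<bar>F z\<bar> \<le> M * nm z)"

lemma functional_diff:
  assumes "bounded_functional F" "V y" "V z" shows "F (\<lambda>x. y x - z x) = F y - F z"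
proof -
  have "F (\<lambda>x. y x + (-1) * z x) = F y + F (\<lambda>x. (-1) * z x)"
    using assms V_scale[of z "-1"] unfolding bounded_functional_def by blast
  moreover have "F (\<lambda>x. (-1) * z x) = (-1) * F z" using assms unfolding bounded_functional_def by blast
  ultimately show ?thesis by simp
qed

lemma functional_bound:
  assumes "bounded_functional F" shows "\<exists>M\<ge>0. \<forall>z. V z \<longrightarrow> \<bar>F z\<bar> \<le> M * nm z"
proof -
  obtain M where M: "\<forall>z. V z \<longrightarrow> \<bar>F z\<bar> \<le> M * nm z" using assms unfolding bounded_functional_def by blast
  have "\<bar>F z\<bar> \<le> \<bar>M\<bar> * nm z" if z: "V z" for z
  proof -
    have "M * nm z \<le> \<bar>M\<bar> * nm z" by (rule mult_right_mono) (auto simp: nm_eq ip_nonneg z)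
    then show ?thesis using M z by fastforce
  qed
  then show ?thesis by (intro exI[of _ "\<bar>M\<bar>"]) auto
qed

lemma V_diff: "V y \<Longrightarrow> V z \<Longrightarrow> V (\<lambda>x. y x - z x)"
  using V_add[of y "\<lambda>x. (-1) * z x"] V_scale[of z "-1"] by simp

lemma nm_nonneg: "V y \<Longrightarrow> 0 \<le> nm y"
  by (simp add: nm_eq ip_nonneg)

lemma nm_power2: "V y \<Longrightarrow> (nm y)\<^sup>2 = ip y y"
  by (simp add: nm_eq ip_nonneg)

lemma ip_add_right: "V y \<Longrightarrow> V z \<Longrightarrow> V w \<Longrightarrow> ip w (\<lambda>x. y x + z x) = ip w y + ip w z"
  using ip_add[of y z w] by (simp add: ip_sym V_add)

lemma ip_scale_right: "V y \<Longrightarrow> V w \<Longrightarrow> ip w (\<lambda>x. c * y x) = c * ip w y"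
  using ip_scale[of y w c] by (simp add: ip_sym V_scale)

lemma ip_combination:
  assumes "V y" "V z"
  shows "ip (\<lambda>x. y x + t * z x) (\<lambda>x. y x + t * z x) = ip y y + 2 * t * ip y z + t\<^sup>2 * ip z z"
  using assms by (simp add: ip_add ip_add_right ip_scale ip_scale_right V_add V_scale ip_sym[of z y] power2_eq_square algebra_simps)

text \<open>A parabola through the origin that never becomes negative is flat there. At
  \<open>t = - b / s\<close> the linear term wins as soon as \<open>2 * s\<close> exceeds the
  leading coefficient.\<close>

lemma nonneg_quadratic:
  fixes a b :: real
  assumes "\<And>t. 0 \<le> 2 * t * b + t\<^sup>2 * a" shows "b = 0"
proof (rule ccontr)
  assume b: "b \<noteq> 0"
  define s where "s = \<bar>a\<bar> + 1"
  have s: "s > 0" "a < 2 * s" by (auto simp: s_def)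
  have "0 \<le> 2 * (- b / s) * b + (- b / s)\<^sup>2 * a" by (rule assms)
  also have "\<dots> = (b / s)\<^sup>2 * (a - 2 * s)" using s by (simp add: power2_eq_square field_simps)
  also have "\<dots> < 0" using b s by (intro mult_pos_neg) auto
  finally show False by simp
qed

lemma ip_le_nm: assumes "V y" "V z" shows "\<bar>ip y z\<bar> \<le> nm y * nm z"
proof -
  have "(ip y z)\<^sup>2 \<le> ip y y * ip z z"
  proof (cases "ip z z = 0")
    \<comment> \<open>The form is only semidefinite, so a null vector need not be zero. The
      quadratic in \<open>t\<close> is then affine, and an affine function bounded below is
      constant: its slope vanishes, since otherwise a suitable \<open>t\<close> would give the value
      -1.\<close>
    case True
    have "0 \<le> ip y y + 2 * t * ip y z" for t
      using ip_combination[OF assms, of t] ip_nonneg[OF V_add[OF assms(1) V_scale[OF assms(2), of t]]] True by simp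
    moreover have "ip y y + 2 * (- (ip y y + 1) / (2 * ip y z)) * ip y z = - 1" if "ip y z \<noteq> 0"
      using that by (simp add: field_simps)
    ultimately have "ip y z = 0" by (metis neg_0_le_iff_le not_one_le_zero)
    then show ?thesis using True by simp
  next
    case False
    then have p: "ip z z > 0" using ip_nonneg[OF assms(2)] by linarith
    \<comment> \<open>The quadratic in \<open>t\<close> is smallest at
      \<open>t = - ip y z / ip z z\<close>.\<close>
    have "0 \<le> ip y y + 2 * (- ip y z / ip z z) * ip y z + (- ip y z / ip z z)\<^sup>2 * ip z z"
      using ip_combination[OF assms, of "- ip y z / ip z z"]
        ip_nonneg[OF V_add[OF assms(1) V_scale[OF assms(2), of "- ip y z / ip z z"]]] by simp
    also have "\<dots> = ip y y - (ip y z)\<^sup>2 / ip z z" using p by (simp add: power2_eq_square field_simps)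
    finally show ?thesis using p by (simp add: field_simps)
  qed
  then have "\<bar>ip y z\<bar>\<^sup>2 \<le> (nm y * nm z)\<^sup>2" by (simp add: power_mult_distrib nm_power2 assms)
  then show ?thesis by (rule power2_le_imp_le) (simp add: nm_nonneg assms)
qed

lemma nm_triangle: assumes "V y" "V z" shows "nm (\<lambda>x. y x + z x) \<le> nm y + nm z"
proof (rule power2_le_imp_le)
  have "(nm (\<lambda>x. y x + z x))\<^sup>2 = ip y y + 2 * ip y z + ip z z"
    using ip_combination[OF assms, of 1] nm_power2[OF V_add[OF assms]] by simp
  also have "\<dots> \<le> (nm y)\<^sup>2 + 2 * (nm y * nm z) + (nm z)\<^sup>2"
    using ip_le_nm[OF assms] by (simp add: nm_power2 assms)
  finally show "(nm (\<lambda>x. y x + z x))\<^sup>2 \<le> (nm y + nm z)\<^sup>2" by (simp add: power2_sum)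
qed (simp add: nm_nonneg assms)

lemma nm_scale: "V y \<Longrightarrow> nm (\<lambda>x. c * y x) = \<bar>c\<bar> * nm y"
  by (simp add: nm_eq ip_scale ip_scale_right V_scale real_sqrt_mult flip: power2_eq_square mult.assoc)

lemma nm_commute: assumes "V y" "V z" shows "nm (\<lambda>x. y x - z x) = nm (\<lambda>x. z x - y x)"
  using nm_scale[OF V_diff[OF assms], of "-1"] by simp

lemma bounded_form_tendsto:
  assumes "\<And>k. V (f k)" "V g" "(\<lambda>k. nm (\<lambda>x. f k x - g x)) \<longlonglongrightarrow> 0" "bounded_functional F"
  shows "(\<lambda>k. F (f k)) \<longlonglongrightarrow> F g"
proof -
  obtain M where M: "\<And>z. V z \<Longrightarrow> \<bar>F z\<bar> \<le> M * nm z" using functional_bound[OF assms(4)] by blast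
  show ?thesis
  proof (rule Lim_transform2[OF tendsto_const], rule Lim_null_comparison)
    show "(\<lambda>k. M * nm (\<lambda>x. f k x - g x)) \<longlonglongrightarrow> 0" using tendsto_mult_right_zero[OF assms(3)] by simp
    have "norm (F g - F (f k)) \<le> M * nm (\<lambda>x. f k x - g x)" for k
      using M[OF V_diff[OF assms(1)[of k] assms(2)]] functional_diff[OF assms(4) assms(1)[of k] assms(2)]
      by (simp add: abs_minus_commute)
    then show "\<forall>\<^sub>F k in sequentially. norm (F g - F (f k)) \<le> M * nm (\<lambda>x. f k x - g x)" by simp
  qed
qed

lemma bounded_functional_ip: assumes "V w" shows "bounded_functional (ip w)" "bounded_functional (\<lambda>y. ip y w)"
proof -
  have "\<bar>ip w z\<bar> \<le> nm w * nm z" "\<bar>ip z w\<bar> \<le> nm w * nm z" if "V z" for z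
    using ip_le_nm[OF assms that] ip_le_nm[OF that assms] by (auto simp: mult.commute)
  then show "bounded_functional (ip w)" "bounded_functional (\<lambda>y. ip y w)"
    unfolding bounded_functional_def using assms
    by (auto simp: ip_add_right ip_scale_right ip_add ip_scale)
qed

text \<open>The representing element is the minimiser of \<open>ip y y - 2 * F y\<close>; minimising sequences
  are Cauchy by the parallelogram law.\<close>

lemma riesz:
  assumes F: "bounded_functional F" shows "\<exists>y. V y \<and> (\<forall>z. V z \<longrightarrow> ip y z = F z)"
proof -
  have Fadd: "F (\<lambda>x. y x + z x) = F y + F z" if "V y" "V z" for y z
    using F that unfolding bounded_functional_def by blast
  have Fscale: "F (\<lambda>x. c * y x) = c * F y" if "V y" for c y
    using F that unfolding bounded_functional_def by blast
  obtain M where M: "\<And>z. V z \<Longrightarrow> \<bar>F z\<bar> \<le> M * nm z" using functional_bound[OF F] by blast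
  define J where "J y = ip y y - 2 * F y" for y
  have Jb: "- M\<^sup>2 \<le> J y" if "V y" for y
  proof -
    have "J y \<ge> (nm y)\<^sup>2 - 2 * (M * nm y)" using M[OF that] by (simp add: J_def nm_power2 that)
    moreover have "(nm y)\<^sup>2 - 2 * (M * nm y) + M\<^sup>2 = (nm y - M)\<^sup>2" by (simp add: power2_diff)
    ultimately show ?thesis using zero_le_power2[of "nm y - M"] by linarith
  qed
  define d where "d = (INF y\<in>{y. V y}. J y)"
  have bdd: "bdd_below (J ` {y. V y})" using Jb by (intro bdd_belowI2[where m = "- M\<^sup>2"]) auto
  have dJ: "d \<le> J y" if "V y" for y unfolding d_def using bdd that by (auto intro: cINF_lower)
  have "\<exists>y. V y \<and> J y < d + inverse (real (Suc k))" for k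
  proof (rule ccontr)
    assume "\<not> ?thesis"
    then have "d + inverse (real (Suc k)) \<le> d" unfolding d_def
      by (intro cINF_greatest) (use V_zero in \<open>auto simp: not_less d_def\<close>)
    then show False by simp
  qed
  then obtain f where f: "\<And>k. V (f k)" "\<And>k. J (f k) < d + inverse (real (Suc k))" by metis
  have par: "(nm (\<lambda>x. y x - z x))\<^sup>2 \<le> 2 * (J y - d) + 2 * (J z - d)" if y: "V y" and z: "V z" for y z
  proof -
    define m where "m = (\<lambda>x. (1/2) * (y x + z x))"
    have m: "V m" unfolding m_def by (intro V_scale V_add y z)
    have "ip m m = (1/4) * (ip y y + 2 * ip y z + ip z z)"
      using ip_combination[OF y z, of 1] ip_scale[OF V_add[OF y z] m, of "1/2"]
        ip_scale_right[OF V_add[OF y z] V_add[OF y z], of "1/2"] unfolding m_def by simp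
    moreover have "F m = (1/2) * (F y + F z)" unfolding m_def using Fscale[OF V_add[OF y z], of "1/2"] Fadd[OF y z] by simp
    moreover have "(nm (\<lambda>x. y x - z x))\<^sup>2 = ip y y - 2 * ip y z + ip z z"
      using ip_combination[OF y z, of "-1"] nm_power2[OF V_diff[OF y z]] by simp
    ultimately have "(nm (\<lambda>x. y x - z x))\<^sup>2 = 2 * J y + 2 * J z - 4 * J m" by (simp add: J_def)
    then show ?thesis using dJ[OF m] by simp
  qed
  have "\<exists>N. \<forall>i\<ge>N. \<forall>j\<ge>N. nm (\<lambda>x. f i x - f j x) < e" if "e > 0" for e
  proof -
    obtain N where N: "inverse (real (Suc N)) < e\<^sup>2 / 4" using reals_Archimedean[of "e\<^sup>2 / 4"] \<open>e > 0\<close> by auto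
    have "nm (\<lambda>x. f i x - f j x) < e" if "i \<ge> N" "j \<ge> N" for i j
    proof -
      have "J (f k) - d < e\<^sup>2 / 4" if "k \<ge> N" for k
      proof -
        have "inverse (real (Suc k)) \<le> inverse (real (Suc N))" using that by (simp add: divide_simps)
        then show ?thesis using N f(2)[of k] by linarith
      qed
      from this[OF that(1)] this[OF that(2)] have "2 * (J (f i) - d) + 2 * (J (f j) - d) < e\<^sup>2"
        by argo
      then have "(nm (\<lambda>x. f i x - f j x))\<^sup>2 < e\<^sup>2"
        using par[OF f(1)[of i] f(1)[of j]] by (rule order_le_less_trans[rotated])
      then show ?thesis using \<open>e > 0\<close> by (simp add: power_less_imp_less_base)
    qed
    then show ?thesis by blast
  qed
  then obtain y where y: "V y" "(\<lambda>k. nm (\<lambda>x. f k x - y x)) \<longlonglongrightarrow> 0" using complete[of f] f(1) by blast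
  \<comment> \<open>Convergence is available for bounded functionals only, so the quadratic term
    \<open>ip (f k) (f k)\<close> is expressed by the squared distance to \<open>y\<close> and the
    linear term \<open>ip (f k) y\<close>.\<close>
  have "(\<lambda>k. J (f k)) \<longlonglongrightarrow> J y"
  proof -
    have "(\<lambda>k. (nm (\<lambda>x. f k x - y x))\<^sup>2 + 2 * ip (f k) y - ip y y - 2 * F (f k))
        \<longlonglongrightarrow> 0\<^sup>2 + 2 * ip y y - ip y y - 2 * F y"
      by (intro tendsto_intros y(2) bounded_form_tendsto[OF f(1) y(1) y(2)] F bounded_functional_ip y(1))
    moreover have "(nm (\<lambda>x. f k x - y x))\<^sup>2 + 2 * ip (f k) y - ip y y = ip (f k) (f k)" for k
      using ip_combination[OF f(1)[of k] y(1), of "-1"] nm_power2[OF V_diff[OF f(1)[of k] y(1)]] by simp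
    ultimately show ?thesis by (simp add: J_def)
  qed
  moreover have "(\<lambda>k. d + inverse (real (Suc k))) \<longlonglongrightarrow> d + 0"
    by (intro tendsto_intros LIMSEQ_inverse_real_of_nat)
  ultimately have Jd: "J y \<le> d" using f(2)
    by (intro LIMSEQ_le[of "\<lambda>k. J (f k)" _ "\<lambda>k. d + inverse (real (Suc k))"]) (auto intro: less_imp_le)
  have "ip y z = F z" if z: "V z" for z
  proof -
    \<comment> \<open>This is the difference between the values of \<open>J\<close> at
      \<open>y + t * z\<close> and at the minimiser \<open>y\<close>.\<close>
    have "0 \<le> 2 * t * (ip y z - F z) + t\<^sup>2 * ip z z" for t
    proof -
      have "J y \<le> J (\<lambda>x. y x + t * z x)" using Jd dJ[OF V_add[OF y(1) V_scale[OF z]]] by (rule order_trans)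
      then show ?thesis
        using Fadd[OF y(1) V_scale[OF z, of t]] Fscale[OF z, of t] ip_combination[OF y(1) z, of t]
        by (simp add: J_def algebra_simps)
    qed
    from nonneg_quadratic[OF this] show ?thesis by simp
  qed
  then show ?thesis using y(1) by blast
qed

text \<open>A Neumann series for \<open>S + D\<close>: solve \<open>S\<close> for \<open>F\<close>
  minus \<open>D\<close> of the previous iterate. The a priori bound makes this a contraction with
  factor \<open>C * K\<close>, hence at most one half.\<close>

lemma continuity_step:
  assumes S: "\<And>y. V y \<Longrightarrow> bounded_functional (S y)" "\<And>z. V z \<Longrightarrow> bounded_functional (\<lambda>y. S y z)"
    and D: "\<And>y. V y \<Longrightarrow> bounded_functional (D y)" "\<And>z. V z \<Longrightarrow> bounded_functional (\<lambda>y. D y z)"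
    and Db: "\<And>y z. V y \<Longrightarrow> V z \<Longrightarrow> \<bar>D y z\<bar> \<le> K * nm y * nm z"
    and ap: "\<And>y M. V y \<Longrightarrow> M \<ge> 0 \<Longrightarrow> (\<And>z. V z \<Longrightarrow> \<bar>S y z\<bar> \<le> M * nm z) \<Longrightarrow> nm y \<le> C * M"
    and K: "K \<ge> 0" "C \<ge> 0" "C * K \<le> 1/2"
    and surj: "\<And>F. bounded_functional F \<Longrightarrow> \<exists>y. V y \<and> (\<forall>z. V z \<longrightarrow> S y z = F z)"
    and F: "bounded_functional F"
  shows "\<exists>y. V y \<and> (\<forall>z. V z \<longrightarrow> S y z + D y z = F z)"
proof -
  have bfd: "bounded_functional (\<lambda>z. F z - D y z)" if "V y" for y
  proof -
    obtain M where M: "\<And>z. V z \<Longrightarrow> \<bar>F z\<bar> \<le> M * nm z" using functional_bound[OF F] by blast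
    have "\<bar>F z - D y z\<bar> \<le> (M + K * nm y) * nm z" if "V z" for z
      using M[OF that] Db[OF \<open>V y\<close> that] by (simp add: algebra_simps)
    then show ?thesis using F D(1)[OF that] unfolding bounded_functional_def
      by (intro conjI allI impI exI[of _ "M + K * nm y"]) (auto simp: algebra_simps)
  qed
  \<comment> \<open>Solutions are determined only up to functions of norm zero, so a choice is made
    and no linearity of \<open>G\<close> is claimed. The contraction property comes from applying
    the a priori bound to the difference of two iterates.\<close>
  define G where "G y = (SOME w. V w \<and> (\<forall>z. V z \<longrightarrow> S w z = F z - D y z))" for y
  have G: "V (G y)" "\<And>z. V z \<Longrightarrow> S (G y) z = F z - D y z" if "V y" for y
    using someI_ex[OF surj[OF bfd[OF that]]] unfolding G_def by blast+
  define f where "f k = (G ^^ k) (\<lambda>x. 0)" for k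
  have f: "V (f k)" for k by (induction k) (auto simp: f_def V_zero G)
  have fS: "f (Suc k) = G (f k)" for k by (simp add: f_def)
  have contr: "nm (\<lambda>x. f (Suc (Suc k)) x - f (Suc k) x) \<le> (1/2) * nm (\<lambda>x. f (Suc k) x - f k x)" for k
  proof -
    let ?e = "\<lambda>x. f (Suc k) x - f k x"
    have e: "V ?e" by (intro V_diff f)
    have "nm (\<lambda>x. f (Suc (Suc k)) x - f (Suc k) x) \<le> C * (K * nm ?e)"
    proof (rule ap)
      show "V (\<lambda>x. f (Suc (Suc k)) x - f (Suc k) x)" by (intro V_diff f)
      show "0 \<le> K * nm ?e" using K(1) nm_nonneg[OF e] by simp
      fix z assume z: "V z"
      have "S (\<lambda>x. f (Suc (Suc k)) x - f (Suc k) x) z = S (f (Suc (Suc k))) z - S (f (Suc k)) z"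
        by (rule functional_diff[OF S(2)[OF z] f f])
      also have "\<dots> = - (D (f (Suc k)) z - D (f k) z)" using G(2)[OF f z, of k] G(2)[OF f z, of "Suc k"] by (simp add: fS)
      also have "\<dots> = - D ?e z" using functional_diff[OF D(2)[OF z] f f, of "Suc k" k] by simp
      finally show "\<bar>S (\<lambda>x. f (Suc (Suc k)) x - f (Suc k) x) z\<bar> \<le> K * nm ?e * nm z"
        using Db[OF e z] by simp
    qed
    also have "\<dots> \<le> (1/2) * nm ?e" using mult_right_mono[OF K(3) nm_nonneg[OF e]] by (simp add: mult.assoc)
    finally show ?thesis .
  qed
  define c where "c = nm (\<lambda>x. f 1 x - f 0 x)"
  have c0: "c \<ge> 0" unfolding c_def by (intro nm_nonneg V_diff f)
  have inc: "nm (\<lambda>x. f (Suc k) x - f k x) \<le> c * (1/2) ^ k" for k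
    by (induction k) (use contr in \<open>auto simp: c_def intro: order_trans\<close>)
  \<comment> \<open>The factor \<open>1 - (1/2) ^ m\<close> makes the right-hand side the exact
    partial sum of the geometric series, so the induction on \<open>m\<close> closes.\<close>
  have far: "nm (\<lambda>x. f (i + m) x - f i x) \<le> 2 * c * (1/2) ^ i * (1 - (1/2) ^ m)" for i m
  proof (induction m)
    case 0
    then show ?case using nm_scale[OF V_zero, of 0] by simp
  next
    case (Suc m)
    have "nm (\<lambda>x. (f (Suc (i + m)) x - f (i + m) x) + (f (i + m) x - f i x)) \<le>
        nm (\<lambda>x. f (Suc (i + m)) x - f (i + m) x) + nm (\<lambda>x. f (i + m) x - f i x)"
      by (intro nm_triangle V_diff f)
    also have "\<dots> \<le> c * (1/2) ^ (i + m) + 2 * c * (1/2) ^ i * (1 - (1/2) ^ m)"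
      using inc[of "i + m"] Suc by linarith
    also have "\<dots> = 2 * c * (1/2) ^ i * (1 - (1/2) ^ Suc m)" by (simp add: power_add field_simps)
    finally show ?case by simp
  qed
  have far2: "nm (\<lambda>x. f j x - f i x) \<le> 2 * c * (1/2) ^ i" if "i \<le> j" for i j
  proof -
    have "nm (\<lambda>x. f j x - f i x) \<le> 2 * c * (1/2) ^ i * (1 - (1/2) ^ (j - i))" using far[of i "j - i"] that by simp
    also have "\<dots> \<le> 2 * c * (1/2) ^ i * 1" using c0 by (intro mult_left_mono) auto
    finally show ?thesis by simp
  qed
  have "\<exists>N. \<forall>i\<ge>N. \<forall>j\<ge>N. nm (\<lambda>x. f i x - f j x) < e" if e: "e > 0" for e
  proof -
    have "(\<lambda>i. 2 * c * (1/2) ^ i) \<longlonglongrightarrow> 2 * c * 0" by (intro tendsto_intros LIMSEQ_power_zero) auto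
    then have "\<forall>\<^sub>F i in sequentially. 2 * c * (1/2) ^ i < e" using e by (auto dest: order_tendstoD(2))
    then obtain N where N: "\<And>i. i \<ge> N \<Longrightarrow> 2 * c * (1/2) ^ i < e" by (auto simp: eventually_sequentially)
    have "nm (\<lambda>x. f i x - f j x) < e" if "i \<ge> N" "j \<ge> N" for i j
    proof (cases "i \<le> j")
      case True
      then show ?thesis using far2[OF True] N[OF that(1)] nm_commute[OF f[of i] f[of j]] by simp
    next
      case False
      then show ?thesis using far2[of j i] N[OF that(2)] by simp
    qed
    then show ?thesis by blast
  qed
  then obtain y where y: "V y" "(\<lambda>k. nm (\<lambda>x. f k x - y x)) \<longlonglongrightarrow> 0" using complete[of f] f by blast
  have "S y z + D y z = F z" if z: "V z" for z
  proof -
    have "(\<lambda>k. S (f (Suc k)) z + D (f k) z) \<longlonglongrightarrow> S y z + D y z"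
      by (intro tendsto_add LIMSEQ_Suc[of "\<lambda>k. S (f k) z"] bounded_form_tendsto[OF f y] S(2)[OF z] D(2)[OF z])
    moreover have "S (f (Suc k)) z + D (f k) z = F z" for k using G(2)[OF f z] by (simp add: fS)
    ultimately have "(\<lambda>k::nat. F z) \<longlonglongrightarrow> S y z + D y z" by simp
    then show ?thesis by (simp add: LIMSEQ_const_iff)
  qed
  then show ?thesis using y(1) by blast
qed

text \<open>The segment runs from the inner product, which is solved by \<open>riesz\<close>, to
  \<open>B\<close>. As \<open>C\<close> is the same at every point of it, all steps can have one
  fixed length and finitely many of them reach the end.\<close>

theorem method_of_continuity:
  assumes B: "\<And>y. V y \<Longrightarrow> bounded_functional (B y)" "\<And>z. V z \<Longrightarrow> bounded_functional (\<lambda>y. B y z)"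
    and Bb: "\<And>y z. V y \<Longrightarrow> V z \<Longrightarrow> \<bar>B y z\<bar> \<le> K * nm y * nm z" and K: "K \<ge> 0"
    and ap: "\<And>t y M. 0 \<le> t \<Longrightarrow> t \<le> 1 \<Longrightarrow> V y \<Longrightarrow> M \<ge> 0 \<Longrightarrow>
        (\<And>z. V z \<Longrightarrow> \<bar>(1 - t) * ip y z + t * B y z\<bar> \<le> M * nm z) \<Longrightarrow> nm y \<le> C * M"
    and C: "C \<ge> 0" and F: "bounded_functional F"
  shows "\<exists>y. V y \<and> (\<forall>z. V z \<longrightarrow> B y z = F z)"
proof -
  have comb: "bounded_functional (\<lambda>z. a * F1 z + b * F2 z)"
    if F12: "bounded_functional F1" "bounded_functional F2" for a b F1 F2
  proof -
    obtain M1 where M1: "\<And>z. V z \<Longrightarrow> \<bar>F1 z\<bar> \<le> M1 * nm z" using functional_bound[OF F12(1)] by blast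
    obtain M2 where M2: "\<And>z. V z \<Longrightarrow> \<bar>F2 z\<bar> \<le> M2 * nm z" using functional_bound[OF F12(2)] by blast
    have "\<bar>a * F1 z + b * F2 z\<bar> \<le> (\<bar>a\<bar> * M1 + \<bar>b\<bar> * M2) * nm z" if "V z" for z
    proof -
      have "\<bar>a * F1 z + b * F2 z\<bar> \<le> \<bar>a\<bar> * \<bar>F1 z\<bar> + \<bar>b\<bar> * \<bar>F2 z\<bar>"
        by (metis abs_mult abs_triangle_ineq)
      also have "\<dots> \<le> \<bar>a\<bar> * (M1 * nm z) + \<bar>b\<bar> * (M2 * nm z)"
        by (intro add_mono mult_left_mono M1 M2 that) auto
      finally show ?thesis by (simp add: algebra_simps)
    qed
    then show ?thesis using F12 unfolding bounded_functional_def
      by (intro conjI allI impI exI[of _ "\<bar>a\<bar> * M1 + \<bar>b\<bar> * M2"]) (auto simp: algebra_simps)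
  qed
  define S where "S t y z = (1 - t) * ip y z + t * B y z" for t y z
  \<comment> \<open>The increment over one step is bounded by \<open>(K + 1) / N\<close>, the 1
    being the contribution of the inner product; \<open>continuity_step\<close> asks for
    \<open>C * (K + 1) / N \<le> 1/2\<close>. The final \<open>+ 1\<close> excludes
    \<open>N = 0\<close>.\<close>
  define N :: nat where "N = nat \<lceil>2 * C * (K + 1)\<rceil> + 1"
  have N: "real N \<ge> 2 * C * (K + 1)" "N > 0" unfolding N_def by linarith+
  have "k \<le> N \<Longrightarrow> \<forall>F. bounded_functional F \<longrightarrow> (\<exists>y. V y \<and> (\<forall>z. V z \<longrightarrow> S (real k / real N) y z = F z))" for k
  proof (induction k)
    case 0
    then show ?case using riesz by (simp add: S_def)
  next
    case (Suc k)
    show ?case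
    proof (intro allI impI)
      fix F assume F: "bounded_functional F"
      let ?s = "real k / real N" and ?D = "\<lambda>y z. (1 / real N) * B y z + (- 1 / real N) * ip y z"
      have s: "0 \<le> ?s" "?s \<le> 1" using Suc.prems N by auto
      have "\<exists>y. V y \<and> (\<forall>z. V z \<longrightarrow> S ?s y z + ?D y z = F z)"
      proof (rule continuity_step[where K = "(K + 1) / real N" and C = C])
        show "bounded_functional (S ?s y)" if "V y" for y
          unfolding S_def[abs_def] using that by (intro comb B(1) bounded_functional_ip(1))
        show "bounded_functional (\<lambda>w. S ?s w y)" if "V y" for y
          unfolding S_def[abs_def] using that by (intro comb B(2) bounded_functional_ip(2))
        show "bounded_functional (?D y)" if "V y" for y
          using that by (intro comb B(1) bounded_functional_ip(1))
        show "bounded_functional (\<lambda>w. ?D w y)" if "V y" for y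
          using that by (intro comb B(2) bounded_functional_ip(2))
        show "\<bar>?D y z\<bar> \<le> (K + 1) / real N * nm y * nm z" if "V y" "V z" for y z
        proof -
          have "?D y z = (B y z - ip y z) / real N" using N by (simp add: field_simps)
          then have "\<bar>?D y z\<bar> = \<bar>B y z - ip y z\<bar> / real N" by simp
          also have "\<dots> \<le> (K * nm y * nm z + nm y * nm z) / real N"
            using Bb[OF that] ip_le_nm[OF that] by (intro divide_right_mono) auto
          finally show ?thesis by (simp add: algebra_simps)
        qed
        show "C * ((K + 1) / real N) \<le> 1/2" using N by (simp add: field_simps)
        show "nm y \<le> C * M" if "V y" "M \<ge> 0" "\<And>z. V z \<Longrightarrow> \<bar>S ?s y z\<bar> \<le> M * nm z" for y M
          by (rule ap[OF s that(1,2)]) (use that(3) in \<open>simp add: S_def\<close>)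
      qed (use Suc K C F in auto)
      moreover have "S ?s y z + ?D y z = S (real (Suc k) / real N) y z" for y z
        using N by (simp add: S_def field_simps)
      ultimately show "\<exists>y. V y \<and> (\<forall>z. V z \<longrightarrow> S (real (Suc k) / real N) y z = F z)" by simp
    qed
  qed
  from this[of N] F N show ?thesis by (simp add: S_def)
qed

end

section \<open>Sobolev inequalities for test functions\<close>

lemma abs_le_nn_integral_derivative:
  fixes w :: "real \<Rightarrow> real"
  assumes d: "\<And>t. (w has_real_derivative w' t) (at t)" and c: "continuous_on UNIV w'"
    and z: "\<And>t. t \<le> - R \<Longrightarrow> w t = 0"
  shows "ennreal \<bar>w s\<bar> \<le> (\<integral>\<^sup>+t. ennreal \<bar>w' t\<bar> \<partial>lborel)"
proof -
  \<comment> \<open>Wherever \<open>s\<close> lies, this starting point is to its left and inside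
    the region where \<open>w\<close> vanishes.\<close>
  define a where "a = min s (- R)"
  have as: "a \<le> s" "w a = 0" using z by (auto simp: a_def)
  have FTC: "has_bochner_integral lborel (\<lambda>x. w' x * indicator {a..s} x) (w s - w a)"
    by (rule has_bochner_integral_FTC_Icc_real[OF as(1)])
       (use d c in \<open>auto simp: continuous_on_eq_continuous_at\<close>)
  have "ennreal \<bar>w s\<bar> = ennreal (norm (\<integral>x. w' x * indicator {a..s} x \<partial>lborel))"
    using has_bochner_integral_integral_eq[OF FTC] as by simp
  also have "\<dots> \<le> (\<integral>\<^sup>+x. norm (w' x * indicator {a..s} x) \<partial>lborel)"
    using FTC by (intro integral_norm_bound_ennreal) (rule integrable.intros)
  also have "\<dots> \<le> (\<integral>\<^sup>+t. ennreal \<bar>w' t\<bar> \<partial>lborel)"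
    by (intro nn_integral_mono) (auto simp: indicator_def)
  finally show ?thesis .
qed

lemma test_fun_line_bound:
  assumes u: "test_fun \<Omega> u"
  shows "ennreal \<bar>u (c + s *\<^sub>R axis i 1)\<bar> \<le> (\<integral>\<^sup>+r. ennreal \<bar>partial i u (c + r *\<^sub>R axis i 1)\<bar> \<partial>lborel)"
proof -
  have s: "smooth u" using u by (rule test_fun_smooth)
  obtain R where R: "\<And>x. x \<in> tsupport u \<Longrightarrow> norm x \<le> R"
    using compact_imp_bounded[of "tsupport u"] u unfolding test_fun_def bounded_iff by blast
  show ?thesis
  \<comment> \<open>Beyond this distance the triangle inequality places the points of the straight
    path outside the ball that contains the support.\<close>
  proof (rule abs_le_nn_integral_derivative[where R = "\<bar>R\<bar> + norm c + 1" and s = s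
      and w = "\<lambda>t. u (c + t *\<^sub>R axis i 1)" and w' = "\<lambda>t. partial i u (c + t *\<^sub>R axis i 1)"])
    show "((\<lambda>t. u (c + t *\<^sub>R axis i 1)) has_real_derivative partial i u (c + t *\<^sub>R axis i 1)) (at t)" for t
      using smooth_directional[OF s, of "c + t *\<^sub>R axis i 1" i]
        DERIV_shift[of "\<lambda>t. u (c + t *\<^sub>R axis i 1)" _ 0 t] by (simp add: algebra_simps)
    show "continuous_on UNIV (\<lambda>t. partial i u (c + t *\<^sub>R axis i 1))"
      by (rule continuous_on_compose2[OF smooth_continuous[OF smooth_partial[OF s], of UNIV]])
         (auto intro!: continuous_intros)
    fix t :: real assume t: "t \<le> - (\<bar>R\<bar> + norm c + 1)"
    have "\<bar>t\<bar> = norm ((c + t *\<^sub>R axis i (1::real)) - c)" by (simp add: norm_axis_1)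
    also have "\<dots> \<le> norm (c + t *\<^sub>R axis i 1) + norm c" by (rule norm_triangle_ineq4)
    finally have "norm (c + t *\<^sub>R axis i 1) > R" using t by linarith
    then show "u (c + t *\<^sub>R axis i 1) = 0" using R test_fun_eq_0[OF u] by (meson not_less)
  qed
qed

section \<open>Lebesgue integrals in named coordinates\<close>

lemma Basis_vec_real: "(Basis :: (real^'n::finite) set) = (\<lambda>i. axis i 1) ` UNIV"
  by (auto simp: Basis_vec_def)

text \<open>A linear bijection between the standard bases is an isometry that pulls boxes back to
  boxes of equal volume, and boxes determine \<open>lborel\<close>. It identifies
  \<open>real^'n\<close> with a product of real lines, on which Fubini applies.\<close>

lemma lborel_distr_linear_Basis:
  fixes T :: "'a::euclidean_space \<Rightarrow> 'b::euclidean_space"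
  assumes T: "linear T" and bij: "bij_betw T Basis Basis"
  shows "distr lborel borel T = lborel"
proof (rule lborel_eqI[symmetric])
  have inj: "inj_on T Basis" and im: "T ` Basis = Basis" using bij by (auto simp: bij_betw_def)
  have inner: "T x \<bullet> T b = x \<bullet> b" if b: "b \<in> Basis" for x b
  proof -
    have "T x = T (\<Sum>c\<in>Basis. (x \<bullet> c) *\<^sub>R c)" by (simp add: euclidean_representation)
    also have "\<dots> = (\<Sum>c\<in>Basis. (x \<bullet> c) *\<^sub>R T c)" by (simp add: linear_sum[OF T] linear_scale[OF T])
    finally have "T x \<bullet> T b = (\<Sum>c\<in>Basis. (x \<bullet> c) * (T c \<bullet> T b))" by (simp add: inner_sum_left)
    also have "\<dots> = (\<Sum>c\<in>Basis. if c = b then x \<bullet> c else 0)"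
    proof (intro sum.cong refl)
      fix c :: 'a assume c: "c \<in> Basis"
      have "T c \<in> Basis" "T b \<in> Basis" "T c = T b \<longleftrightarrow> c = b" using im c b inj by (auto dest: inj_onD)
      then show "(x \<bullet> c) * (T c \<bullet> T b) = (if c = b then x \<bullet> c else 0)" by (simp add: inner_Basis)
    qed
    finally show ?thesis using b by simp
  qed
  have Tm[measurable]: "T \<in> borel_measurable borel"
    using linear_continuous_on[of T UNIV] T by (intro borel_measurable_continuous_onI) (simp add: linear_linear)
  fix l u :: 'b assume lu: "\<And>b. b \<in> Basis \<Longrightarrow> l \<bullet> b \<le> u \<bullet> b"
  define l' where "l' = (\<Sum>b\<in>Basis. (l \<bullet> T b) *\<^sub>R b)"
  define u' where "u' = (\<Sum>b\<in>Basis. (u \<bullet> T b) *\<^sub>R b)"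
  have lu': "l' \<bullet> b = l \<bullet> T b" "u' \<bullet> b = u \<bullet> T b" if "b \<in> Basis" for b
    using that by (simp_all add: l'_def u'_def)
  have "x \<in> T -` box l u \<longleftrightarrow> x \<in> box l' u'" for x
  proof -
    have "x \<in> T -` box l u \<longleftrightarrow> (\<forall>c\<in>T ` Basis. l \<bullet> c < T x \<bullet> c \<and> T x \<bullet> c < u \<bullet> c)" by (simp add: mem_box im)
    also have "\<dots> \<longleftrightarrow> x \<in> box l' u'" by (auto simp: mem_box inner lu')
    finally show ?thesis .
  qed
  then have "emeasure (distr lborel borel T) (box l u) = emeasure lborel (box l' u')"
    by (subst emeasure_distr) (auto intro!: arg_cong[where f = "emeasure lborel"])
  also have "\<dots> = (\<Prod>b\<in>Basis. (u' - l') \<bullet> b)"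
    using lu im by (intro emeasure_lborel_box) (auto simp: lu')
  also have "(\<Prod>b\<in>Basis. (u' - l') \<bullet> b) = (\<Prod>b\<in>Basis. (u - l) \<bullet> T b)"
    by (intro prod.cong) (auto simp: inner_diff_left lu')
  also have "\<dots> = (\<Prod>b\<in>Basis. (u - l) \<bullet> b)" by (rule prod.reindex_bij_betw[OF bij])
  finally show "emeasure (distr lborel borel T) (box l u) = (\<Prod>b\<in>Basis. (u - l) \<bullet> b)" .
qed simp

lemma nn_integral_lborel_linear_Basis:
  fixes T :: "'a::euclidean_space \<Rightarrow> 'b::euclidean_space"
  assumes T: "linear T" "bij_betw T Basis Basis" and f: "f \<in> borel_measurable borel"
  shows "(\<integral>\<^sup>+x. f x \<partial>lborel) = (\<integral>\<^sup>+p. f (T p) \<partial>lborel)"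
proof -
  have "T \<in> borel_measurable borel"
    using linear_continuous_on[of T UNIV] T(1) by (intro borel_measurable_continuous_onI) (simp add: linear_linear)
  then show ?thesis using f nn_integral_distr[of T lborel borel f] by (simp add: lborel_distr_linear_Basis[OF T])
qed

lemma nn_integral_lborel_pair:
  fixes f :: "'a::euclidean_space \<times> 'b::euclidean_space \<Rightarrow> ennreal"
  assumes "f \<in> borel_measurable borel"
  shows "(\<integral>\<^sup>+p. f p \<partial>lborel) = (\<integral>\<^sup>+s. \<integral>\<^sup>+t. f (s, t) \<partial>lborel \<partial>lborel)"
  unfolding lborel_prod[symmetric]
  by (subst lborel.nn_integral_fst[symmetric]) (use assms in \<open>auto simp: lborel_prod\<close>)

text \<open>The index type is an arbitrary type with two elements, so its coordinates must be named
  before the integral can be split.\<close>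

lemma nn_integral_lborel_2:
  fixes f :: "real^'n::finite \<Rightarrow> ennreal" and i j :: 'n
  assumes ij: "i \<noteq> j" "UNIV = {i, j}" and f: "f \<in> borel_measurable borel"
  shows "(\<integral>\<^sup>+x. f x \<partial>lborel) = (\<integral>\<^sup>+s. \<integral>\<^sup>+t. f (s *\<^sub>R axis i 1 + t *\<^sub>R axis j 1) \<partial>lborel \<partial>lborel)"
proof -
  define T :: "real \<times> real \<Rightarrow> real^'n" where "T p = fst p *\<^sub>R axis i 1 + snd p *\<^sub>R axis j 1" for p
  have T[measurable]: "T \<in> borel_measurable borel"
    unfolding T_def by (intro borel_measurable_continuous_onI continuous_intros)
  have "linear T" by (rule linearI) (simp_all add: T_def algebra_simps)
  moreover have "bij_betw T Basis Basis"
    unfolding Basis_vec_real ij(2) using ij(1) by (auto simp: bij_betw_def Basis_prod_def T_def axis_eq_axis)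
  ultimately have "(\<integral>\<^sup>+x. f x \<partial>lborel) = (\<integral>\<^sup>+p. f (T p) \<partial>lborel)"
    using f by (rule nn_integral_lborel_linear_Basis)
  also have "\<dots> = (\<integral>\<^sup>+s. \<integral>\<^sup>+t. f (T (s, t)) \<partial>lborel \<partial>lborel)"
    using f by (intro nn_integral_lborel_pair) simp
  finally show ?thesis by (simp add: T_def)
qed

lemma nn_integral_lborel_3:
  fixes f :: "real^'n::finite \<Rightarrow> ennreal" and i j k :: 'n
  assumes ijk: "i \<noteq> j" "i \<noteq> k" "j \<noteq> k" "UNIV = {i, j, k}" and f: "f \<in> borel_measurable borel"
  shows "(\<integral>\<^sup>+x. f x \<partial>lborel) =
    (\<integral>\<^sup>+r. \<integral>\<^sup>+s. \<integral>\<^sup>+t. f (r *\<^sub>R axis i 1 + s *\<^sub>R axis j 1 + t *\<^sub>R axis k 1) \<partial>lborel \<partial>lborel \<partial>lborel)"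
proof -
  define T :: "real \<times> real \<times> real \<Rightarrow> real^'n"
    where "T p = fst p *\<^sub>R axis i 1 + fst (snd p) *\<^sub>R axis j 1 + snd (snd p) *\<^sub>R axis k 1" for p
  have T: "(\<lambda>q. T (g q)) \<in> borel_measurable borel" if "continuous_on UNIV g" for g :: "'z::topological_space \<Rightarrow> _"
    unfolding T_def by (intro borel_measurable_continuous_onI continuous_intros that)
  have fT: "(\<lambda>q. f (T (g q))) \<in> borel_measurable borel" if "continuous_on UNIV g" for g :: "'z::topological_space \<Rightarrow> _"
    using measurable_compose[OF T[OF that] f] .
  have "linear T" by (rule linearI) (simp_all add: T_def algebra_simps)
  moreover have "bij_betw T Basis Basis"
    unfolding Basis_vec_real ijk(4) using ijk(1-3)
    by (auto simp: bij_betw_def Basis_prod_def T_def axis_eq_axis image_Un image_image zero_prod_def)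
  ultimately have "(\<integral>\<^sup>+x. f x \<partial>lborel) = (\<integral>\<^sup>+p. f (T p) \<partial>lborel)"
    using f by (rule nn_integral_lborel_linear_Basis)
  also have "\<dots> = (\<integral>\<^sup>+r. \<integral>\<^sup>+q. f (T (r, q)) \<partial>lborel \<partial>lborel)"
    by (intro nn_integral_lborel_pair fT continuous_intros)
  also have "\<dots> = (\<integral>\<^sup>+r. \<integral>\<^sup>+s. \<integral>\<^sup>+t. f (T (r, s, t)) \<partial>lborel \<partial>lborel \<partial>lborel)"
    by (intro nn_integral_cong nn_integral_lborel_pair fT continuous_intros)
  finally show ?thesis by (simp add: T_def)
qed

text \<open>Two applications of Cauchy-Schwarz: in the pair \<open>(r, s)\<close> to split off
  \<open>H\<close>, then in \<open>t\<close> to separate \<open>F\<close> from \<open>G\<close>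
  inside \<open>K\<close>. After the second one the variables \<open>r\<close> and \<open>s\<close>
  occur in different factors.\<close>

lemma (in sigma_finite_measure) loomis_whitney:
  fixes F G H :: "'a \<times> 'a \<Rightarrow> ennreal"
  assumes [measurable]: "F \<in> borel_measurable (M \<Otimes>\<^sub>M M)" "G \<in> borel_measurable (M \<Otimes>\<^sub>M M)" "H \<in> borel_measurable (M \<Otimes>\<^sub>M M)"
  shows "(\<integral>\<^sup>+r. \<integral>\<^sup>+s. \<integral>\<^sup>+t. F (s, t) * G (r, t) * H (r, s) \<partial>M \<partial>M \<partial>M)\<^sup>2
    \<le> (\<integral>\<^sup>+s. \<integral>\<^sup>+t. (F (s, t))\<^sup>2 \<partial>M \<partial>M) * (\<integral>\<^sup>+r. \<integral>\<^sup>+t. (G (r, t))\<^sup>2 \<partial>M \<partial>M) * (\<integral>\<^sup>+r. \<integral>\<^sup>+s. (H (r, s))\<^sup>2 \<partial>M \<partial>M)"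
proof -
  define K where "K p = (\<integral>\<^sup>+t. F (snd p, t) * G (fst p, t) \<partial>M)" for p
  have [measurable]: "K \<in> borel_measurable (M \<Otimes>\<^sub>M M)" unfolding K_def by measurable
  have "(\<integral>\<^sup>+r. \<integral>\<^sup>+s. \<integral>\<^sup>+t. F (s, t) * G (r, t) * H (r, s) \<partial>M \<partial>M \<partial>M)
      = (\<integral>\<^sup>+r. \<integral>\<^sup>+s. K (r, s) * H (r, s) \<partial>M \<partial>M)"
    unfolding K_def by (intro nn_integral_cong) (simp add: nn_integral_multc)
  also have "\<dots> = (\<integral>\<^sup>+p. K p * H p \<partial>(M \<Otimes>\<^sub>M M))"
    by (subst nn_integral_fst[symmetric]) auto
  finally have "(\<integral>\<^sup>+r. \<integral>\<^sup>+s. \<integral>\<^sup>+t. F (s, t) * G (r, t) * H (r, s) \<partial>M \<partial>M \<partial>M)\<^sup>2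
      = (\<integral>\<^sup>+p. K p * H p \<partial>(M \<Otimes>\<^sub>M M))\<^sup>2" by simp
  also have "\<dots> \<le> (\<integral>\<^sup>+p. (K p)\<^sup>2 \<partial>(M \<Otimes>\<^sub>M M)) * (\<integral>\<^sup>+p. (H p)\<^sup>2 \<partial>(M \<Otimes>\<^sub>M M))"
    by (rule Cauchy_Schwarz_nn_integral) auto
  also have "(\<integral>\<^sup>+p. (H p)\<^sup>2 \<partial>(M \<Otimes>\<^sub>M M)) = (\<integral>\<^sup>+r. \<integral>\<^sup>+s. (H (r, s))\<^sup>2 \<partial>M \<partial>M)"
    by (subst nn_integral_fst[symmetric]) auto
  also have "(\<integral>\<^sup>+p. (K p)\<^sup>2 \<partial>(M \<Otimes>\<^sub>M M)) = (\<integral>\<^sup>+r. \<integral>\<^sup>+s. (K (r, s))\<^sup>2 \<partial>M \<partial>M)"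
    by (subst nn_integral_fst[symmetric]) auto
  also have "\<dots> \<le> (\<integral>\<^sup>+r. \<integral>\<^sup>+s. (\<integral>\<^sup>+t. (F (s, t))\<^sup>2 \<partial>M) * (\<integral>\<^sup>+t. (G (r, t))\<^sup>2 \<partial>M) \<partial>M \<partial>M)"
    unfolding K_def fst_conv snd_conv by (intro nn_integral_mono Cauchy_Schwarz_nn_integral) auto
  also have "\<dots> = (\<integral>\<^sup>+s. \<integral>\<^sup>+t. (F (s, t))\<^sup>2 \<partial>M \<partial>M) * (\<integral>\<^sup>+r. \<integral>\<^sup>+t. (G (r, t))\<^sup>2 \<partial>M \<partial>M)"
    by (simp add: nn_integral_multc nn_integral_cmult)
  finally show ?thesis by (simp add: mult_right_mono)
qed

text \<open>The Loomis-Whitney factors are square roots of integrals along lines, which are kept as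
  extended reals.\<close>

definition esqrt :: "ennreal \<Rightarrow> ennreal" where
  "esqrt x = (if x = top then top else ennreal (sqrt (enn2real x)))"

lemma esqrt_power2: "(esqrt x)\<^sup>2 = x"
  by (cases x) (auto simp: esqrt_def power2_eq_square simp flip: ennreal_mult)

lemma esqrt_measurable [measurable]: "esqrt \<in> borel_measurable borel"
  unfolding esqrt_def[abs_def] by measurable

lemma le_esqrt: "0 \<le> x \<Longrightarrow> ennreal (x\<^sup>2) \<le> y \<Longrightarrow> ennreal x \<le> esqrt y"
  by (cases y) (auto simp: esqrt_def intro!: ennreal_leI real_le_rsqrt)

section \<open>Gagliardo inequalities in two and three dimensions\<close>

lemma partial_power:
  assumes "smooth v" shows "partial i (\<lambda>x. v x ^ m) x = real m * v x ^ (m - 1) * partial i v x"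
proof -
  have "((\<lambda>s. s ^ m) has_real_derivative real m * v x ^ (m - 1)) (at (v x))"
    by (auto intro!: derivative_eq_intros)
  from grad_comp[OF assms this] show ?thesis by (simp add: grad_def vec_eq_iff)
qed

lemma test_fun_power: "test_fun \<Omega> v \<Longrightarrow> m > 0 \<Longrightarrow> test_fun \<Omega> (\<lambda>x. v x ^ m)"
  by (rule test_fun_support[of \<Omega> v v]) (auto intro: smooth_power test_fun_smooth)

lemma test_fun_nn_integral:
  fixes h :: "real^'n::finite \<Rightarrow> real"
  assumes "open \<Omega>" "test_fun \<Omega> v" "continuous_on UNIV h" "\<And>x. x \<notin> tsupport v \<Longrightarrow> h x = 0"
  shows "integrable (lebesgue_on \<Omega>) h"
    and "(\<integral>\<^sup>+x. ennreal \<bar>h x\<bar> \<partial>lborel) = ennreal (\<integral>x. \<bar>h x\<bar> \<partial>lebesgue_on \<Omega>)"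
proof -
  have K: "compact (tsupport v)" "tsupport v \<subseteq> \<Omega>" using assms(2) by (auto simp: test_fun_def)
  have S: "\<Omega> \<in> sets lebesgue" using assms(1) by simp
  have [measurable]: "h \<in> borel_measurable borel" using assms(3) by (rule borel_measurable_continuous_onI)
  have ih: "integrable lborel h"
    using integrable_continuous_compact_support[OF assms(3) K(1)] assms(4) by blast
  have z: "h x = 0" if "x \<notin> \<Omega>" for x using assms(4) K that by blast
  show "integrable (lebesgue_on \<Omega>) h" using lebesgue_on_lborel(1)[OF S _ z] ih by simp
  have "(\<integral>\<^sup>+x. ennreal \<bar>h x\<bar> \<partial>lborel) = ennreal (\<integral>x. \<bar>h x\<bar> \<partial>lborel)"
    using ih by (intro nn_integral_eq_integral) auto
  then show "(\<integral>\<^sup>+x. ennreal \<bar>h x\<bar> \<partial>lborel) = ennreal (\<integral>x. \<bar>h x\<bar> \<partial>lebesgue_on \<Omega>)"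
    using lebesgue_on_lborel(2)[OF S, of "\<lambda>x. \<bar>h x\<bar>"] z by simp
qed

text \<open>Integrating the derivative along a whole line removes one variable:
  \<open>\<bar>u\<bar>\<close> is bounded by \<open>a\<close>, which depends on \<open>t\<close>
  only, and by \<open>b\<close>, which depends on \<open>s\<close> only. The integral of the product
  \<open>a t * b s\<close> then factorises.\<close>

lemma gagliardo_2:
  fixes u :: "real^'n::finite \<Rightarrow> real" and i j :: 'n
  assumes ij: "i \<noteq> j" "UNIV = {i, j}" and \<Omega>: "open \<Omega>" and u: "test_fun \<Omega> u"
  shows "(\<integral>x. (u x)\<^sup>2 \<partial>lebesgue_on \<Omega>)
    \<le> (\<integral>x. \<bar>partial i u x\<bar> \<partial>lebesgue_on \<Omega>) * (\<integral>x. \<bar>partial j u x\<bar> \<partial>lebesgue_on \<Omega>)"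
proof -
  have s: "smooth u" using u by (rule test_fun_smooth)
  have cp: "continuous_on UNIV (partial m u)" for m by (intro smooth_continuous smooth_partial s)
  have cu: "continuous_on UNIV u" by (intro smooth_continuous s)
  have [measurable]: "partial m u \<in> borel_measurable borel" "u \<in> borel_measurable borel" for m
    using cp cu by (auto intro: borel_measurable_continuous_onI)
  define T where "T s t = s *\<^sub>R axis i (1::real) + t *\<^sub>R axis j 1" for s t
  have T[measurable (raw)]: "(\<lambda>p. T (f p) (g p)) \<in> borel_measurable M"
    if [measurable]: "f \<in> borel_measurable M" "g \<in> borel_measurable M" for f g and M :: "'z measure"
    unfolding T_def by measurable
  define a where "a t = (\<integral>\<^sup>+s. ennreal \<bar>partial i u (T s t)\<bar> \<partial>lborel)" for t
  define b where "b s = (\<integral>\<^sup>+t. ennreal \<bar>partial j u (T s t)\<bar> \<partial>lborel)" for s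
  have [measurable]: "a \<in> borel_measurable borel" "b \<in> borel_measurable borel"
    unfolding a_def b_def by measurable
  have ua: "ennreal \<bar>u (T s t)\<bar> \<le> a t" and ub: "ennreal \<bar>u (T s t)\<bar> \<le> b s" for s t
    using test_fun_line_bound[OF u, of "t *\<^sub>R axis j 1" s i] test_fun_line_bound[OF u, of "s *\<^sub>R axis i 1" t j]
    by (simp_all add: a_def b_def T_def add.commute)
  have A: "(\<integral>\<^sup>+t. a t \<partial>lborel) = ennreal (\<integral>x. \<bar>partial i u x\<bar> \<partial>lebesgue_on \<Omega>)"
  proof -
    have "(\<integral>\<^sup>+t. a t \<partial>lborel) = (\<integral>\<^sup>+s. \<integral>\<^sup>+t. ennreal \<bar>partial i u (T s t)\<bar> \<partial>lborel \<partial>lborel)"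
      unfolding a_def by (rule lborel_pair.Fubini') simp
    also have "\<dots> = (\<integral>\<^sup>+x. ennreal \<bar>partial i u x\<bar> \<partial>lborel)"
      unfolding T_def by (rule nn_integral_lborel_2[OF ij, symmetric]) simp
    finally show ?thesis using test_fun_nn_integral(2)[OF \<Omega> u cp test_fun_eq_0(2)[OF u]] by simp
  qed
  have B: "(\<integral>\<^sup>+s. b s \<partial>lborel) = ennreal (\<integral>x. \<bar>partial j u x\<bar> \<partial>lebesgue_on \<Omega>)"
  proof -
    have "(\<integral>\<^sup>+s. b s \<partial>lborel) = (\<integral>\<^sup>+x. ennreal \<bar>partial j u x\<bar> \<partial>lborel)"
      unfolding b_def T_def by (rule nn_integral_lborel_2[OF ij, symmetric]) simp
    then show ?thesis using test_fun_nn_integral(2)[OF \<Omega> u cp test_fun_eq_0(2)[OF u]] by simp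
  qed
  have "ennreal (\<integral>x. (u x)\<^sup>2 \<partial>lebesgue_on \<Omega>) = (\<integral>\<^sup>+x. ennreal ((u x)\<^sup>2) \<partial>lborel)"
    using test_fun_nn_integral(2)[OF \<Omega> u, of "\<lambda>x. (u x)\<^sup>2"] cu test_fun_eq_0(1)[OF u]
    by (simp add: continuous_on_power)
  also have "\<dots> = (\<integral>\<^sup>+s. \<integral>\<^sup>+t. ennreal ((u (T s t))\<^sup>2) \<partial>lborel \<partial>lborel)"
    unfolding T_def by (rule nn_integral_lborel_2[OF ij]) simp
  also have "\<dots> \<le> (\<integral>\<^sup>+s. \<integral>\<^sup>+t. a t * b s \<partial>lborel \<partial>lborel)"
  proof (intro nn_integral_mono)
    fix s t
    have "ennreal ((u (T s t))\<^sup>2) = ennreal \<bar>u (T s t)\<bar> * ennreal \<bar>u (T s t)\<bar>"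
      by (simp add: power2_eq_square flip: ennreal_mult)
    also have "\<dots> \<le> a t * b s" by (intro mult_mono ua ub) auto
    finally show "ennreal ((u (T s t))\<^sup>2) \<le> a t * b s" .
  qed
  also have "\<dots> = (\<integral>\<^sup>+t. a t \<partial>lborel) * (\<integral>\<^sup>+s. b s \<partial>lborel)"
    by (simp add: nn_integral_multc nn_integral_cmult)
  also have "\<dots> = ennreal ((\<integral>x. \<bar>partial i u x\<bar> \<partial>lebesgue_on \<Omega>) * (\<integral>x. \<bar>partial j u x\<bar> \<partial>lebesgue_on \<Omega>))"
    unfolding A B by (simp add: ennreal_mult)
  finally show ?thesis by (subst (asm) ennreal_le_iff) (auto intro!: mult_nonneg_nonneg)
qed

text \<open>Each of the three line bounds for \<open>\<bar>u\<bar>\<close> omits one variable, so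
  their square roots have the shape required by \<open>loomis_whitney\<close>. Taking
  \<open>u = v ^ 4\<close> avoids fractional powers: the square root of \<open>\<bar>u\<bar>\<close>
  is the square of \<open>v\<close>, and the product of three of them is
  \<open>v ^ 6\<close>.\<close>

lemma gagliardo_3:
  fixes v :: "real^'n::finite \<Rightarrow> real" and i j k :: 'n
  assumes ijk: "i \<noteq> j" "i \<noteq> k" "j \<noteq> k" "UNIV = {i, j, k}" and \<Omega>: "open \<Omega>" and v: "test_fun \<Omega> v"
  shows "(\<integral>x. v x ^ 6 \<partial>lebesgue_on \<Omega>)\<^sup>2
    \<le> (\<Prod>m\<in>UNIV. \<integral>x. \<bar>partial m (\<lambda>x. v x ^ 4) x\<bar> \<partial>lebesgue_on \<Omega>)"
proof -
  define u where "u x = v x ^ 4" for x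
  have u: "test_fun \<Omega> u" unfolding u_def[abs_def] by (rule test_fun_power[OF v]) simp
  have s: "smooth u" "smooth v" using u v by (auto intro: test_fun_smooth)
  have cp: "continuous_on UNIV (partial m u)" for m by (intro smooth_continuous smooth_partial s)
  have cv: "continuous_on UNIV v" by (intro smooth_continuous s)
  have [measurable]: "partial m u \<in> borel_measurable borel" "v \<in> borel_measurable borel" for m
    using cp cv by (auto intro: borel_measurable_continuous_onI)
  define T where "T r s t = r *\<^sub>R axis i (1::real) + s *\<^sub>R axis j 1 + t *\<^sub>R axis k 1" for r s t
  have T[measurable (raw)]: "(\<lambda>p. T (f p) (g p) (h p)) \<in> borel_measurable M"
    if [measurable]: "f \<in> borel_measurable M" "g \<in> borel_measurable M" "h \<in> borel_measurable M"
    for f g h and M :: "'z measure"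
    unfolding T_def by measurable
  define a where "a p = (\<integral>\<^sup>+r. ennreal \<bar>partial i u (T r (fst p) (snd p))\<bar> \<partial>lborel)" for p
  define b where "b p = (\<integral>\<^sup>+s. ennreal \<bar>partial j u (T (fst p) s (snd p))\<bar> \<partial>lborel)" for p
  define c where "c p = (\<integral>\<^sup>+t. ennreal \<bar>partial k u (T (fst p) (snd p) t)\<bar> \<partial>lborel)" for p
  have m[measurable]: "a \<in> borel_measurable (lborel \<Otimes>\<^sub>M lborel)" "b \<in> borel_measurable (lborel \<Otimes>\<^sub>M lborel)"
      "c \<in> borel_measurable (lborel \<Otimes>\<^sub>M lborel)"
    unfolding a_def b_def c_def by measurable
  have bound: "ennreal \<bar>u (T r s t)\<bar> \<le> a (s, t)" "ennreal \<bar>u (T r s t)\<bar> \<le> b (r, t)" "ennreal \<bar>u (T r s t)\<bar> \<le> c (r, s)" for r s t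
    using test_fun_line_bound[OF u, of "s *\<^sub>R axis j 1 + t *\<^sub>R axis k 1" r i]
      test_fun_line_bound[OF u, of "r *\<^sub>R axis i 1 + t *\<^sub>R axis k 1" s j]
      test_fun_line_bound[OF u, of "r *\<^sub>R axis i 1 + s *\<^sub>R axis j 1" t k]
    by (simp_all add: a_def b_def c_def T_def add_ac)
  have int: "(\<integral>\<^sup>+r. \<integral>\<^sup>+s. \<integral>\<^sup>+t. ennreal \<bar>partial m u (T r s t)\<bar> \<partial>lborel \<partial>lborel \<partial>lborel)
      = ennreal (\<integral>x. \<bar>partial m u x\<bar> \<partial>lebesgue_on \<Omega>)" for m
    using nn_integral_lborel_3[OF ijk, of "\<lambda>x. ennreal \<bar>partial m u x\<bar>"]
      test_fun_nn_integral(2)[OF \<Omega> u cp test_fun_eq_0(2)[OF u]] by (simp add: T_def)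
  have A: "(\<integral>\<^sup>+s. \<integral>\<^sup>+t. a (s, t) \<partial>lborel \<partial>lborel) = ennreal (\<integral>x. \<bar>partial i u x\<bar> \<partial>lebesgue_on \<Omega>)"
  proof -
    have "(\<integral>\<^sup>+s. \<integral>\<^sup>+t. a (s, t) \<partial>lborel \<partial>lborel)
        = (\<integral>\<^sup>+s. \<integral>\<^sup>+r. \<integral>\<^sup>+t. ennreal \<bar>partial i u (T r s t)\<bar> \<partial>lborel \<partial>lborel \<partial>lborel)"
      unfolding a_def fst_conv snd_conv by (intro nn_integral_cong lborel_pair.Fubini') simp
    also have "\<dots> = (\<integral>\<^sup>+r. \<integral>\<^sup>+s. \<integral>\<^sup>+t. ennreal \<bar>partial i u (T r s t)\<bar> \<partial>lborel \<partial>lborel \<partial>lborel)"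
      by (rule lborel_pair.Fubini') simp
    finally show ?thesis using int by simp
  qed
  have B: "(\<integral>\<^sup>+r. \<integral>\<^sup>+t. b (r, t) \<partial>lborel \<partial>lborel) = ennreal (\<integral>x. \<bar>partial j u x\<bar> \<partial>lebesgue_on \<Omega>)"
  proof -
    have "(\<integral>\<^sup>+r. \<integral>\<^sup>+t. b (r, t) \<partial>lborel \<partial>lborel)
        = (\<integral>\<^sup>+r. \<integral>\<^sup>+s. \<integral>\<^sup>+t. ennreal \<bar>partial j u (T r s t)\<bar> \<partial>lborel \<partial>lborel \<partial>lborel)"
      unfolding b_def fst_conv snd_conv by (intro nn_integral_cong lborel_pair.Fubini') simp
    then show ?thesis using int by simp
  qed
  have C: "(\<integral>\<^sup>+r. \<integral>\<^sup>+s. c (r, s) \<partial>lborel \<partial>lborel) = ennreal (\<integral>x. \<bar>partial k u x\<bar> \<partial>lebesgue_on \<Omega>)"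
    unfolding c_def fst_conv snd_conv using int by simp
  have nn: "0 \<le> (\<integral>x. v x ^ 6 \<partial>lebesgue_on \<Omega>)" by (intro Bochner_Integration.integral_nonneg) simp
  have "ennreal (\<integral>x. v x ^ 6 \<partial>lebesgue_on \<Omega>) = (\<integral>\<^sup>+x. ennreal (v x ^ 6) \<partial>lborel)"
    using test_fun_nn_integral(2)[OF \<Omega> v, of "\<lambda>x. v x ^ 6"] cv test_fun_eq_0(1)[OF v]
    by (simp add: continuous_on_power)
  also have "\<dots> = (\<integral>\<^sup>+r. \<integral>\<^sup>+s. \<integral>\<^sup>+t. ennreal (v (T r s t) ^ 6) \<partial>lborel \<partial>lborel \<partial>lborel)"
    unfolding T_def by (rule nn_integral_lborel_3[OF ijk]) simp
  also have "\<dots> \<le> (\<integral>\<^sup>+r. \<integral>\<^sup>+s. \<integral>\<^sup>+t. esqrt (a (s, t)) * esqrt (b (r, t)) * esqrt (c (r, s)) \<partial>lborel \<partial>lborel \<partial>lborel)"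
  proof (intro nn_integral_mono)
    fix r s t
    have u4: "\<bar>u x\<bar> = ((v x)\<^sup>2)\<^sup>2" for x by (simp add: u_def flip: power_mult)
    have "ennreal (v (T r s t) ^ 6) = ennreal ((v (T r s t))\<^sup>2) * ennreal ((v (T r s t))\<^sup>2) * ennreal ((v (T r s t))\<^sup>2)"
      by (simp add: power_add[symmetric] flip: ennreal_mult)
    also have "\<dots> \<le> esqrt (a (s, t)) * esqrt (b (r, t)) * esqrt (c (r, s))"
      using bound[of r s t] unfolding u4 by (intro mult_mono le_esqrt) auto
    finally show "ennreal (v (T r s t) ^ 6) \<le> esqrt (a (s, t)) * esqrt (b (r, t)) * esqrt (c (r, s))" .
  qed
  finally have "(ennreal (\<integral>x. v x ^ 6 \<partial>lebesgue_on \<Omega>))\<^sup>2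
      \<le> (\<integral>\<^sup>+r. \<integral>\<^sup>+s. \<integral>\<^sup>+t. esqrt (a (s, t)) * esqrt (b (r, t)) * esqrt (c (r, s)) \<partial>lborel \<partial>lborel \<partial>lborel)\<^sup>2"
    by (rule power_mono) simp
  also have "\<dots> \<le> (\<integral>\<^sup>+s. \<integral>\<^sup>+t. (esqrt (a (s, t)))\<^sup>2 \<partial>lborel \<partial>lborel) * (\<integral>\<^sup>+r. \<integral>\<^sup>+t. (esqrt (b (r, t)))\<^sup>2 \<partial>lborel \<partial>lborel)
      * (\<integral>\<^sup>+r. \<integral>\<^sup>+s. (esqrt (c (r, s)))\<^sup>2 \<partial>lborel \<partial>lborel)"
    by (rule lborel.loomis_whitney[of "\<lambda>p. esqrt (a p)" "\<lambda>p. esqrt (b p)" "\<lambda>p. esqrt (c p)"]) measurable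
  also have "\<dots> = ennreal (\<Prod>m\<in>UNIV. \<integral>x. \<bar>partial m u x\<bar> \<partial>lebesgue_on \<Omega>)"
    unfolding esqrt_power2 A B C ijk(4) using ijk(1-3) by (simp add: ennreal_mult mult.assoc)
  finally have "ennreal ((\<integral>x. v x ^ 6 \<partial>lebesgue_on \<Omega>)\<^sup>2) \<le> ennreal (\<Prod>m\<in>UNIV. \<integral>x. \<bar>partial m u x\<bar> \<partial>lebesgue_on \<Omega>)"
    by (simp add: ennreal_power nn)
  then have "(\<integral>x. v x ^ 6 \<partial>lebesgue_on \<Omega>)\<^sup>2 \<le> (\<Prod>m\<in>UNIV. \<integral>x. \<bar>partial m u x\<bar> \<partial>lebesgue_on \<Omega>)"
    by (subst (asm) ennreal_le_iff) (auto intro!: prod_nonneg)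
  then show ?thesis by (simp add: u_def[abs_def])
qed

section \<open>Sobolev inequalities with explicit constants\<close>

lemma continuous_bounded_L2:
  fixes f :: "'a::euclidean_space \<Rightarrow> 'b::euclidean_space"
  assumes "bounded \<Omega>" "\<Omega> \<in> sets lebesgue" "continuous_on UNIV f"
  shows "L2 (lebesgue_on \<Omega>) f"
proof -
  interpret finite_measure "lebesgue_on \<Omega>" by (intro finite_measure_lebesgue_on bounded_set_imp_lmeasurable assms)
  have "compact (f ` closure \<Omega>)"
    using assms by (intro compact_continuous_image) (auto intro: continuous_on_subset)
  then obtain B where B: "\<And>x. x \<in> closure \<Omega> \<Longrightarrow> norm (f x) \<le> B"
    using compact_imp_bounded[of "f ` closure \<Omega>"] unfolding bounded_iff by blast
  show ?thesis
  proof (rule L2_bounded)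
    show "f \<in> borel_measurable (lebesgue_on \<Omega>)"
      using borel_measurable_continuous_onI[OF assms(3)]
      by (intro measurable_restrict_space1 measurable_completion) simp
    show "AE x in lebesgue_on \<Omega>. norm (f x) \<le> B"
      using B closure_subset by (intro AE_I2) auto
  qed
qed

lemma test_fun_L2:
  assumes "bounded \<Omega>" "open \<Omega>" "test_fun \<Omega>' v"
  shows "L2 (lebesgue_on \<Omega>) v" "L2 (lebesgue_on \<Omega>) (grad v)" "L2 (lebesgue_on \<Omega>) (partial i v)"
  by (intro continuous_bounded_L2 assms smooth_continuous grad_continuous smooth_partial test_fun_smooth[OF assms(3)]
      lmeasurable_open fmeasurableD)+

lemma l2_partial_le:
  assumes "bounded \<Omega>" "open \<Omega>" "test_fun \<Omega>' v"
  shows "l2 (lebesgue_on \<Omega>) (partial i v) \<le> l2 (lebesgue_on \<Omega>) (grad v)"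
proof (rule l2_mono)
  have "partial i v x = grad v x $ i" for x by (simp add: grad_def)
  then show "AE x in lebesgue_on \<Omega>. norm (partial i v x) \<le> norm (grad v x)"
    using component_le_norm_cart[of "grad v _" i] by simp
qed (use test_fun_L2[OF assms] in \<open>auto simp: L2_def\<close>)

lemma integral_partial_power_le:
  assumes "bounded \<Omega>" "open \<Omega>" "test_fun \<Omega>' v"
  shows "(\<integral>x. \<bar>partial i (\<lambda>x. v x ^ m) x\<bar> \<partial>lebesgue_on \<Omega>)
    \<le> real m * sqrt (\<integral>x. v x ^ (2 * (m - 1)) \<partial>lebesgue_on \<Omega>) * l2 (lebesgue_on \<Omega>) (grad v)"
proof -
  let ?M = "lebesgue_on \<Omega>"
  have s: "smooth v" using assms(3) by (rule test_fun_smooth)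
  have L: "L2 ?M (\<lambda>x. v x ^ (m - 1))"
    by (intro continuous_bounded_L2 assms smooth_continuous smooth_power s lmeasurable_open fmeasurableD)
  have "(\<integral>x. \<bar>partial i (\<lambda>x. v x ^ m) x\<bar> \<partial>?M) = real m * (\<integral>x. norm (v x ^ (m - 1)) * norm (partial i v x) \<partial>?M)"
    by (simp add: partial_power[OF s] abs_mult mult.assoc)
  also have "\<dots> \<le> real m * (l2 ?M (\<lambda>x. v x ^ (m - 1)) * l2 ?M (partial i v))"
    by (intro mult_left_mono Cauchy_Schwarz_L2 L test_fun_L2(3)[OF assms]) auto
  also have "\<dots> \<le> real m * (l2 ?M (\<lambda>x. v x ^ (m - 1)) * l2 ?M (grad v))"
    by (intro mult_left_mono l2_partial_le[OF assms]) (auto simp: l2_nonneg)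
  also have "l2 ?M (\<lambda>x. v x ^ (m - 1)) = sqrt (\<integral>x. v x ^ (2 * (m - 1)) \<partial>?M)"
    by (simp add: l2_def flip: power_mult) (simp add: mult.commute)
  finally show ?thesis by (simp add: mult.assoc)
qed

text \<open>Applied to \<open>v ^ Suc m\<close>, the planar Gagliardo inequality raises the exponent
  by two at the price of \<open>(m + 1)\<^sup>2\<close> and two gradient norms. The squared
  factorial collects these prices; the measure of \<Omega> is the value for
  \<open>m = 0\<close>.\<close>

lemma sobolev_2:
  fixes v :: "real^'n::finite \<Rightarrow> real"
  assumes card: "CARD('n) = 2" and \<Omega>: "bounded \<Omega>" "open \<Omega>" and v: "test_fun \<Omega> v"
  shows "(\<integral>x. v x ^ (2 * m) \<partial>lebesgue_on \<Omega>)
    \<le> (fact m)\<^sup>2 * measure lebesgue \<Omega> * l2 (lebesgue_on \<Omega>) (grad v) ^ (2 * m)"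
proof (induction m)
  case 0
  have "measure (lebesgue_on \<Omega>) \<Omega> = measure lebesgue \<Omega>" using \<Omega> by (simp add: measure_restrict_space)
  then show ?case by simp
next
  case (Suc m)
  obtain i j :: 'n where ij: "i \<noteq> j" "UNIV = {i, j}" using card by (auto simp: card_2_iff)
  let ?M = "lebesgue_on \<Omega>" and ?X = "l2 (lebesgue_on \<Omega>) (grad v)"
  let ?J = "\<integral>x. v x ^ (2 * m) \<partial>?M"
  have J: "0 \<le> ?J" by (intro Bochner_Integration.integral_nonneg) simp
  have "(\<integral>x. v x ^ (2 * Suc m) \<partial>?M) = (\<integral>x. (v x ^ Suc m)\<^sup>2 \<partial>?M)"
    by (simp only: power_mult[symmetric] mult.commute)
  also have "\<dots> \<le> (\<integral>x. \<bar>partial i (\<lambda>x. v x ^ Suc m) x\<bar> \<partial>?M) * (\<integral>x. \<bar>partial j (\<lambda>x. v x ^ Suc m) x\<bar> \<partial>?M)"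
    by (rule gagliardo_2[OF ij \<Omega>(2) test_fun_power[OF v]]) simp
  also have "\<dots> \<le> (real (Suc m) * sqrt ?J * ?X) * (real (Suc m) * sqrt ?J * ?X)"
    using integral_partial_power_le[OF \<Omega> v, of _ "Suc m"]
    by (intro mult_mono) (auto simp: l2_nonneg J)
  also have "\<dots> = (real (Suc m))\<^sup>2 * ?X\<^sup>2 * ?J" using J by (simp add: power2_eq_square)
  also have "\<dots> \<le> (real (Suc m))\<^sup>2 * ?X\<^sup>2 * ((fact m)\<^sup>2 * measure lebesgue \<Omega> * ?X ^ (2 * m))"
    by (intro mult_left_mono Suc) auto
  also have "\<dots> = (fact (Suc m))\<^sup>2 * measure lebesgue \<Omega> * ?X ^ (2 * Suc m)"
    by (simp add: power_mult_distrib power2_eq_square power_add algebra_simps)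
  finally show ?case .
qed

text \<open>With \<open>J\<close> the integral of \<open>v ^ 6\<close> and \<open>X\<close> the
  gradient norm, each factor of \<open>gagliardo_3\<close> is at most \<open>4 * sqrt J * X\<close>.
  Hence \<open>J\<^sup>2 \<le> (4 * sqrt J * X) ^ 3\<close>; cancelling gives
  \<open>sqrt J \<le> 64 * X ^ 3\<close>, and 4096 is the square of 64.\<close>

lemma sobolev_3:
  fixes v :: "real^'n::finite \<Rightarrow> real"
  assumes card: "CARD('n) = 3" and \<Omega>: "bounded \<Omega>" "open \<Omega>" and v: "test_fun \<Omega> v"
  shows "(\<integral>x. v x ^ 6 \<partial>lebesgue_on \<Omega>) \<le> 4096 * l2 (lebesgue_on \<Omega>) (grad v) ^ 6"
proof -
  obtain i j k :: 'n where ijk: "i \<noteq> j" "i \<noteq> k" "j \<noteq> k" "UNIV = {i, j, k}" using card by (auto simp: card_3_iff)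
  let ?M = "lebesgue_on \<Omega>"
  define X where "X = l2 (lebesgue_on \<Omega>) (grad v)"
  define J where "J = (\<integral>x. v x ^ 6 \<partial>?M)"
  define q where "q = sqrt J"
  have X: "0 \<le> X" by (simp add: X_def l2_nonneg)
  have "0 \<le> J" unfolding J_def by (intro Bochner_Integration.integral_nonneg) simp
  then have q: "0 \<le> q" "J = q\<^sup>2" by (auto simp: q_def)
  have "J\<^sup>2 \<le> (\<Prod>m\<in>UNIV. \<integral>x. \<bar>partial m (\<lambda>x. v x ^ 4) x\<bar> \<partial>?M)"
    unfolding J_def by (rule gagliardo_3[OF ijk \<Omega>(2) v])
  also have "\<dots> \<le> (\<Prod>m\<in>(UNIV::'n set). 4 * q * X)"
    using integral_partial_power_le[OF \<Omega> v, of _ 4] by (intro prod_mono) (auto simp: q_def J_def X_def)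
  also have "\<dots> = (4 * q * X) ^ 3" using card by simp
  finally have "q * q ^ 3 \<le> (64 * X ^ 3) * q ^ 3"
    by (simp add: q(2) power_mult_distrib algebra_simps flip: power_mult power_add power_Suc)
  then have "q \<le> 64 * X ^ 3"
  proof (cases "q = 0")
    case False
    then show ?thesis using \<open>q * q ^ 3 \<le> (64 * X ^ 3) * q ^ 3\<close> q(1) by (simp add: mult_le_cancel_right)
  qed (use X in simp)
  from power_mono[OF this q(1), of 2] show ?thesis
    by (simp add: q(2)[symmetric] J_def[symmetric] X_def[symmetric] power_mult_distrib flip: power_mult)
qed

section \<open>Calculus in the Sobolev space\<close>

text \<open>Hoelder's inequality with exponents \<open>1 / (1 - \<theta>)\<close> and
  \<open>1 / \<theta>\<close>, arranged so that only plain integrals of \<open>f\<close> and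
  \<open>g\<close> occur. It is Young's inequality for both functions divided by their
  integrals.\<close>

lemma holder_powr:
  fixes f g :: "'a \<Rightarrow> real"
  assumes f: "integrable M f" "\<And>x. 0 \<le> f x" and g: "integrable M g" "\<And>x. 0 \<le> g x"
    and \<theta>: "0 < \<theta>" "\<theta> < 1"
  shows "integrable M (\<lambda>x. f x powr (1 - \<theta>) * g x powr \<theta>)"
    and "(\<integral>x. f x powr (1 - \<theta>) * g x powr \<theta> \<partial>M) \<le> (\<integral>x. f x \<partial>M) powr (1 - \<theta>) * (\<integral>x. g x \<partial>M) powr \<theta>"
proof -
  have [measurable]: "f \<in> borel_measurable M" "g \<in> borel_measurable M" using f g by auto
  have young: "a powr (1 - \<theta>) * b powr \<theta> \<le> (1 - \<theta>) * a + \<theta> * b" if "0 \<le> a" "0 \<le> b" for a b :: real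
  proof (cases "a = 0 \<or> b = 0")
    case False
    then show ?thesis using Youngs_inequality_0[of "1 - \<theta>" \<theta> a b] \<theta> that by auto
  qed (use \<theta> that in auto)
  show int: "integrable M (\<lambda>x. f x powr (1 - \<theta>) * g x powr \<theta>)"
  proof (rule Bochner_Integration.integrable_bound)
    show "integrable M (\<lambda>x. (1 - \<theta>) * f x + \<theta> * g x)" using f g by auto
    show "AE x in M. norm (f x powr (1 - \<theta>) * g x powr \<theta>) \<le> norm ((1 - \<theta>) * f x + \<theta> * g x)"
      using young f(2) g(2) \<theta> by auto
  qed measurable
  define A where "A = (\<integral>x. f x \<partial>M)"
  define B where "B = (\<integral>x. g x \<partial>M)"
  have AB: "0 \<le> A" "0 \<le> B" unfolding A_def B_def using f g by auto
  show "(\<integral>x. f x powr (1 - \<theta>) * g x powr \<theta> \<partial>M) \<le> (\<integral>x. f x \<partial>M) powr (1 - \<theta>) * (\<integral>x. g x \<partial>M) powr \<theta>"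
    unfolding A_def[symmetric] B_def[symmetric]
  proof (cases "A = 0 \<or> B = 0")
    \<comment> \<open>A vanishing integral cannot be normalised, but then the product is zero almost
      everywhere.\<close>
    case True
    then have "(AE x in M. f x = 0) \<or> (AE x in M. g x = 0)"
      using integral_nonneg_eq_0_iff_AE[OF f(1)] integral_nonneg_eq_0_iff_AE[OF g(1)] f g by (auto simp: A_def B_def)
    then have "AE x in M. f x powr (1 - \<theta>) * g x powr \<theta> = 0" by auto
    then have "(\<integral>x. f x powr (1 - \<theta>) * g x powr \<theta> \<partial>M) = 0" by (rule integral_eq_zero_AE)
    then show "(\<integral>x. f x powr (1 - \<theta>) * g x powr \<theta> \<partial>M) \<le> A powr (1 - \<theta>) * B powr \<theta>" by simp
  next
    case False
    then have p: "A > 0" "B > 0" using AB by auto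
    have le: "f x powr (1 - \<theta>) * g x powr \<theta> \<le> A powr (1 - \<theta>) * B powr \<theta> * ((1 - \<theta>) * (f x / A) + \<theta> * (g x / B))" for x
    proof -
      have "f x powr (1 - \<theta>) * g x powr \<theta> = A powr (1 - \<theta>) * B powr \<theta> * ((f x / A) powr (1 - \<theta>) * (g x / B) powr \<theta>)"
        using p f(2)[of x] g(2)[of x] by (simp add: powr_divide)
      also have "\<dots> \<le> A powr (1 - \<theta>) * B powr \<theta> * ((1 - \<theta>) * (f x / A) + \<theta> * (g x / B))"
        using p f(2)[of x] g(2)[of x] by (intro mult_left_mono young) auto
      finally show ?thesis .
    qed
    have "(\<integral>x. f x powr (1 - \<theta>) * g x powr \<theta> \<partial>M)
        \<le> (\<integral>x. A powr (1 - \<theta>) * B powr \<theta> * ((1 - \<theta>) * (f x / A) + \<theta> * (g x / B)) \<partial>M)"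
      by (rule integral_mono[OF int _ le]) (use f g in auto)
    also have "\<dots> = A powr (1 - \<theta>) * B powr \<theta> * ((1 - \<theta>) * (A / A) + \<theta> * (B / B))"
      using f g by (simp add: A_def B_def)
    finally show "(\<integral>x. f x powr (1 - \<theta>) * g x powr \<theta> \<partial>M) \<le> A powr (1 - \<theta>) * B powr \<theta>" using p by simp
  qed
qed

section \<open>The weak gradient as a closed linear operator\<close>

locale bounded_open_set =
  fixes \<Omega> :: "(real^'n::finite) set"
  assumes open_Omega: "open \<Omega>" and bounded_Omega: "bounded \<Omega>"
begin

abbreviation "\<mu> \<equiv> lebesgue_on \<Omega>"

lemma sets_Omega: "\<Omega> \<in> sets lebesgue"
  using open_Omega by simp

sublocale finite_measure \<mu>
  by (intro finite_measure_lebesgue_on bounded_set_imp_lmeasurable bounded_Omega sets_Omega)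

lemma space_mu [simp]: "space \<mu> = \<Omega>"
  by (simp add: space_restrict_space)

lemmas continuous_L2 = continuous_bounded_L2[OF bounded_Omega sets_Omega]
lemmas test_L2 = test_fun_L2[OF bounded_Omega open_Omega]

lemma Lp_2_iff: "Lp 2 \<Omega> f \<longleftrightarrow> L2 \<mu> f"
  by (simp add: Lp_def L2_def)

lemma borel_measurable_vec_iff:
  fixes g :: "'a \<Rightarrow> real^'n"
  shows "g \<in> borel_measurable N \<longleftrightarrow> (\<forall>i. (\<lambda>x. g x $ i) \<in> borel_measurable N)"
  by (subst borel_measurable_euclidean_space) (auto simp: Basis_vec_real inner_axis)

lemma L2_vec_iff:
  fixes g :: "real^'n \<Rightarrow> real^'n"
  shows "(\<forall>i. L2 \<mu> (\<lambda>x. g x $ i)) \<longleftrightarrow> L2 \<mu> g"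
proof
  assume L: "\<forall>i. L2 \<mu> (\<lambda>x. g x $ i)"
  then have "integrable \<mu> (\<lambda>x. \<Sum>i\<in>UNIV. (norm (g x $ i))\<^sup>2)" by (auto simp: L2_def)
  also have "(\<lambda>x. \<Sum>i\<in>UNIV. (norm (g x $ i))\<^sup>2) = (\<lambda>x. (norm (g x))\<^sup>2)"
    by (simp add: norm_vec_def L2_set_def sum_nonneg)
  finally show "L2 \<mu> g" using L by (auto simp: L2_def borel_measurable_vec_iff)
next
  assume L: "L2 \<mu> g"
  show "\<forall>i. L2 \<mu> (\<lambda>x. g x $ i)"
    by (intro allI L2_bound[OF _ L])
       (use L component_le_norm_cart[of "g _"] in \<open>auto simp: L2_def borel_measurable_vec_iff\<close>)
qed

lemma integral_power2_tendsto_iff: "(\<lambda>k. \<integral>x. (norm (f k x))\<^sup>2 \<partial>\<mu>) \<longlonglongrightarrow> 0 \<longleftrightarrow> (\<lambda>k. l2 \<mu> (f k)) \<longlonglongrightarrow> 0"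
proof
  assume "(\<lambda>k. \<integral>x. (norm (f k x))\<^sup>2 \<partial>\<mu>) \<longlonglongrightarrow> 0"
  from tendsto_real_sqrt[OF this] show "(\<lambda>k. l2 \<mu> (f k)) \<longlonglongrightarrow> 0" by (simp add: l2_def)
next
  assume "(\<lambda>k. l2 \<mu> (f k)) \<longlonglongrightarrow> 0"
  from tendsto_power[OF this, of 2] show "(\<lambda>k. \<integral>x. (norm (f k x))\<^sup>2 \<partial>\<mu>) \<longlonglongrightarrow> 0" by (simp add: l2_power2)
qed

lemma H01_grad_iff:
  "H01_grad \<Omega> y g \<longleftrightarrow> L2 \<mu> y \<and> L2 \<mu> g \<and>
     (\<exists>\<phi>. (\<forall>k. test_fun \<Omega> (\<phi> k)) \<and> (\<lambda>k. l2 \<mu> (\<lambda>x. \<phi> k x - y x)) \<longlonglongrightarrow> 0 \<and>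
        (\<lambda>k. l2 \<mu> (\<lambda>x. grad (\<phi> k) x - g x)) \<longlonglongrightarrow> 0)"
  unfolding H01_grad_def Lp_2_iff L2_vec_iff integral_power2_tendsto_iff
    integral_power2_tendsto_iff[of "\<lambda>k x. _ k x - y x :: real", unfolded real_norm_def power2_abs] ..

lemma H01_grad_L2: "H01_grad \<Omega> y g \<Longrightarrow> L2 \<mu> y" "H01_grad \<Omega> y g \<Longrightarrow> L2 \<mu> g"
  by (auto simp: H01_grad_iff)

lemma H01_grad_test: "test_fun \<Omega> \<phi> \<Longrightarrow> H01_grad \<Omega> \<phi> (grad \<phi>)"
  unfolding H01_grad_iff by (auto simp: test_L2 l2_def intro!: exI[of _ "\<lambda>k. \<phi>"])

text \<open>A diagonal argument: for each \<open>k\<close> a test function is chosen within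
  \<open>h k\<close> of the \<open>k\<close>-th pair. Sums, multiples, compositions and completeness
  all obtain membership in H01 from this closedness.\<close>

lemma H01_grad_limit:
  assumes fg: "\<And>k. H01_grad \<Omega> (f k) (g k)" and L: "L2 \<mu> y" "L2 \<mu> G"
    and lim: "(\<lambda>k. l2 \<mu> (\<lambda>x. f k x - y x)) \<longlonglongrightarrow> 0" "(\<lambda>k. l2 \<mu> (\<lambda>x. g k x - G x)) \<longlonglongrightarrow> 0"
  shows "H01_grad \<Omega> y G"
proof -
  define h where "h k = inverse (real (Suc k))" for k
  have h: "h k > 0" for k by (simp add: h_def)
  have h0: "h \<longlonglongrightarrow> 0" unfolding h_def by (rule LIMSEQ_inverse_real_of_nat)
  have "\<exists>\<phi>. test_fun \<Omega> \<phi> \<and> l2 \<mu> (\<lambda>x. \<phi> x - f k x) < h k \<and> l2 \<mu> (\<lambda>x. grad \<phi> x - g k x) < h k" for k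
  proof -
    obtain \<phi> where p: "\<And>j. test_fun \<Omega> (\<phi> j)" "(\<lambda>j. l2 \<mu> (\<lambda>x. \<phi> j x - f k x)) \<longlonglongrightarrow> 0"
      "(\<lambda>j. l2 \<mu> (\<lambda>x. grad (\<phi> j) x - g k x)) \<longlonglongrightarrow> 0" using fg[of k] unfolding H01_grad_iff by blast
    have "\<forall>\<^sub>F j in sequentially. l2 \<mu> (\<lambda>x. \<phi> j x - f k x) < h k \<and> l2 \<mu> (\<lambda>x. grad (\<phi> j) x - g k x) < h k"
      using order_tendstoD(2)[OF p(2) h] order_tendstoD(2)[OF p(3) h] by (rule eventually_conj)
    then show ?thesis using p(1) unfolding eventually_sequentially by blast
  qed
  then have "\<exists>\<phi>. \<forall>k. test_fun \<Omega> (\<phi> k) \<and> l2 \<mu> (\<lambda>x. \<phi> k x - f k x) < h k \<and> l2 \<mu> (\<lambda>x. grad (\<phi> k) x - g k x) < h k"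
    by (intro choice allI)
  then obtain \<phi> where \<phi>: "\<And>k. test_fun \<Omega> (\<phi> k)" "\<And>k. l2 \<mu> (\<lambda>x. \<phi> k x - f k x) < h k"
    "\<And>k. l2 \<mu> (\<lambda>x. grad (\<phi> k) x - g k x) < h k" by blast
  have "(\<lambda>k. l2 \<mu> (\<lambda>x. \<phi> k x - y x)) \<longlonglongrightarrow> 0"
  proof (rule tendsto_sandwich[OF _ _ tendsto_const])
    show "(\<lambda>k. h k + l2 \<mu> (\<lambda>x. f k x - y x)) \<longlonglongrightarrow> 0" using tendsto_add[OF h0 lim(1)] by simp
    have "l2 \<mu> (\<lambda>x. \<phi> k x - y x) \<le> h k + l2 \<mu> (\<lambda>x. f k x - y x)" for k
      using l2_triangle_diff[OF test_L2(1)[OF \<phi>(1)] H01_grad_L2(1)[OF fg] L(1), of k k] \<phi>(2)[of k] by linarith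
    then show "\<forall>\<^sub>F k in sequentially. l2 \<mu> (\<lambda>x. \<phi> k x - y x) \<le> h k + l2 \<mu> (\<lambda>x. f k x - y x)" by simp
  qed (simp add: l2_nonneg)
  moreover have "(\<lambda>k. l2 \<mu> (\<lambda>x. grad (\<phi> k) x - G x)) \<longlonglongrightarrow> 0"
  proof (rule tendsto_sandwich[OF _ _ tendsto_const])
    show "(\<lambda>k. h k + l2 \<mu> (\<lambda>x. g k x - G x)) \<longlonglongrightarrow> 0" using tendsto_add[OF h0 lim(2)] by simp
    have "l2 \<mu> (\<lambda>x. grad (\<phi> k) x - G x) \<le> h k + l2 \<mu> (\<lambda>x. g k x - G x)" for k
      using l2_triangle_diff[OF test_L2(2)[OF \<phi>(1)] H01_grad_L2(2)[OF fg] L(2), of k k] \<phi>(3)[of k] by linarith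
    then show "\<forall>\<^sub>F k in sequentially. l2 \<mu> (\<lambda>x. grad (\<phi> k) x - G x) \<le> h k + l2 \<mu> (\<lambda>x. g k x - G x)" by simp
  qed (simp add: l2_nonneg)
  ultimately show ?thesis using L \<phi>(1) unfolding H01_grad_iff by blast
qed

lemma l2_tendsto_add:
  assumes "\<And>k. L2 \<mu> (f k)" "L2 \<mu> f'" "\<And>k. L2 \<mu> (g k)" "L2 \<mu> g'"
    and "(\<lambda>k. l2 \<mu> (\<lambda>x. f k x - f' x)) \<longlonglongrightarrow> 0" "(\<lambda>k. l2 \<mu> (\<lambda>x. g k x - g' x)) \<longlonglongrightarrow> 0"
  shows "(\<lambda>k. l2 \<mu> (\<lambda>x. (f k x + g k x) - (f' x + g' x))) \<longlonglongrightarrow> 0"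
proof (rule tendsto_sandwich[OF _ _ tendsto_const])
  show "(\<lambda>k. l2 \<mu> (\<lambda>x. f k x - f' x) + l2 \<mu> (\<lambda>x. g k x - g' x)) \<longlonglongrightarrow> 0"
    using tendsto_add[OF assms(5,6)] by simp
  have "l2 \<mu> (\<lambda>x. (f k x + g k x) - (f' x + g' x)) \<le> l2 \<mu> (\<lambda>x. f k x - f' x) + l2 \<mu> (\<lambda>x. g k x - g' x)" for k
    using l2_triangle[OF L2_diff[OF assms(1)[of k] assms(2)] L2_diff[OF assms(3)[of k] assms(4)]]
    by (simp add: algebra_simps)
  then show "\<forall>\<^sub>F k in sequentially. l2 \<mu> (\<lambda>x. (f k x + g k x) - (f' x + g' x))
      \<le> l2 \<mu> (\<lambda>x. f k x - f' x) + l2 \<mu> (\<lambda>x. g k x - g' x)" by simp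
qed (simp add: l2_nonneg)

lemma H01_grad_add:
  assumes "H01_grad \<Omega> y g" "H01_grad \<Omega> z h"
  shows "H01_grad \<Omega> (\<lambda>x. y x + z x) (\<lambda>x. g x + h x)"
proof -
  obtain \<phi> where p: "\<And>j. test_fun \<Omega> (\<phi> j)" "(\<lambda>j. l2 \<mu> (\<lambda>x. \<phi> j x - y x)) \<longlonglongrightarrow> 0"
      "(\<lambda>j. l2 \<mu> (\<lambda>x. grad (\<phi> j) x - g x)) \<longlonglongrightarrow> 0" using assms(1) unfolding H01_grad_iff by blast
  obtain \<psi> where q: "\<And>j. test_fun \<Omega> (\<psi> j)" "(\<lambda>j. l2 \<mu> (\<lambda>x. \<psi> j x - z x)) \<longlonglongrightarrow> 0"
      "(\<lambda>j. l2 \<mu> (\<lambda>x. grad (\<psi> j) x - h x)) \<longlonglongrightarrow> 0" using assms(2) unfolding H01_grad_iff by blast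
  have gr: "grad (\<lambda>x. \<phi> j x + \<psi> j x) = (\<lambda>x. grad (\<phi> j) x + grad (\<psi> j) x)" for j
    using p(1) q(1) by (intro ext grad_add) (auto intro: test_fun_smooth)
  show ?thesis
  proof (rule H01_grad_limit[where f = "\<lambda>j x. \<phi> j x + \<psi> j x" and g = "\<lambda>j x. grad (\<phi> j) x + grad (\<psi> j) x"])
    show "H01_grad \<Omega> (\<lambda>x. \<phi> j x + \<psi> j x) (\<lambda>x. grad (\<phi> j) x + grad (\<psi> j) x)" for j
      using H01_grad_test[OF test_fun_add[OF p(1)[of j] q(1)[of j]]] by (simp add: gr)
    show "L2 \<mu> (\<lambda>x. y x + z x)" "L2 \<mu> (\<lambda>x. g x + h x)"
      by (intro L2_add H01_grad_L2[OF assms(1)] H01_grad_L2[OF assms(2)])+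
    show "(\<lambda>j. l2 \<mu> (\<lambda>x. \<phi> j x + \<psi> j x - (y x + z x))) \<longlonglongrightarrow> 0"
      by (rule l2_tendsto_add[OF test_L2(1)[OF p(1)] H01_grad_L2(1)[OF assms(1)] test_L2(1)[OF q(1)]
            H01_grad_L2(1)[OF assms(2)] p(2) q(2)])
    show "(\<lambda>j. l2 \<mu> (\<lambda>x. grad (\<phi> j) x + grad (\<psi> j) x - (g x + h x))) \<longlonglongrightarrow> 0"
      by (rule l2_tendsto_add[OF test_L2(2)[OF p(1)] H01_grad_L2(2)[OF assms(1)] test_L2(2)[OF q(1)]
            H01_grad_L2(2)[OF assms(2)] p(3) q(3)])
  qed
qed

lemma H01_grad_cmult:
  assumes "H01_grad \<Omega> y g" shows "H01_grad \<Omega> (\<lambda>x. c * y x) (\<lambda>x. c *\<^sub>R g x)"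
proof -
  obtain \<phi> where p: "\<And>j. test_fun \<Omega> (\<phi> j)" "(\<lambda>j. l2 \<mu> (\<lambda>x. \<phi> j x - y x)) \<longlonglongrightarrow> 0"
      "(\<lambda>j. l2 \<mu> (\<lambda>x. grad (\<phi> j) x - g x)) \<longlonglongrightarrow> 0" using assms(1) unfolding H01_grad_iff by blast
  have gr: "grad (\<lambda>x. c * \<phi> j x) = (\<lambda>x. c *\<^sub>R grad (\<phi> j) x)" for j
    using p(1) by (intro ext grad_cmult) (auto intro: test_fun_smooth)
  show ?thesis
  proof (rule H01_grad_limit[where f = "\<lambda>j x. c * \<phi> j x" and g = "\<lambda>j x. c *\<^sub>R grad (\<phi> j) x"])
    show "H01_grad \<Omega> (\<lambda>x. c * \<phi> j x) (\<lambda>x. c *\<^sub>R grad (\<phi> j) x)" for j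
      using H01_grad_test[OF test_fun_cmult[OF p(1)[of j], of c]] by (simp add: gr)
    show "L2 \<mu> (\<lambda>x. c * y x)" using L2_scaleR[OF H01_grad_L2(1)[OF assms], of c] by simp
    show "L2 \<mu> (\<lambda>x. c *\<^sub>R g x)" using L2_scaleR[OF H01_grad_L2(2)[OF assms], of c] by simp
    show "(\<lambda>j. l2 \<mu> (\<lambda>x. c * \<phi> j x - c * y x)) \<longlonglongrightarrow> 0"
      using tendsto_mult_right_zero[OF p(2), of "\<bar>c\<bar>"] l2_scaleR[of \<mu> c "\<lambda>x. \<phi> _ x - y x"] by (simp add: right_diff_distrib)
    show "(\<lambda>j. l2 \<mu> (\<lambda>x. c *\<^sub>R grad (\<phi> j) x - c *\<^sub>R g x)) \<longlonglongrightarrow> 0"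
      using tendsto_mult_right_zero[OF p(3), of "\<bar>c\<bar>"] l2_scaleR[of \<mu> c "\<lambda>x. grad (\<phi> _) x - g x"]
      by (simp add: scaleR_right_diff_distrib)
  qed
qed

lemma H01_grad_diff:
  assumes "H01_grad \<Omega> y g" "H01_grad \<Omega> z h"
  shows "H01_grad \<Omega> (\<lambda>x. y x - z x) (\<lambda>x. g x - h x)"
  using H01_grad_add[OF assms(1) H01_grad_cmult[OF assms(2), of "-1"]] by simp

lemma H01_grad_integration_by_parts:
  assumes H: "H01_grad \<Omega> y g" and \<psi>: "continuous_on UNIV \<psi>" "continuous_on UNIV d"
    and d: "\<And>x. ((\<lambda>t. \<psi> (x + t *\<^sub>R axis i 1)) has_real_derivative d x) (at 0)"
  shows "(\<integral>x. g x $ i * \<psi> x \<partial>\<mu>) + (\<integral>x. y x * d x \<partial>\<mu>) = 0"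
proof -
  obtain \<phi> where p: "\<And>j. test_fun \<Omega> (\<phi> j)" "(\<lambda>j. l2 \<mu> (\<lambda>x. \<phi> j x - y x)) \<longlonglongrightarrow> 0"
      "(\<lambda>j. l2 \<mu> (\<lambda>x. grad (\<phi> j) x - g x)) \<longlonglongrightarrow> 0" using H unfolding H01_grad_iff by blast
  have L: "L2 \<mu> \<psi>" "L2 \<mu> d" by (intro continuous_L2 \<psi>)+
  \<comment> \<open>This vector-valued partner turns the \<open>i\<close>-th component of the
    gradient into an inner product, so the limit can be taken by
    \<open>l2_inner_tendsto\<close>.\<close>
  have Lv: "L2 \<mu> (\<lambda>x. \<psi> x *\<^sub>R axis i (1::real))"
    by (intro continuous_L2 continuous_intros \<psi>)
  have "(\<lambda>j. (\<integral>x. grad (\<phi> j) x \<bullet> (\<psi> x *\<^sub>R axis i 1) \<partial>\<mu>) + (\<integral>x. \<phi> j x \<bullet> d x \<partial>\<mu>))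
      \<longlonglongrightarrow> (\<integral>x. g x \<bullet> (\<psi> x *\<^sub>R axis i 1) \<partial>\<mu>) + (\<integral>x. y x \<bullet> d x \<partial>\<mu>)"
    by (intro tendsto_add l2_inner_tendsto[OF test_L2(2)[OF p(1)] H01_grad_L2(2)[OF H] Lv p(3)]
        l2_inner_tendsto[OF test_L2(1)[OF p(1)] H01_grad_L2(1)[OF H] L(2) p(2)])
  moreover have "(\<integral>x. grad (\<phi> j) x \<bullet> (\<psi> x *\<^sub>R axis i 1) \<partial>\<mu>) + (\<integral>x. \<phi> j x \<bullet> d x \<partial>\<mu>) = 0" for j
  proof -
    have s: "smooth (\<phi> j)" using p(1) by (rule test_fun_smooth)
    have "(\<integral>x. grad (\<phi> j) x \<bullet> (\<psi> x *\<^sub>R axis i 1) \<partial>\<mu>) + (\<integral>x. \<phi> j x \<bullet> d x \<partial>\<mu>)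
        = (\<integral>x. grad (\<phi> j) x \<bullet> (\<psi> x *\<^sub>R axis i 1) + \<phi> j x \<bullet> d x \<partial>\<mu>)"
      by (rule Bochner_Integration.integral_add[symmetric, OF L2_inner[OF test_L2(2)[OF p(1)] Lv]
            L2_inner[OF test_L2(1)[OF p(1)] L(2)]])
    also have "\<dots> = (\<integral>x. partial i (\<phi> j) x * \<psi> x + \<phi> j x * d x \<partial>\<mu>)"
      by (simp add: inner_axis grad_def mult.commute)
    also have "\<dots> = (\<integral>x. partial i (\<phi> j) x * \<psi> x + \<phi> j x * d x \<partial>lborel)"
    proof (rule lebesgue_on_lborel(2)[OF sets_Omega])
      show "(\<lambda>x. partial i (\<phi> j) x * \<psi> x + \<phi> j x * d x) \<in> borel_measurable borel"
        by (intro borel_measurable_continuous_onI continuous_intros smooth_continuous smooth_partial s \<psi>)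
      show "partial i (\<phi> j) x * \<psi> x + \<phi> j x * d x = 0" if "x \<notin> \<Omega>" for x
        using test_fun_outside[OF p(1) that] by simp
    qed
    also have "\<dots> = 0" by (rule test_fun_integration_by_parts[OF p(1) \<psi> d])
    finally show ?thesis .
  qed
  ultimately have "(\<lambda>j::nat. 0) \<longlonglongrightarrow> (\<integral>x. g x \<bullet> (\<psi> x *\<^sub>R axis i 1) \<partial>\<mu>) + (\<integral>x. y x \<bullet> d x \<partial>\<mu>)" by simp
  then show ?thesis by (simp add: LIMSEQ_const_iff inner_axis mult.commute)
qed

text \<open>The sign of \<open>f\<close> is an almost everywhere limit of continuous functions, hence of uniformly
  bounded polynomials.\<close>

lemma orthogonal_polynomials_AE_0:
  fixes f :: "real^'n \<Rightarrow> real"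
  assumes f: "integrable \<mu> f"
    and orth: "\<And>\<psi>. real_polynomial_function \<psi> \<Longrightarrow> (\<integral>x. f x * \<psi> x \<partial>\<mu>) = 0"
  shows "AE x in \<mu>. f x = 0"
proof -
  have fm[measurable]: "f \<in> borel_measurable \<mu>" using f by auto
  have "(\<lambda>x. sgn (f x)) measurable_on \<Omega>"
    unfolding measurable_on_iff_borel_measurable[OF sets_Omega] by measurable
  then obtain N g where Ng: "negligible N" "\<And>n::nat. continuous_on UNIV (g n)"
      "\<And>x. x \<notin> N \<Longrightarrow> (\<lambda>n. g n x) \<longlonglongrightarrow> (if x \<in> \<Omega> then sgn (f x) else 0)"
    unfolding measurable_on_def by blast
  \<comment> \<open>Clipping does not change the limit, which is a sign, and keeps the approximating
    polynomials within 2 on \<Omega>, as dominated convergence requires.\<close>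
  define h where "h n x = max (-1) (min 1 (g n x))" for n x
  have "\<exists>p. real_polynomial_function p \<and> (\<forall>x\<in>closure \<Omega>. \<bar>h n x - p x\<bar> < inverse (real (Suc n)))" for n
  proof -
    have "continuous_on (closure \<Omega>) (h n)" unfolding h_def[abs_def]
      by (intro continuous_intros continuous_on_subset[OF Ng(2)]) auto
    moreover have "compact (closure \<Omega>)" using bounded_Omega by simp
    ultimately show ?thesis
      using Stone_Weierstrass_real_polynomial_function[of "closure \<Omega>" "h n" "inverse (real (Suc n))"]
      by (metis inverse_positive_iff_positive of_nat_0_less_iff zero_less_Suc)
  qed
  then obtain p where p: "\<And>n. real_polynomial_function (p n)"
    "\<And>n x. x \<in> closure \<Omega> \<Longrightarrow> \<bar>h n x - p n x\<bar> < inverse (real (Suc n))" by metis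
  have lim: "AE x in \<mu>. (\<lambda>n. p n x) \<longlonglongrightarrow> sgn (f x)"
  proof -
    have "AE x in lebesgue. x \<notin> N"
      using Ng(1) by (simp add: negligible_iff_null_sets AE_not_in)
    then have "AE x in lebesgue. x \<in> \<Omega> \<longrightarrow> x \<notin> N" by eventually_elim simp
    then have "AE x in \<mu>. x \<notin> N" by (simp add: AE_restrict_space_iff sets_Omega)
    then show ?thesis
    proof (rule AE_mp, intro AE_I2 impI)
      fix x assume x: "x \<in> space \<mu>" "x \<notin> N"
      have "(\<lambda>n. g n x) \<longlonglongrightarrow> sgn (f x)" using Ng(3)[OF x(2)] x(1) by simp
      then have "(\<lambda>n. h n x) \<longlonglongrightarrow> max (-1) (min 1 (sgn (f x)))"
        unfolding h_def by (intro tendsto_max tendsto_min tendsto_const)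
      moreover have "max (-1) (min 1 (sgn (f x))) = sgn (f x)" by (simp add: sgn_if)
      moreover have "(\<lambda>n. p n x - h n x) \<longlonglongrightarrow> 0"
      proof (rule Lim_null_comparison[OF _ LIMSEQ_inverse_real_of_nat])
        show "\<forall>\<^sub>F n in sequentially. norm (p n x - h n x) \<le> inverse (real (Suc n))"
          using p(2)[of x] x(1) closure_subset[of \<Omega>]
          by (intro always_eventually allI) (auto simp: abs_minus_commute intro!: less_imp_le)
      qed
      ultimately show "(\<lambda>n. p n x) \<longlonglongrightarrow> sgn (f x)"
        using tendsto_add[of "\<lambda>n. p n x - h n x" 0 sequentially "\<lambda>n. h n x"] by simp
    qed
  qed
  have pm[measurable]: "p n \<in> borel_measurable \<mu>" for n
  proof -
    have "continuous_on UNIV (p n)"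
      using p(1) by (simp add: continuous_on_polymonial_function real_polynomial_function_eq)
    then show ?thesis using continuous_L2[of "p n"] by (simp add: L2_def)
  qed
  have "(\<lambda>n. \<integral>x. f x * p n x \<partial>\<mu>) \<longlonglongrightarrow> (\<integral>x. \<bar>f x\<bar> \<partial>\<mu>)"
  proof (rule integral_dominated_convergence[where w = "\<lambda>x. 2 * \<bar>f x\<bar>"])
    show "AE x in \<mu>. (\<lambda>n. f x * p n x) \<longlonglongrightarrow> \<bar>f x\<bar>"
      using lim
    proof eventually_elim
      fix x assume "(\<lambda>n. p n x) \<longlonglongrightarrow> sgn (f x)"
      from tendsto_mult_left[OF this, of "f x"] show "(\<lambda>n. f x * p n x) \<longlonglongrightarrow> \<bar>f x\<bar>"
        by (simp add: abs_sgn)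
    qed
    show "AE x in \<mu>. norm (f x * p n x) \<le> 2 * \<bar>f x\<bar>" for n
    proof (rule AE_I2)
      fix x assume "x \<in> space \<mu>"
      then have "\<bar>h n x - p n x\<bar> < inverse (real (Suc n))" using p(2) closure_subset by auto
      moreover have "inverse (real (Suc n)) \<le> 1" by (simp add: divide_simps)
      moreover have "\<bar>h n x\<bar> \<le> 1" by (auto simp: h_def)
      ultimately have "\<bar>p n x\<bar> \<le> 2" by linarith
      from mult_left_mono[OF this, of "\<bar>f x\<bar>"] show "norm (f x * p n x) \<le> 2 * \<bar>f x\<bar>"
        by (simp add: abs_mult mult.commute)
    qed
  qed (use f in auto)
  then have "(\<lambda>n::nat. 0) \<longlonglongrightarrow> (\<integral>x. \<bar>f x\<bar> \<partial>\<mu>)" using orth[OF p(1)] by simp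
  then have "(\<integral>x. \<bar>f x\<bar> \<partial>\<mu>) = 0" by (simp add: LIMSEQ_const_iff)
  then show ?thesis using integral_nonneg_eq_0_iff_AE[of \<mu> "\<lambda>x. \<bar>f x\<bar>"] f by auto
qed

text \<open>Integration by parts moves the derivative from the vanishing function to a polynomial,
  so each component of \<open>g\<close> is orthogonal to all polynomials. Besides uniqueness, this
  yields that gradients vanish on level sets.\<close>

lemma H01_grad_zero_unique:
  assumes H: "H01_grad \<Omega> y g" and y: "AE x in \<mu>. y x = 0" shows "AE x in \<mu>. g x = 0"
proof -
  have "AE x in \<mu>. g x $ i = 0" for i
  proof (rule orthogonal_polynomials_AE_0)
    have Lg: "L2 \<mu> (\<lambda>x. g x $ i)" using H01_grad_L2(2)[OF H] by (simp flip: L2_vec_iff)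
    show "integrable \<mu> (\<lambda>x. g x $ i)" by (rule L2_L1(1)[OF Lg])
    fix \<psi> :: "real^'n \<Rightarrow> real" assume \<psi>: "real_polynomial_function \<psi>"
    obtain d where d: "real_polynomial_function d"
      "\<And>x. ((\<lambda>t. \<psi> (x + t *\<^sub>R axis i 1)) has_real_derivative d x) (at 0)"
      using real_polynomial_function_directional[OF \<psi>, of "axis i 1"] by blast
    have "(\<integral>x. g x $ i * \<psi> x \<partial>\<mu>) + (\<integral>x. y x * d x \<partial>\<mu>) = 0"
      by (rule H01_grad_integration_by_parts[OF H _ _ d(2)])
         (use \<psi> d(1) in \<open>simp_all add: continuous_on_polymonial_function real_polynomial_function_eq\<close>)
    moreover have "(\<integral>x. y x * d x \<partial>\<mu>) = 0" using y by (intro integral_eq_zero_AE) auto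
    ultimately show "(\<integral>x. g x $ i * \<psi> x \<partial>\<mu>) = 0" by simp
  qed
  then have "AE x in \<mu>. \<forall>i\<in>UNIV. g x $ i = 0" by (intro AE_finite_allI) auto
  then show ?thesis by eventually_elim (simp add: vec_eq_iff)
qed

lemma H01_grad_unique:
  assumes "H01_grad \<Omega> y g" "H01_grad \<Omega> z h" "AE x in \<mu>. y x = z x" shows "AE x in \<mu>. g x = h x"
  using H01_grad_zero_unique[OF H01_grad_diff[OF assms(1,2)]] assms(3) by auto

lemma H01_wgrad: "H01 \<Omega> y \<Longrightarrow> H01_grad \<Omega> y (wgrad \<Omega> y)"
  using someI_ex[of "H01_grad \<Omega> y"] by (simp add: H01_def wgrad_def)

text \<open>Makes the choice inside \<open>wgrad\<close> harmless: any explicit gradient may replace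
  it under an integral.\<close>

lemma wgrad_AE_eq: assumes "H01_grad \<Omega> y g" shows "AE x in \<mu>. wgrad \<Omega> y x = g x"
  using H01_grad_unique[OF H01_wgrad assms] assms unfolding H01_def by blast

lemma wgrad_L2: "H01 \<Omega> y \<Longrightarrow> L2 \<mu> (wgrad \<Omega> y)"
  using H01_wgrad H01_grad_L2(2) by blast

lemma H01_L2: "H01 \<Omega> y \<Longrightarrow> L2 \<mu> y"
  using H01_wgrad H01_grad_L2(1) by blast

lemma H01_norm_eq: "H01_norm \<Omega> y = l2 \<mu> (wgrad \<Omega> y)"
  by (simp add: H01_norm_def l2_def)

lemma H01_norm_grad: assumes "H01_grad \<Omega> y g" shows "H01_norm \<Omega> y = l2 \<mu> g"
  unfolding H01_norm_eq using assms wgrad_AE_eq[OF assms] wgrad_L2[of y] H01_grad_L2(2)[OF assms]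
  by (intro l2_cong_AE) (auto simp: L2_def H01_def)

lemma H01_zero: "H01 \<Omega> (\<lambda>x. 0)"
  using H01_grad_test[OF test_fun_zero] by (auto simp: H01_def)

lemma H01_add: "H01 \<Omega> y \<Longrightarrow> H01 \<Omega> z \<Longrightarrow> H01 \<Omega> (\<lambda>x. y x + z x)"
  using H01_grad_add unfolding H01_def by blast

lemma H01_cmult: "H01 \<Omega> y \<Longrightarrow> H01 \<Omega> (\<lambda>x. c * y x)"
  using H01_grad_cmult unfolding H01_def by blast

lemma H01_diff: "H01 \<Omega> y \<Longrightarrow> H01 \<Omega> z \<Longrightarrow> H01 \<Omega> (\<lambda>x. y x - z x)"
  using H01_grad_diff unfolding H01_def by blast

lemma wgrad_add:
  "H01 \<Omega> y \<Longrightarrow> H01 \<Omega> z \<Longrightarrow> AE x in \<mu>. wgrad \<Omega> (\<lambda>x. y x + z x) x = wgrad \<Omega> y x + wgrad \<Omega> z x"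
  by (intro wgrad_AE_eq H01_grad_add H01_wgrad)

lemma wgrad_cmult: "H01 \<Omega> y \<Longrightarrow> AE x in \<mu>. wgrad \<Omega> (\<lambda>x. c * y x) x = c *\<^sub>R wgrad \<Omega> y x"
  by (intro wgrad_AE_eq H01_grad_cmult H01_wgrad)

lemma H01_test: "test_fun \<Omega> \<phi> \<Longrightarrow> H01 \<Omega> \<phi>"
  using H01_grad_test by (auto simp: H01_def)

lemma H01_test_approx:
  assumes "H01 \<Omega> y"
  shows "\<exists>\<phi>. (\<forall>k. test_fun \<Omega> (\<phi> k)) \<and> (\<lambda>k. l2 \<mu> (\<lambda>x. \<phi> k x - y x)) \<longlonglongrightarrow> 0 \<and>
    (\<lambda>k. H01_norm \<Omega> (\<lambda>x. \<phi> k x - y x)) \<longlonglongrightarrow> 0"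
proof -
  have H: "H01_grad \<Omega> y (wgrad \<Omega> y)" by (rule H01_wgrad[OF assms])
  then obtain \<phi> where p: "\<And>j. test_fun \<Omega> (\<phi> j)" "(\<lambda>j. l2 \<mu> (\<lambda>x. \<phi> j x - y x)) \<longlonglongrightarrow> 0"
      "(\<lambda>j. l2 \<mu> (\<lambda>x. grad (\<phi> j) x - wgrad \<Omega> y x)) \<longlonglongrightarrow> 0" unfolding H01_grad_iff by blast
  have "H01_norm \<Omega> (\<lambda>x. \<phi> k x - y x) = l2 \<mu> (\<lambda>x. grad (\<phi> k) x - wgrad \<Omega> y x)" for k
    by (rule H01_norm_grad[OF H01_grad_diff[OF H01_grad_test[OF p(1)] H]])
  with p show ?thesis by (intro exI[of _ \<phi>]) auto
qed

section \<open>Chain rule for functions of a test function\<close>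

lemma test_fun_bound:
  assumes \<phi>: "test_fun \<Omega> \<phi>"
  obtains B where "B > 0" "\<And>x. \<bar>\<phi> x\<bar> \<le> B" "\<And>x. norm (grad \<phi> x) \<le> B"
proof -
  have K: "compact (tsupport \<phi>)" and s: "smooth \<phi>" using \<phi> by (auto simp: test_fun_def)
  obtain B1 where B1: "B1 > 0" "\<And>x. norm (\<phi> x) \<le> B1"
    using continuous_compact_support_bounded[OF smooth_continuous[OF s] K] test_fun_eq_0(1)[OF \<phi>] by metis
  obtain B2 where B2: "B2 > 0" "\<And>x. norm (grad \<phi> x) \<le> B2"
    using continuous_compact_support_bounded[OF grad_continuous[OF s] K] test_fun_eq_0(3)[OF \<phi>] by metis
  show thesis
  proof (rule that[of "max B1 B2"])
    show "\<bar>\<phi> x\<bar> \<le> max B1 B2" "norm (grad \<phi> x) \<le> max B1 B2" for x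
      using B1(2)[of x] B2(2)[of x] by auto
  qed (use B1(1) in auto)
qed

text \<open>Pointwise convergence suffices, by domination on the bounded range of \<phi>. In
  particular \<open>D\<close> may be discontinuous and need not be a derivative of \<open>T\<close>
  at every point, as truncations demand.\<close>

lemma H01_comp_tendsto:
  assumes \<phi>: "test_fun \<Omega> \<phi>" and B: "\<And>x. \<bar>\<phi> x\<bar> \<le> B"
    and H: "\<And>k. H01_grad \<Omega> (\<lambda>x. G k (\<phi> x)) (\<lambda>x. G' k (\<phi> x) *\<^sub>R grad \<phi> x)"
    and b: "\<And>k s. \<bar>s\<bar> \<le> B \<Longrightarrow> \<bar>G k s\<bar> \<le> K" "\<And>k s. \<bar>s\<bar> \<le> B \<Longrightarrow> \<bar>G' k s\<bar> \<le> K"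
    and lim: "\<And>s. \<bar>s\<bar> \<le> B \<Longrightarrow> (\<lambda>k. G k s) \<longlonglongrightarrow> T s" "\<And>s. \<bar>s\<bar> \<le> B \<Longrightarrow> (\<lambda>k. G' k s) \<longlonglongrightarrow> D s"
  shows "H01_grad \<Omega> (\<lambda>x. T (\<phi> x)) (\<lambda>x. D (\<phi> x) *\<^sub>R grad \<phi> x)"
proof -
  obtain B' where B': "B' > 0" "\<And>x. norm (grad \<phi> x) \<le> B'" by (rule test_fun_bound[OF \<phi>]) blast
  have m: "(\<lambda>x. G k (\<phi> x)) \<in> borel_measurable \<mu>" "(\<lambda>x. G' k (\<phi> x) *\<^sub>R grad \<phi> x) \<in> borel_measurable \<mu>" for k
    using H01_grad_L2[OF H[of k]] by (auto simp: L2_def)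
  have lim': "(\<lambda>k. G k (\<phi> x)) \<longlonglongrightarrow> T (\<phi> x)" "(\<lambda>k. G' k (\<phi> x) *\<^sub>R grad \<phi> x) \<longlonglongrightarrow> D (\<phi> x) *\<^sub>R grad \<phi> x" for x
    by (intro tendsto_intros lim B)+
  have mT: "(\<lambda>x. T (\<phi> x)) \<in> borel_measurable \<mu>" by (rule borel_measurable_LIMSEQ_real[OF lim'(1) m(1)])
  have mD: "(\<lambda>x. D (\<phi> x) *\<^sub>R grad \<phi> x) \<in> borel_measurable \<mu>"
    by (rule borel_measurable_LIMSEQ_metric[OF m(2) lim'(2)])
  have Gb: "norm (G k (\<phi> x)) \<le> K" for k x using b(1)[OF B] by simp
  have Gb': "norm (G' k (\<phi> x) *\<^sub>R grad \<phi> x) \<le> K * B'" for k x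
  proof -
    have "\<bar>G' k (\<phi> x)\<bar> * norm (grad \<phi> x) \<le> K * B'"
      by (rule mult_mono[OF b(2)[OF B] B'(2) order_trans[OF abs_ge_zero b(2)[OF B]]]) simp
    then show ?thesis by simp
  qed
  have L: "L2 \<mu> (\<lambda>x. T (\<phi> x))"
    by (rule L2_bounded[where B = K], rule mT, rule AE_I2,
        rule tendsto_upperbound[OF tendsto_norm[OF lim'(1)]]) (use Gb in auto)
  have L': "L2 \<mu> (\<lambda>x. D (\<phi> x) *\<^sub>R grad \<phi> x)"
    by (rule L2_bounded[where B = "K * B'"], rule mD, rule AE_I2,
        rule tendsto_upperbound[OF tendsto_norm[OF lim'(2)]]) (use Gb' in auto)
  show ?thesis
    by (rule H01_grad_limit[where f = "\<lambda>k x. G k (\<phi> x)" and g = "\<lambda>k x. G' k (\<phi> x) *\<^sub>R grad \<phi> x", OF H L L'])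
       (intro l2_dominated_tendsto[OF m(1) mT lim'(1) Gb] l2_dominated_tendsto[OF m(2) mD lim'(2) Gb'])+
qed

text \<open>Polynomials vanishing at zero map test functions to test functions, so \<open>G'\<close> is
  approximated by polynomials and these are integrated.\<close>

lemma H01_comp_C1:
  assumes \<phi>: "test_fun \<Omega> \<phi>" and G: "\<And>s. (G has_real_derivative G' s) (at s)"
    and c: "continuous_on UNIV G'" and G0: "G 0 = 0"
  shows "H01_grad \<Omega> (\<lambda>x. G (\<phi> x)) (\<lambda>x. G' (\<phi> x) *\<^sub>R grad \<phi> x)"
proof -
  have s: "smooth \<phi>" using \<phi> by (rule test_fun_smooth)
  obtain B where B: "B > 0" "\<And>x. \<bar>\<phi> x\<bar> \<le> B" by (rule test_fun_bound[OF \<phi>]) blast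
  have cG: "continuous_on UNIV G" using G by (meson DERIV_isCont continuous_at_imp_continuous_on)
  have "compact (G ` {-B..B} \<union> G' ` {-B..B})"
    by (intro compact_Un compact_continuous_image continuous_on_subset[OF c] continuous_on_subset[OF cG]) auto
  from compact_imp_bounded[OF this] obtain K where K: "\<And>s. \<bar>s\<bar> \<le> B \<Longrightarrow> \<bar>G s\<bar> \<le> K \<and> \<bar>G' s\<bar> \<le> K"
    unfolding bounded_iff by (auto simp: abs_le_iff) fastforce
  define h where "h k = inverse (real (Suc k))" for k
  have h: "h k > 0" "h k \<le> 1" for k by (auto simp: h_def divide_simps)
  have h0: "h \<longlonglongrightarrow> 0" unfolding h_def by (rule LIMSEQ_inverse_real_of_nat)
  have "\<exists>n a. \<forall>s. \<bar>s\<bar> \<le> B \<longrightarrow> \<bar>G' s - (\<Sum>i\<le>n. a i * s ^ i)\<bar> < h k" for k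
  proof -
    obtain p where p: "real_polynomial_function p" "\<And>s. s \<in> {-B..B} \<Longrightarrow> \<bar>G' s - p s\<bar> < h k"
      using Stone_Weierstrass_real_polynomial_function[of "{-B..B}" G' "h k"] h(1) continuous_on_subset[OF c]
      by (metis compact_Icc subset_UNIV)
    then obtain a n where "p = (\<lambda>x. \<Sum>i\<le>n. a i * x ^ i)" by (auto simp: real_polynomial_function_iff_sum)
    with p(2) show ?thesis by (intro exI[of _ n] exI[of _ a]) (auto simp: abs_le_iff)
  qed
  then obtain n a where na: "\<And>k s. \<bar>s\<bar> \<le> B \<Longrightarrow> \<bar>G' s - (\<Sum>i\<le>n k. a k i * s ^ i)\<bar> < h k" by metis
  define p where "p k s = (\<Sum>i\<le>n k. a k i * s ^ i)" for k s
  \<comment> \<open>The antiderivative without constant term, so that \<open>test_fun_poly\<close>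
    applies and \<open>P k\<close> agrees with \<open>G\<close> at zero.\<close>
  define P where "P k s = (\<Sum>i\<le>n k. (a k i / real (Suc i)) * s ^ Suc i)" for k s
  have P: "(P k has_real_derivative p k s) (at s)" for k s
    unfolding P_def[abs_def] p_def
    by (rule derivative_eq_intros refl | simp add: mult.commute)+
  have pd: "\<bar>p k s - G' s\<bar> \<le> h k" if "\<bar>s\<bar> \<le> B" for k s
    using na[OF that, of k] by (simp add: p_def abs_minus_commute)
  have Pd: "\<bar>P k s - G s\<bar> \<le> h k * B" if s: "\<bar>s\<bar> \<le> B" for k s
  proof -
    have "norm ((P k s - G s) - (P k 0 - G 0)) \<le> h k * norm (s - 0)"
    proof (rule field_differentiable_bound[where S = "{-B..B}" and f' = "\<lambda>s. p k s - G' s"])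
      show "((\<lambda>s. P k s - G s) has_field_derivative p k z - G' z) (at z within {-B..B})" for z
        by (intro DERIV_diff has_field_derivative_at_within[OF P] has_field_derivative_at_within[OF G])
      show "norm (p k z - G' z) \<le> h k" if "z \<in> {-B..B}" for z
        using pd[of z k] that by (auto simp: abs_le_iff)
    qed (use s B(1) in auto)
    then have "\<bar>P k s - G s\<bar> \<le> h k * \<bar>s\<bar>" by (simp add: P_def G0)
    also have "\<dots> \<le> h k * B" using s h(1)[of k] by (intro mult_left_mono) auto
    finally show ?thesis .
  qed
  have gr: "grad (\<lambda>x. P k (\<phi> x)) = (\<lambda>x. p k (\<phi> x) *\<^sub>R grad \<phi> x)" for k
    by (rule ext, rule grad_comp[OF s P])
  have tf: "test_fun \<Omega> (\<lambda>x. P k (\<phi> x))" for k unfolding P_def by (rule test_fun_poly[OF \<phi>])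
  show ?thesis
  proof (rule H01_comp_tendsto[OF \<phi> B(2), where G = P and G' = p and K = "K + (B + 1)"])
    show "H01_grad \<Omega> (\<lambda>x. P k (\<phi> x)) (\<lambda>x. p k (\<phi> x) *\<^sub>R grad \<phi> x)" for k
      using H01_grad_test[OF tf[of k]] by (simp add: gr)
    fix s assume s: "\<bar>s\<bar> \<le> B"
    have hB: "h k * B \<le> B" for k using mult_right_mono[OF h(2)[of k], of B] B(1) by simp
    show "\<bar>P k s\<bar> \<le> K + (B + 1)" for k using Pd[OF s, of k] K[OF s] hB[of k] by linarith
    show "\<bar>p k s\<bar> \<le> K + (B + 1)" for k using pd[OF s, of k] K[OF s] h(2)[of k] B(1) by linarith
    show "(\<lambda>k. P k s) \<longlonglongrightarrow> G s"
    proof (rule LIM_zero_cancel, rule Lim_null_comparison)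
      show "\<forall>\<^sub>F k in sequentially. norm (P k s - G s) \<le> h k * B" using Pd[OF s] by simp
      show "(\<lambda>k. h k * B) \<longlonglongrightarrow> 0" using tendsto_mult_left_zero[OF h0] .
    qed
    show "(\<lambda>k. p k s) \<longlonglongrightarrow> G' s"
    proof (rule LIM_zero_cancel, rule Lim_null_comparison[OF _ h0])
      show "\<forall>\<^sub>F k in sequentially. norm (p k s - G' s) \<le> h k" using pd[OF s] by simp
    qed
  qed
qed

text \<open>The uniform bound on the derivatives also bounds the functions on the range of \<phi>,
  because all of them vanish at zero.\<close>

lemma H01_comp_limit:
  assumes \<phi>: "test_fun \<Omega> \<phi>" and G: "\<And>k s. (G k has_real_derivative G' k s) (at s)"
    and c: "\<And>k::nat. continuous_on UNIV (G' k)" and G0: "\<And>k. G k 0 = 0"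
    and b: "\<And>k s. \<bar>G' k s\<bar> \<le> K" and lim: "\<And>s. (\<lambda>k. G k s) \<longlonglongrightarrow> T s" "\<And>s. (\<lambda>k. G' k s) \<longlonglongrightarrow> D s"
  shows "H01_grad \<Omega> (\<lambda>x. T (\<phi> x)) (\<lambda>x. D (\<phi> x) *\<^sub>R grad \<phi> x)"
proof -
  obtain B where B: "B > 0" "\<And>x. \<bar>\<phi> x\<bar> \<le> B" by (rule test_fun_bound[OF \<phi>]) blast
  have K: "K \<ge> 0" using b[of 0 0] by linarith
  show ?thesis
  proof (rule H01_comp_tendsto[OF \<phi> B(2) H01_comp_C1[OF \<phi> G c G0] _ _ lim, where K = "K * max 1 B"])
    fix k s assume s: "\<bar>s\<bar> \<le> B"
    have "norm (G k s - G k 0) \<le> K * norm (s - 0)"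
      by (rule field_differentiable_bound[where S = UNIV and f' = "G' k"]) (use G b in auto)
    also have "\<dots> \<le> K * max 1 B" using K s by (intro mult_left_mono) auto
    finally show "\<bar>G k s\<bar> \<le> K * max 1 B" by (simp add: G0)
    have "K * 1 \<le> K * max 1 B" using K by (intro mult_left_mono) auto
    then show "\<bar>G' k s\<bar> \<le> K * max 1 B" using b[of k s] by simp
  qed
qed

end

section \<open>Truncations and weighted estimates\<close>

text \<open>For \<open>k \<ge> 0\<close> this cuts \<open>s\<close> off at height \<open>k\<close>
  on both sides. Writing it with absolute values reduces its approximation to that of the absolute
  value.\<close>

definition trunc :: "real \<Rightarrow> real \<Rightarrow> real" where
  "trunc k s = (\<bar>s + k\<bar> - \<bar>s - k\<bar>) / 2"

text \<open>Since \<open>sgn 0 = 0\<close>, the value at \<open>s = k\<close> and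
  \<open>s = - k\<close> is one half for \<open>k > 0\<close>. It is the pointwise limit of the
  derivatives of the smoothed truncations.\<close>

definition trunc_deriv :: "real \<Rightarrow> real \<Rightarrow> real" where
  "trunc_deriv k s = (sgn (s + k) - sgn (s - k)) / 2"

lemma divide_sqrt_add_tendsto_sgn:
  fixes u :: real
  assumes "h \<longlonglongrightarrow> 0" shows "(\<lambda>n. u / sqrt (u\<^sup>2 + (h n)\<^sup>2)) \<longlonglongrightarrow> sgn u"
proof (cases "u = 0")
  case False
  have "(\<lambda>n. u / sqrt (u\<^sup>2 + (h n)\<^sup>2)) \<longlonglongrightarrow> u / sqrt (u\<^sup>2 + 0\<^sup>2)"
    by (intro tendsto_intros assms) (use False in auto)
  moreover have "u / sqrt (u\<^sup>2 + 0\<^sup>2) = sgn u" using False by (simp add: sgn_if)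
  ultimately show ?thesis by simp
qed simp

lemma sqrt_add_tendsto_abs:
  fixes u :: real
  assumes "h \<longlonglongrightarrow> 0" shows "(\<lambda>n. sqrt (u\<^sup>2 + (h n)\<^sup>2)) \<longlonglongrightarrow> \<bar>u\<bar>"
proof -
  have "(\<lambda>n. sqrt (u\<^sup>2 + (h n)\<^sup>2)) \<longlonglongrightarrow> sqrt (u\<^sup>2 + 0\<^sup>2)" by (intro tendsto_intros assms)
  then show ?thesis by simp
qed

lemma abs_divide_sqrt_le_1: "\<bar>u / sqrt (u\<^sup>2 + e\<^sup>2)\<bar> \<le> (1::real)"
proof -
  define q where "q = sqrt (u\<^sup>2 + e\<^sup>2)"
  have "\<bar>u\<bar> \<le> q" unfolding q_def by (rule real_le_rsqrt) simp
  then show ?thesis unfolding q_def[symmetric] by (cases "q = 0") (auto simp: abs_divide divide_le_eq)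
qed

text \<open>\<open>\<bar>u\<bar>\<close> is smoothed to the square root of
  \<open>u\<^sup>2 + (h n)\<^sup>2\<close>, whose derivatives are bounded by one and converge to
  \<open>sgn u\<close> at every \<open>u\<close>, including zero.\<close>

lemma (in bounded_open_set) H01_grad_trunc:
  assumes \<phi>: "test_fun \<Omega> \<phi>"
  shows "H01_grad \<Omega> (\<lambda>x. trunc k (\<phi> x)) (\<lambda>x. trunc_deriv k (\<phi> x) *\<^sub>R grad \<phi> x)"
proof -
  define h where "h n = inverse (real (Suc n))" for n
  have h: "h n > 0" for n by (simp add: h_def)
  have h0: "h \<longlonglongrightarrow> 0" unfolding h_def by (rule LIMSEQ_inverse_real_of_nat)
  have p: "u\<^sup>2 + (h n)\<^sup>2 > 0" for u n using h[of n] by (simp add: add_nonneg_pos)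
  have d: "((\<lambda>s. sqrt ((s + c)\<^sup>2 + (h n)\<^sup>2)) has_real_derivative (s + c) / sqrt ((s + c)\<^sup>2 + (h n)\<^sup>2)) (at s)" for c n s
  proof -
    have "((\<lambda>s. (s + c)\<^sup>2 + (h n)\<^sup>2) has_real_derivative 2 * (s + c)) (at s)"
      by (auto intro!: derivative_eq_intros)
    from DERIV_chain2[OF DERIV_real_sqrt[OF p] this]
    have "((\<lambda>s. sqrt ((s + c)\<^sup>2 + (h n)\<^sup>2)) has_real_derivative
        inverse (sqrt ((s + c)\<^sup>2 + (h n)\<^sup>2)) / 2 * (2 * (s + c))) (at s)" .
    moreover have "inverse q / 2 * (2 * u) = u / q" for q u :: real by (cases "q = 0") (auto simp: field_simps)
    ultimately show ?thesis by (simp only:)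
  qed
  show ?thesis
  proof (rule H01_comp_limit[OF \<phi>, where K = 1
      and G = "\<lambda>n s. (sqrt ((s + k)\<^sup>2 + (h n)\<^sup>2) - sqrt ((s + (- k))\<^sup>2 + (h n)\<^sup>2)) / 2"
      and G' = "\<lambda>n s. ((s + k) / sqrt ((s + k)\<^sup>2 + (h n)\<^sup>2) - (s + (- k)) / sqrt ((s + (- k))\<^sup>2 + (h n)\<^sup>2)) / 2"])
    fix n s
    show "((\<lambda>s. (sqrt ((s + k)\<^sup>2 + (h n)\<^sup>2) - sqrt ((s + (- k))\<^sup>2 + (h n)\<^sup>2)) / 2) has_real_derivative
        ((s + k) / sqrt ((s + k)\<^sup>2 + (h n)\<^sup>2) - (s + (- k)) / sqrt ((s + (- k))\<^sup>2 + (h n)\<^sup>2)) / 2) (at s)"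
      by (intro DERIV_cdivide DERIV_diff d)
    show "continuous_on UNIV (\<lambda>s. ((s + k) / sqrt ((s + k)\<^sup>2 + (h n)\<^sup>2) - (s + (- k)) / sqrt ((s + (- k))\<^sup>2 + (h n)\<^sup>2)) / 2)"
      by (intro continuous_intros) (use h[of n] in auto)
    show "\<bar>((s + k) / sqrt ((s + k)\<^sup>2 + (h n)\<^sup>2) - (s + (- k)) / sqrt ((s + (- k))\<^sup>2 + (h n)\<^sup>2)) / 2\<bar> \<le> 1"
    proof -
      have "\<bar>(a - b) / 2\<bar> \<le> 1" if "\<bar>a\<bar> \<le> 1" "\<bar>b\<bar> \<le> 1" for a b :: real
        using that unfolding abs_le_iff by simp
      from this[OF abs_divide_sqrt_le_1 abs_divide_sqrt_le_1] show ?thesis .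
    qed
    show "(\<lambda>n. (sqrt ((s + k)\<^sup>2 + (h n)\<^sup>2) - sqrt ((s + (- k))\<^sup>2 + (h n)\<^sup>2)) / 2) \<longlonglongrightarrow> trunc k s"
      unfolding trunc_def diff_conv_add_uminus[of s k] by (intro tendsto_intros sqrt_add_tendsto_abs h0) simp
    show "(\<lambda>n. ((s + k) / sqrt ((s + k)\<^sup>2 + (h n)\<^sup>2) - (s + (- k)) / sqrt ((s + (- k))\<^sup>2 + (h n)\<^sup>2)) / 2) \<longlonglongrightarrow> trunc_deriv k s"
      unfolding trunc_deriv_def diff_conv_add_uminus[of s k] by (intro tendsto_intros divide_sqrt_add_tendsto_sgn h0) simp
  qed simp
qed

text \<open>The functions \<open>\<epsilon> * arctan ((s - c) / \<epsilon>)\<close> tend to zero, while their derivatives tend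
  to the indicator of \<open>c\<close>.\<close>

lemma (in bounded_open_set) grad_eq_0_on_level_set:
  assumes \<phi>: "test_fun \<Omega> \<phi>" shows "AE x in \<mu>. \<phi> x = c \<longrightarrow> grad \<phi> x = 0"
proof -
  define r where "r n = real (Suc n)" for n
  have r: "r n > 0" for n by (simp add: r_def)
  have r0: "(\<lambda>n. inverse (r n)) \<longlonglongrightarrow> 0" unfolding r_def by (rule LIMSEQ_inverse_real_of_nat)
  have "H01_grad \<Omega> (\<lambda>x. (\<lambda>s. 0) (\<phi> x)) (\<lambda>x. (\<lambda>s. if s = c then 1 else 0) (\<phi> x) *\<^sub>R grad \<phi> x)"
  proof (rule H01_comp_limit[OF \<phi>, where K = 1 and G = "\<lambda>n s. (arctan (r n * (s - c)) - arctan (r n * (0 - c))) / r n"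
        and G' = "\<lambda>n s. inverse (1 + (r n * (s - c))\<^sup>2)"])
    fix n s
    show "((\<lambda>s. (arctan (r n * (s - c)) - arctan (r n * (0 - c))) / r n) has_real_derivative
        inverse (1 + (r n * (s - c))\<^sup>2)) (at s)"
    proof -
      have "((\<lambda>s. r n * (s - c)) has_real_derivative r n) (at s)" by (auto intro!: derivative_eq_intros)
      from DERIV_diff[OF DERIV_chain2[OF DERIV_arctan this] DERIV_const[of "arctan (r n * (0 - c))"]]
      have "((\<lambda>s. (arctan (r n * (s - c)) - arctan (r n * (0 - c))) / r n) has_real_derivative
          (inverse (1 + (r n * (s - c))\<^sup>2) * r n - 0) / r n) (at s)" by (rule DERIV_cdivide)
      then show ?thesis using r[of n] by simp
    qed
    have p: "1 + (r n * (s - c))\<^sup>2 \<ge> 1" for s by simp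
    have "1 + (r n * (s - c))\<^sup>2 \<noteq> 0" for s using p[of s] by linarith
    then show "continuous_on UNIV (\<lambda>s. inverse (1 + (r n * (s - c))\<^sup>2))"
      by (intro continuous_intros) auto
    show "\<bar>inverse (1 + (r n * (s - c))\<^sup>2)\<bar> \<le> 1" using p[of s] by (simp add: inverse_le_1_iff)
    show "(\<lambda>n. (arctan (r n * (s - c)) - arctan (r n * (0 - c))) / r n) \<longlonglongrightarrow> 0"
    proof (rule Lim_null_comparison)
      show "(\<lambda>n. 4 * inverse (r n)) \<longlonglongrightarrow> 0" using tendsto_mult_right_zero[OF r0] by simp
      have "\<bar>arctan (r n * (s - c)) - arctan (r n * (0 - c))\<bar> \<le> 4" for n
        using arctan_bounded[of "r n * (s - c)"] arctan_bounded[of "r n * (0 - c)"] pi_less_4 by linarith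
      then show "\<forall>\<^sub>F n in sequentially. norm ((arctan (r n * (s - c)) - arctan (r n * (0 - c))) / r n) \<le> 4 * inverse (r n)"
        using r by (intro always_eventually allI) (simp add: abs_divide divide_simps abs_of_pos)
    qed
    show "(\<lambda>n. inverse (1 + (r n * (s - c))\<^sup>2)) \<longlonglongrightarrow> (if s = c then 1 else 0)"
    proof (cases "s = c")
      case False
      have "(\<lambda>n. inverse (1 + (r n * (s - c))\<^sup>2)) \<longlonglongrightarrow> 0"
      proof (rule Lim_null_comparison)
        show "(\<lambda>n. (inverse (r n))\<^sup>2 * inverse ((s - c)\<^sup>2)) \<longlonglongrightarrow> 0"
          by (rule tendsto_mult_left_zero, rule tendsto_null_power[OF r0]) simp
        have "inverse (1 + (r n * (s - c))\<^sup>2) \<le> inverse ((r n * (s - c))\<^sup>2)" for n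
          using r[of n] False by (intro le_imp_inverse_le) auto
        then show "\<forall>\<^sub>F n in sequentially. norm (inverse (1 + (r n * (s - c))\<^sup>2)) \<le> (inverse (r n))\<^sup>2 * inverse ((s - c)\<^sup>2)"
          by (intro always_eventually allI) (simp add: power_mult_distrib power_inverse)
      qed
      then show ?thesis using False by simp
    qed simp
  qed simp
  \<comment> \<open>The zero function has now acquired a second weak gradient, the classical one
    restricted to the level set.\<close>
  from H01_grad_zero_unique[OF this] have "AE x in \<mu>. (if \<phi> x = c then 1 else 0) *\<^sub>R grad \<phi> x = 0" by simp
  then show ?thesis by eventually_elim (simp split: if_splits)
qed

text \<open>In order: two bounds for ellipticity, the sign for the \<open>a0\<close> term, the band
  on which \<open>b\<close> must be small, and the vanishing below the slice. The band is closed
  because \<open>trunc_deriv\<close> may be one half at its ends.\<close>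

lemma trunc_slice:
  assumes "0 \<le> k'" "k' \<le> k"
  shows "0 \<le> trunc_deriv k s - trunc_deriv k' s" "trunc_deriv k s - trunc_deriv k' s \<le> 1"
    and "0 \<le> s * (trunc k s - trunc k' s)"
    and "trunc_deriv k s - trunc_deriv k' s \<noteq> 0 \<Longrightarrow> k' \<le> \<bar>s\<bar> \<and> \<bar>s\<bar> \<le> k"
    and "trunc k s - trunc k' s \<noteq> 0 \<Longrightarrow> k' < \<bar>s\<bar>"
proof -
  show "0 \<le> trunc_deriv k s - trunc_deriv k' s" "trunc_deriv k s - trunc_deriv k' s \<le> 1"
    using assms by (auto simp: trunc_deriv_def sgn_if)
  show "trunc_deriv k s - trunc_deriv k' s \<noteq> 0 \<Longrightarrow> k' \<le> \<bar>s\<bar> \<and> \<bar>s\<bar> \<le> k"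
    using assms by (auto simp: trunc_deriv_def sgn_if split: if_splits)
  show "trunc k s - trunc k' s \<noteq> 0 \<Longrightarrow> k' < \<bar>s\<bar>"
    using assms by (auto simp: trunc_def abs_if split: if_splits)
  have "s \<ge> 0 \<Longrightarrow> trunc k s - trunc k' s \<ge> 0" "s \<le> 0 \<Longrightarrow> trunc k s - trunc k' s \<le> 0"
    using assms by (auto simp: trunc_def abs_if)
  then show "0 \<le> s * (trunc k s - trunc k' s)"
    by (metis linear mult_nonneg_nonneg mult_nonpos_nonpos)
qed

lemma trunc_deriv_outside: "0 \<le> k \<Longrightarrow> k < \<bar>s\<bar> \<Longrightarrow> trunc_deriv k s = 0"
  by (auto simp: trunc_deriv_def sgn_if abs_if split: if_splits)

lemma trunc_deriv_inside: "\<bar>s\<bar> < k \<Longrightarrow> trunc_deriv k s = 1"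
  by (auto simp: trunc_deriv_def sgn_if)

lemma trunc_deriv_0: "trunc_deriv 0 s = 0"
  by (simp add: trunc_deriv_def)

text \<open>The intermediate value theorem, applied repeatedly from the top level \<open>T\<close>
  downwards, attains the values \<open>n / N * E 0\<close>. The level attaining \<open>E 0\<close>
  need not be 0, so one further step leads to 0; it costs nothing as \<open>E\<close> does not
  change on it. There are thus \<open>N + 1\<close> slices.\<close>

lemma equidistributed_levels:
  fixes E :: "real \<Rightarrow> real"
  assumes c: "continuous_on {0..T} E" and T: "0 \<le> T" "E T = 0" and mono: "\<And>s t. s \<le> t \<Longrightarrow> E t \<le> E s"
    and N: "N > 0"
  shows "\<exists>t::nat \<Rightarrow> real. t 0 = T \<and> t (Suc N) = 0 \<and> (\<forall>i. 0 \<le> t i) \<and> (\<forall>i. t (Suc i) \<le> t i) \<and>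
    (\<forall>i. E (t (Suc i)) - E (t i) \<le> E 0 / real N)"
proof -
  have E0: "0 \<le> E 0" using mono[of 0 T] T by simp
  \<comment> \<open>The minimum keeps the prescribed values attainable for every index, as the
    recursive choice produces an infinite sequence.\<close>
  let ?v = "\<lambda>n. real (min n N) / real N * E 0"
  have "\<exists>f. \<forall>n. (0 \<le> f n \<and> f n \<le> T \<and> E (f n) = ?v n \<and> (n = 0 \<longrightarrow> f n = T)) \<and> f (Suc n) \<le> f n"
  proof (rule dependent_nat_choice)
    show "\<exists>s. 0 \<le> s \<and> s \<le> T \<and> E s = ?v 0 \<and> (0 = (0::nat) \<longrightarrow> s = T)" using T by auto
    fix s :: real and n :: nat
    assume s: "0 \<le> s \<and> s \<le> T \<and> E s = ?v n \<and> (n = 0 \<longrightarrow> s = T)"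
    have "?v n \<le> ?v (Suc n)" "?v (Suc n) \<le> 1 * E 0"
      using N E0 by (intro mult_right_mono divide_right_mono; simp)+
    then have "\<exists>x\<ge>0. x \<le> s \<and> E x = ?v (Suc n)"
      using s by (intro IVT2') (auto intro: continuous_on_subset[OF c])
    then show "\<exists>y. (0 \<le> y \<and> y \<le> T \<and> E y = ?v (Suc n) \<and> (Suc n = 0 \<longrightarrow> y = T)) \<and> y \<le> s" using s by auto
  qed
  then obtain f where f: "\<And>n. 0 \<le> f n" "\<And>n. E (f n) = ?v n" "f 0 = T" "\<And>n. f (Suc n) \<le> f n" by metis
  define t where "t i = (if i \<le> N then f i else 0)" for i
  show ?thesis
  proof (intro exI[of _ t] conjI allI)
    fix i
    show "0 \<le> t i" "t (Suc i) \<le> t i" using f by (auto simp: t_def)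
    show "E (t (Suc i)) - E (t i) \<le> E 0 / real N"
    proof -
      consider "Suc i \<le> N" | "i = N" | "i > N" by linarith
      then show ?thesis
      proof cases
        case 1
        then show ?thesis using N by (simp add: t_def f(2) min_def field_simps)
      next
        case 2
        then show ?thesis using N E0 by (simp add: t_def f(2))
      next
        case 3
        then show ?thesis using E0 by (simp add: t_def)
      qed
    qed
  qed (auto simp: t_def f)
qed

text \<open>Hides the dimension: from here on it enters only through \<open>m\<close> and
  \<open>S\<close>. The even integer exponent makes \<open>v ^ (2 * m)\<close> a nonnegative power
  that needs no absolute value.\<close>

locale sobolev_set = bounded_open_set \<Omega> for \<Omega> :: "(real^'n::finite) set" +
  fixes m :: nat and S :: real
  assumes m: "m \<ge> 2" and S: "0 \<le> S"
    and sobolev: "test_fun \<Omega> v \<Longrightarrow> (\<integral>x. v x ^ (2 * m) \<partial>\<mu>) \<le> S * l2 \<mu> (grad v) ^ (2 * m)"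
begin

text \<open>Bounds the norm of multiplication by \<open>W powr ((1 - 1 / real m) / 2)\<close> as a
  map from H01 to L2, by Hoelder with \<open>\<theta> = 1 / real m\<close> followed by Sobolev. It
  sees \<open>W\<close> only through its integral, so slices with a small integral have a small
  drift.\<close>

definition \<kappa> :: "(real^'n \<Rightarrow> real) \<Rightarrow> real" where
  "\<kappa> W = sqrt (S powr (1 / real m) * (\<integral>x. W x \<partial>\<mu>) powr (1 - 1 / real m))"

lemma \<kappa>_nonneg: "0 \<le> \<kappa> W"
  by (simp add: \<kappa>_def)

lemma weighted_test:
  assumes v: "test_fun \<Omega> v" and W: "integrable \<mu> W" "\<And>x. 0 \<le> W x"
  shows "L2 \<mu> (\<lambda>x. W x powr ((1 - 1 / real m) / 2) * v x)"
    and "l2 \<mu> (\<lambda>x. W x powr ((1 - 1 / real m) / 2) * v x) \<le> \<kappa> W * l2 \<mu> (grad v)"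
proof -
  let ?\<theta> = "1 / real m" and ?X = "l2 \<mu> (grad v)"
  have \<theta>: "0 < ?\<theta>" "?\<theta> < 1" using m by auto
  have s: "smooth v" using v by (rule test_fun_smooth)
  have iv: "integrable \<mu> (\<lambda>x. v x ^ (2 * m))"
    by (rule L2_L1(1)[OF continuous_L2]) (intro smooth_continuous smooth_power s)
  have v2: "(v x ^ (2 * m)) powr ?\<theta> = (v x)\<^sup>2" for x
  proof (cases "v x = 0")
    case False
    then have "(v x ^ (2 * m)) powr ?\<theta> = (((v x)\<^sup>2) powr real m) powr ?\<theta>"
      by (simp add: power_mult powr_realpow)
    then show ?thesis using m by (simp add: powr_powr)
  qed (use m in simp)
  have sq: "(norm (W x powr ((1 - ?\<theta>) / 2) * v x))\<^sup>2 = W x powr (1 - ?\<theta>) * (v x ^ (2 * m)) powr ?\<theta>" for x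
    unfolding v2 by (simp add: power_mult_distrib power2_eq_square[of "W x powr _"] flip: powr_add)
  note H = holder_powr[OF W iv _ \<theta>]
  have m1: "v \<in> borel_measurable \<mu>" "W \<in> borel_measurable \<mu>" using test_L2(1)[OF v] W(1) by (auto simp: L2_def)
  show L: "L2 \<mu> (\<lambda>x. W x powr ((1 - ?\<theta>) / 2) * v x)"
    unfolding L2_def sq using H(1) m1 by auto
  have "(\<integral>x. v x ^ (2 * m) \<partial>\<mu>) powr ?\<theta> \<le> (S * ?X ^ (2 * m)) powr ?\<theta>"
    using \<theta> by (intro powr_mono2 sobolev v Bochner_Integration.integral_nonneg) auto
  also have "\<dots> = S powr ?\<theta> * ?X\<^sup>2"
  proof (cases "?X = 0")
    case False
    then have "(?X ^ (2 * m)) powr ?\<theta> = ((?X\<^sup>2) powr real m) powr ?\<theta>"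
      by (simp add: power_mult powr_realpow)
    also have "\<dots> = ?X\<^sup>2" using m by (simp add: powr_powr)
    finally show ?thesis by (simp add: powr_mult S l2_nonneg)
  qed (use m in simp)
  finally have sob: "(\<integral>x. v x ^ (2 * m) \<partial>\<mu>) powr ?\<theta> \<le> S powr ?\<theta> * ?X\<^sup>2" .
  have "(l2 \<mu> (\<lambda>x. W x powr ((1 - ?\<theta>) / 2) * v x))\<^sup>2 \<le> (\<integral>x. W x \<partial>\<mu>) powr (1 - ?\<theta>) * (\<integral>x. v x ^ (2 * m) \<partial>\<mu>) powr ?\<theta>"
    unfolding l2_power2 sq by (rule H(2)) simp
  also have "\<dots> \<le> (\<integral>x. W x \<partial>\<mu>) powr (1 - ?\<theta>) * (S powr ?\<theta> * ?X\<^sup>2)" by (intro mult_left_mono sob) simp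
  also have "\<dots> = (\<kappa> W * ?X)\<^sup>2" by (simp add: \<kappa>_def power_mult_distrib)
  finally show "l2 \<mu> (\<lambda>x. W x powr ((1 - ?\<theta>) / 2) * v x) \<le> \<kappa> W * ?X"
    by (rule power2_le_imp_le) (simp add: \<kappa>_nonneg l2_nonneg)
qed

text \<open>The weight is unbounded, so L2 convergence of the approximating test functions does not
  pass through the multiplication. Convergence almost everywhere along a subsequence does, and
  Fatou's lemma keeps the bound.\<close>

lemma weighted:
  assumes z: "H01 \<Omega> z" and W: "integrable \<mu> W" "\<And>x. 0 \<le> W x"
  shows "L2 \<mu> (\<lambda>x. W x powr ((1 - 1 / real m) / 2) * z x)"
    and "l2 \<mu> (\<lambda>x. W x powr ((1 - 1 / real m) / 2) * z x) \<le> \<kappa> W * H01_norm \<Omega> z"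
proof -
  obtain \<phi> where p: "\<And>j. test_fun \<Omega> (\<phi> j)" "(\<lambda>j. l2 \<mu> (\<lambda>x. \<phi> j x - z x)) \<longlonglongrightarrow> 0"
      "(\<lambda>j. l2 \<mu> (\<lambda>x. grad (\<phi> j) x - wgrad \<Omega> z x)) \<longlonglongrightarrow> 0" using H01_wgrad[OF z] unfolding H01_grad_iff by blast
  obtain r :: "nat \<Rightarrow> nat" where r: "strict_mono r" "AE x in \<mu>. (\<lambda>k. \<phi> (r k) x) \<longlonglongrightarrow> z x"
    using l2_AE_subseq[OF test_L2(1)[OF p(1)] H01_L2[OF z] p(2)] by blast
  have lim: "(\<lambda>k. \<kappa> W * l2 \<mu> (grad (\<phi> (r k)))) \<longlonglongrightarrow> \<kappa> W * H01_norm \<Omega> z"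
    using LIMSEQ_subseq_LIMSEQ[OF l2_tendsto[OF test_L2(2)[OF p(1)] wgrad_L2[OF z] p(3)] r(1)]
    unfolding H01_norm_eq by (intro tendsto_intros) (simp add: comp_def)
  have "L2 \<mu> (\<lambda>x. W x powr ((1 - 1 / real m) / 2) * z x) \<and>
      l2 \<mu> (\<lambda>x. W x powr ((1 - 1 / real m) / 2) * z x) \<le> \<kappa> W * H01_norm \<Omega> z"
  proof (rule L2_Fatou[OF weighted_test(1)[OF p(1) W] _ _ weighted_test(2)[OF p(1) W] lim])
    have [measurable]: "z \<in> borel_measurable \<mu>" "W \<in> borel_measurable \<mu>"
      using H01_L2[OF z] W(1) by (auto simp: L2_def)
    show "(\<lambda>x. W x powr ((1 - 1 / real m) / 2) * z x) \<in> borel_measurable \<mu>" by measurable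
    show "AE x in \<mu>. (\<lambda>k. W x powr ((1 - 1 / real m) / 2) * \<phi> (r k) x) \<longlonglongrightarrow> W x powr ((1 - 1 / real m) / 2) * z x"
      using r(2) by eventually_elim (intro tendsto_intros)
  qed
  then show "L2 \<mu> (\<lambda>x. W x powr ((1 - 1 / real m) / 2) * z x)"
    "l2 \<mu> (\<lambda>x. W x powr ((1 - 1 / real m) / 2) * z x) \<le> \<kappa> W * H01_norm \<Omega> z" by auto
qed

lemma poincare: "H01 \<Omega> z \<Longrightarrow> l2 \<mu> z \<le> \<kappa> (\<lambda>x. 1) * H01_norm \<Omega> z"
  using weighted(2)[of z "\<lambda>x. 1"] by simp

text \<open>\<open>H01_norm\<close> controls gradients only. For completeness the gradients converge
  by themselves, Poincare's inequality makes the functions Cauchy as well, and closedness of the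
  weak gradient joins the two limits.\<close>

sublocale H: function_semi_inner "H01 \<Omega>" "\<lambda>y z. \<integral>x. wgrad \<Omega> y x \<bullet> wgrad \<Omega> z x \<partial>\<mu>" "H01_norm \<Omega>"
proof
  fix y z w :: "real^'n \<Rightarrow> real" and c :: real
  have wm: "wgrad \<Omega> u \<in> borel_measurable \<mu>" if "H01 \<Omega> u" for u using wgrad_L2[OF that] by (simp add: L2_def)
  show "(\<integral>x. wgrad \<Omega> (\<lambda>x. y x + z x) x \<bullet> wgrad \<Omega> w x \<partial>\<mu>)
      = (\<integral>x. wgrad \<Omega> y x \<bullet> wgrad \<Omega> w x \<partial>\<mu>) + (\<integral>x. wgrad \<Omega> z x \<bullet> wgrad \<Omega> w x \<partial>\<mu>)"
    if yzw: "H01 \<Omega> y" "H01 \<Omega> z" "H01 \<Omega> w"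
  proof -
    have "(\<integral>x. wgrad \<Omega> (\<lambda>x. y x + z x) x \<bullet> wgrad \<Omega> w x \<partial>\<mu>)
        = (\<integral>x. wgrad \<Omega> y x \<bullet> wgrad \<Omega> w x + wgrad \<Omega> z x \<bullet> wgrad \<Omega> w x \<partial>\<mu>)"
    proof (rule integral_cong_AE)
      show "AE x in \<mu>. wgrad \<Omega> (\<lambda>x. y x + z x) x \<bullet> wgrad \<Omega> w x = wgrad \<Omega> y x \<bullet> wgrad \<Omega> w x + wgrad \<Omega> z x \<bullet> wgrad \<Omega> w x"
        using wgrad_add[OF yzw(1,2)] by eventually_elim (simp add: inner_add_left)
    qed (use wm yzw H01_add in \<open>auto intro!: borel_measurable_add borel_measurable_inner\<close>)
    then show ?thesis using yzw by (simp add: L2_inner wgrad_L2)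
  qed
  show "(\<integral>x. wgrad \<Omega> (\<lambda>x. c * y x) x \<bullet> wgrad \<Omega> w x \<partial>\<mu>) = c * (\<integral>x. wgrad \<Omega> y x \<bullet> wgrad \<Omega> w x \<partial>\<mu>)"
    if yw: "H01 \<Omega> y" "H01 \<Omega> w"
  proof -
    have "(\<integral>x. wgrad \<Omega> (\<lambda>x. c * y x) x \<bullet> wgrad \<Omega> w x \<partial>\<mu>) = (\<integral>x. c * (wgrad \<Omega> y x \<bullet> wgrad \<Omega> w x) \<partial>\<mu>)"
    proof (rule integral_cong_AE)
      show "AE x in \<mu>. wgrad \<Omega> (\<lambda>x. c * y x) x \<bullet> wgrad \<Omega> w x = c * (wgrad \<Omega> y x \<bullet> wgrad \<Omega> w x)"
        using wgrad_cmult[OF yw(1), of c] by eventually_elim simp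
    qed (use wm yw H01_cmult in \<open>auto intro!: borel_measurable_times borel_measurable_inner\<close>)
    then show ?thesis by simp
  qed
  show "(\<integral>x. wgrad \<Omega> y x \<bullet> wgrad \<Omega> w x \<partial>\<mu>) = (\<integral>x. wgrad \<Omega> w x \<bullet> wgrad \<Omega> y x \<partial>\<mu>)"
    by (simp add: inner_commute)
  show "0 \<le> (\<integral>x. wgrad \<Omega> y x \<bullet> wgrad \<Omega> y x \<partial>\<mu>)" by (intro Bochner_Integration.integral_nonneg) simp
  show "H01_norm \<Omega> y = sqrt (\<integral>x. wgrad \<Omega> y x \<bullet> wgrad \<Omega> y x \<partial>\<mu>)"
    by (simp add: H01_norm_def power2_norm_eq_inner)
next
  fix f :: "nat \<Rightarrow> real^'n \<Rightarrow> real"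
  assume f: "\<And>k. H01 \<Omega> (f k)"
    and C: "\<And>e. e > 0 \<Longrightarrow> \<exists>N. \<forall>i\<ge>N. \<forall>j\<ge>N. H01_norm \<Omega> (\<lambda>x. f i x - f j x) < e"
  have nd: "H01_norm \<Omega> (\<lambda>x. f i x - f j x) = l2 \<mu> (\<lambda>x. wgrad \<Omega> (f i) x - wgrad \<Omega> (f j) x)" for i j
    by (rule H01_norm_grad[OF H01_grad_diff[OF H01_wgrad[OF f] H01_wgrad[OF f]]])
  obtain G where G: "L2 \<mu> G" "(\<lambda>k. l2 \<mu> (\<lambda>x. wgrad \<Omega> (f k) x - G x)) \<longlonglongrightarrow> 0"
    by (rule L2_complete[of "\<lambda>k. wgrad \<Omega> (f k)"]) (use wgrad_L2[OF f] C in \<open>auto simp: nd\<close>)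
  obtain y where y: "L2 \<mu> y" "(\<lambda>k. l2 \<mu> (\<lambda>x. f k x - y x)) \<longlonglongrightarrow> 0"
  proof (rule L2_complete[of f])
    show "L2 \<mu> (f k)" for k by (rule H01_L2[OF f])
    fix e :: real assume e: "e > 0"
    define P where "P = \<kappa> (\<lambda>x. 1) + 1"
    have P: "P > 0" using \<kappa>_nonneg[of "\<lambda>x. 1"] by (simp add: P_def)
    then obtain N where N: "\<And>i j. i \<ge> N \<Longrightarrow> j \<ge> N \<Longrightarrow> H01_norm \<Omega> (\<lambda>x. f i x - f j x) < e / P"
      using C[of "e / P"] e by auto
    have "l2 \<mu> (\<lambda>x. f i x - f j x) < e" if "i \<ge> N" "j \<ge> N" for i j
    proof -
      have "l2 \<mu> (\<lambda>x. f i x - f j x) \<le> \<kappa> (\<lambda>x. 1) * H01_norm \<Omega> (\<lambda>x. f i x - f j x)"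
        by (rule poincare[OF H01_diff[OF f f]])
      also have "\<dots> \<le> P * H01_norm \<Omega> (\<lambda>x. f i x - f j x)"
        by (intro mult_right_mono) (auto simp: P_def H01_norm_eq l2_nonneg)
      also have "\<dots> < e" using N[OF that] P by (simp add: field_simps)
      finally show ?thesis .
    qed
    then show "\<exists>N. \<forall>i\<ge>N. \<forall>j\<ge>N. l2 \<mu> (\<lambda>x. f i x - f j x) < e" by blast
  qed
  have H: "H01_grad \<Omega> y G" by (rule H01_grad_limit[OF H01_wgrad[OF f] y(1) G(1) y(2) G(2)])
  have "H01_norm \<Omega> (\<lambda>x. f k x - y x) = l2 \<mu> (\<lambda>x. wgrad \<Omega> (f k) x - G x)" for k
    by (rule H01_norm_grad[OF H01_grad_diff[OF H01_wgrad[OF f] H]])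
  then show "\<exists>g. H01 \<Omega> g \<and> (\<lambda>k. H01_norm \<Omega> (\<lambda>x. f k x - g x)) \<longlonglongrightarrow> 0"
    using H G(2) by (intro exI[of _ y]) (auto simp: H01_def)
qed (auto intro: H01_zero H01_add H01_cmult)

end

section \<open>The a priori estimate\<close>

text \<open>Dividing by \<open>X j\<close> and absorbing its own term
  \<open>\<Lambda> / 2 * X j\<close> on the left leaves
  \<open>X j \<le> 2 * M / \<Lambda> + (\<Sum>i<j. X i)\<close>. Each further slice thus at most
  doubles the partial sum and adds \<open>2 * M / \<Lambda>\<close>, whence the power of
  two.\<close>

lemma slice_recursion:
  fixes X :: "nat \<Rightarrow> real"
  assumes X: "\<And>j. 0 \<le> X j" and L: "\<Lambda> > 0" and M: "M \<ge> 0"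
    and le: "\<And>j. j \<le> N \<Longrightarrow> \<Lambda> * (X j)\<^sup>2 \<le> M * X j + (\<Sum>i\<le>j. X i * (\<Lambda> / 2 * X j))"
    and j: "j \<le> N"
  shows "(\<Sum>i\<le>j. X i) \<le> (2 ^ Suc j - 1) * (2 * M / \<Lambda>)"
proof -
  have step: "X j \<le> 2 * M / \<Lambda> + (\<Sum>i<j. X i)" if j: "j \<le> N" for j
  proof (cases "X j = 0")
    case True
    then show ?thesis using X L M by (simp add: sum_nonneg)
  next
    case False
    then have p: "X j > 0" using X[of j] by linarith
    have "(\<Sum>i\<le>j. X i * (\<Lambda> / 2 * X j)) = (\<Sum>i<j. X i) * (\<Lambda> / 2 * X j) + X j * (\<Lambda> / 2 * X j)"
      by (simp add: lessThan_Suc_atMost[symmetric] sum_distrib_right)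
    then have "\<Lambda> * X j * X j \<le> (M + (\<Sum>i<j. X i) * (\<Lambda> / 2) + X j * (\<Lambda> / 2)) * X j"
      using le[OF j] by (simp add: power2_eq_square algebra_simps)
    then have "\<Lambda> * X j \<le> M + (\<Sum>i<j. X i) * (\<Lambda> / 2) + X j * (\<Lambda> / 2)"
      using p by (simp add: mult_le_cancel_right)
    then show ?thesis using L by (simp add: field_simps)
  qed
  show ?thesis using j
  proof (induction j)
    case 0
    then show ?case using step[of 0] by simp
  next
    case (Suc j)
    have "(\<Sum>i\<le>Suc j. X i) \<le> 2 * (\<Sum>i\<le>j. X i) + 2 * M / \<Lambda>"
      using step[OF Suc.prems] by (simp add: lessThan_Suc_atMost)
    also have "\<dots> \<le> 2 * ((2 ^ Suc j - 1) * (2 * M / \<Lambda>)) + 2 * M / \<Lambda>" using Suc by simp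
    also have "\<dots> = (2 ^ Suc (Suc j) - 1) * (2 * M / \<Lambda>)" by (simp add: algebra_simps)
    finally show ?case .
  qed
qed

text \<open>With these exponents \<open>norm (b x) * z x\<close> and
  \<open>sqrt \<bar>a0 x\<bar> * z x\<close> are square integrable for \<open>z\<close> in H01. The
  locale is instantiated for the given coefficients and again for the interpolated ones.\<close>

locale elliptic_coeffs = sobolev_set \<Omega> m S
  for \<Omega> :: "(real^'n::finite) set" and m :: nat and S :: real +
  fixes a :: "'n \<Rightarrow> 'n \<Rightarrow> real^'n \<Rightarrow> real" and b :: "real^'n \<Rightarrow> real^'n" and a0 :: "real^'n \<Rightarrow> real"
  assumes a_Linf: "\<And>i j. Linf \<Omega> (a i j)"
    and b_meas: "b \<in> borel_measurable \<mu>"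
    and b_int: "integrable \<mu> (\<lambda>x. norm (b x) powr (2 * (real m / (real m - 1))))"
    and a0_meas: "a0 \<in> borel_measurable \<mu>"
    and a0_int: "integrable \<mu> (\<lambda>x. \<bar>a0 x\<bar> powr (real m / (real m - 1)))"
    and a0_nonneg: "AE x in \<mu>. 0 \<le> a0 x"
begin

text \<open>The weights are normalised so that the power used in \<open>weighted\<close> returns
  \<open>norm (b x)\<close> from \<open>Wb\<close> and \<open>sqrt \<bar>a0 x\<bar>\<close> from
  \<open>W0\<close>.\<close>

definition Wb :: "real^'n \<Rightarrow> real" where "Wb x = norm (b x) powr (2 * (real m / (real m - 1)))"
definition W0 :: "real^'n \<Rightarrow> real" where "W0 x = \<bar>a0 x\<bar> powr (real m / (real m - 1))"

lemma Wb: "integrable \<mu> Wb" "0 \<le> Wb x"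
  using b_int by (auto simp: Wb_def[abs_def])

lemma W0: "integrable \<mu> W0" "0 \<le> W0 x"
  using a0_int by (auto simp: W0_def[abs_def])

lemma Wb_powr: "Wb x powr ((1 - 1 / real m) / 2) = norm (b x)"
proof -
  have eq: "2 * (real m / (real m - 1)) * ((1 - 1 / real m) / 2) = 1" using m by (simp add: field_simps)
  show ?thesis unfolding Wb_def powr_powr eq by simp
qed

lemma W0_powr: "W0 x powr ((1 - 1 / real m) / 2) = sqrt \<bar>a0 x\<bar>"
proof -
  have eq: "real m / (real m - 1) * ((1 - 1 / real m) / 2) = 1 / 2" using m by (simp add: field_simps)
  show ?thesis unfolding W0_def powr_powr eq by (simp add: powr_half_sqrt)
qed

text \<open>The exceptional null set must not depend on the vectors. It comes from the finitely many
  coefficients, so the quantifier over vectors can stand inside \<open>AE\<close>.\<close>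

lemma a_bound:
  obtains K where "K \<ge> 0" "AE x in \<mu>. \<forall>g h. \<bar>\<Sum>i\<in>UNIV. \<Sum>j\<in>UNIV. a i j x * g $ i * h $ j\<bar> \<le> K * (norm g * norm h)"
proof -
  have "\<exists>K. \<forall>i j. AE x in \<mu>. \<bar>a i j x\<bar> \<le> K i j"
    using a_Linf unfolding Linf_def by metis
  then obtain K where K: "\<And>i j. AE x in \<mu>. \<bar>a i j x\<bar> \<le> K i j" by blast
  define K' where "K' = (\<Sum>i\<in>UNIV. \<Sum>j\<in>UNIV. \<bar>K i j\<bar>)"
  have "AE x in \<mu>. \<forall>i\<in>UNIV. \<forall>j\<in>UNIV. \<bar>a i j x\<bar> \<le> K i j"
    by (intro AE_finite_allI K) auto
  then have "AE x in \<mu>. \<forall>g h. \<bar>\<Sum>i\<in>UNIV. \<Sum>j\<in>UNIV. a i j x * g $ i * h $ j\<bar> \<le> K' * (norm g * norm h)"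
  proof (eventually_elim, intro allI)
    fix x and g h :: "real^'n" assume Kx: "\<forall>i\<in>UNIV. \<forall>j\<in>UNIV. \<bar>a i j x\<bar> \<le> K i j"
    have "\<bar>\<Sum>i\<in>UNIV. \<Sum>j\<in>UNIV. a i j x * g $ i * h $ j\<bar> \<le> (\<Sum>i\<in>UNIV. \<bar>\<Sum>j\<in>UNIV. a i j x * g $ i * h $ j\<bar>)"
      by (rule sum_abs)
    also have "\<dots> \<le> (\<Sum>i\<in>UNIV. \<Sum>j\<in>UNIV. \<bar>a i j x * g $ i * h $ j\<bar>)" by (intro sum_mono sum_abs)
    also have "\<dots> \<le> (\<Sum>i\<in>UNIV. \<Sum>j\<in>UNIV. \<bar>K i j\<bar> * (norm g * norm h))"
    proof (intro sum_mono)
      fix i j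
      have "\<bar>a i j x\<bar> \<le> \<bar>K i j\<bar>" using Kx by (meson UNIV_I abs_ge_self order_trans)
      then have "\<bar>a i j x\<bar> * (\<bar>g $ i\<bar> * \<bar>h $ j\<bar>) \<le> \<bar>K i j\<bar> * (norm g * norm h)"
        by (intro mult_mono component_le_norm_cart) auto
      then show "\<bar>a i j x * g $ i * h $ j\<bar> \<le> \<bar>K i j\<bar> * (norm g * norm h)" by (simp add: abs_mult mult.assoc)
    qed
    finally show "\<bar>\<Sum>i\<in>UNIV. \<Sum>j\<in>UNIV. a i j x * g $ i * h $ j\<bar> \<le> K' * (norm g * norm h)"
      by (simp add: K'_def sum_distrib_right)
  qed
  then show thesis by (intro that[of K']) (auto simp: K'_def intro!: sum_nonneg)
qed

section \<open>Boundedness and bilinearity of the form\<close>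

lemma integrable_dominated_product:
  fixes u :: "real^'n \<Rightarrow> 'b::euclidean_space" and v :: "real^'n \<Rightarrow> 'c::euclidean_space"
  assumes f: "f \<in> borel_measurable \<mu>" and le: "AE x in \<mu>. \<bar>f x\<bar> \<le> K * (norm (u x) * norm (v x))"
    and uv: "L2 \<mu> u" "L2 \<mu> v" and K: "0 \<le> K"
  shows "integrable \<mu> f" "\<bar>\<integral>x. f x \<partial>\<mu>\<bar> \<le> K * (l2 \<mu> u * l2 \<mu> v)"
proof -
  have i: "integrable \<mu> (\<lambda>x. K * (norm (u x) * norm (v x)))" using L2_norm_mult[OF uv] by simp
  show fi: "integrable \<mu> f"
    by (rule Bochner_Integration.integrable_bound[OF i f]) (use le in eventually_elim, use K in auto)
  have "\<bar>\<integral>x. f x \<partial>\<mu>\<bar> \<le> (\<integral>x. \<bar>f x\<bar> \<partial>\<mu>)" using integral_norm_bound[of \<mu> f] by simp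
  also have "\<dots> \<le> (\<integral>x. K * (norm (u x) * norm (v x)) \<partial>\<mu>)" using fi i le by (intro integral_mono_AE) auto
  also have "\<dots> \<le> K * (l2 \<mu> u * l2 \<mu> v)" using Cauchy_Schwarz_L2[OF uv] K by (simp add: mult_left_mono)
  finally show "\<bar>\<integral>x. f x \<partial>\<mu>\<bar> \<le> K * (l2 \<mu> u * l2 \<mu> v)" .
qed

text \<open>Gradients are separate arguments, so that the classical gradient of a test function or
  the explicit gradient of a slice can be inserted in place of \<open>wgrad\<close>.\<close>

definition form :: "(real^'n \<Rightarrow> real^'n) \<Rightarrow> (real^'n \<Rightarrow> real) \<Rightarrow> (real^'n \<Rightarrow> real^'n) \<Rightarrow> (real^'n \<Rightarrow> real) \<Rightarrow> real^'n \<Rightarrow> real" where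
  "form g y h z x = (\<Sum>i\<in>UNIV. \<Sum>j\<in>UNIV. a i j x * g x $ i * h x $ j) + (b x \<bullet> g x) * z x + a0 x * y x * z x"

lemma opA_form: "opA_integrand a b a0 \<Omega> y z = form (wgrad \<Omega> y) y (wgrad \<Omega> z) z"
  by (rule ext) (simp add: opA_integrand_def form_def)

lemma weighted_b: assumes "H01 \<Omega> z"
  shows "L2 \<mu> (\<lambda>x. norm (b x) * z x)" "l2 \<mu> (\<lambda>x. norm (b x) * z x) \<le> \<kappa> Wb * H01_norm \<Omega> z"
  using weighted[OF assms Wb] by (simp_all add: Wb_powr)

lemma weighted_a0: assumes "H01 \<Omega> z"
  shows "L2 \<mu> (\<lambda>x. sqrt \<bar>a0 x\<bar> * z x)" "l2 \<mu> (\<lambda>x. sqrt \<bar>a0 x\<bar> * z x) \<le> \<kappa> W0 * H01_norm \<Omega> z"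
  using weighted[OF assms W0] by (simp_all add: W0_powr)

lemma form_measurable:
  assumes "H01_grad \<Omega> y g" "H01_grad \<Omega> z h"
  shows "(\<lambda>x. \<Sum>i\<in>UNIV. \<Sum>j\<in>UNIV. a i j x * g x $ i * h x $ j) \<in> borel_measurable \<mu>"
    "(\<lambda>x. (b x \<bullet> g x) * z x) \<in> borel_measurable \<mu>" "(\<lambda>x. a0 x * y x * z x) \<in> borel_measurable \<mu>"
    "form g y h z \<in> borel_measurable \<mu>"
proof -
  have [measurable]: "a i j \<in> borel_measurable \<mu>" for i j using a_Linf by (simp add: Linf_def)
  have [measurable]: "g \<in> borel_measurable \<mu>" "h \<in> borel_measurable \<mu>" "y \<in> borel_measurable \<mu>" "z \<in> borel_measurable \<mu>"
    using H01_grad_L2[OF assms(1)] H01_grad_L2[OF assms(2)] by (auto simp: L2_def)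
  have [measurable]: "(\<lambda>x. g x $ i) \<in> borel_measurable \<mu>" "(\<lambda>x. h x $ i) \<in> borel_measurable \<mu>" for i
    using \<open>g \<in> _\<close> \<open>h \<in> _\<close> unfolding borel_measurable_vec_iff by auto
  note b_meas[measurable] a0_meas[measurable]
  show 1: "(\<lambda>x. \<Sum>i\<in>UNIV. \<Sum>j\<in>UNIV. a i j x * g x $ i * h x $ j) \<in> borel_measurable \<mu>" by measurable
  show 2: "(\<lambda>x. (b x \<bullet> g x) * z x) \<in> borel_measurable \<mu>" by measurable
  show 3: "(\<lambda>x. a0 x * y x * z x) \<in> borel_measurable \<mu>" by measurable
  show "form g y h z \<in> borel_measurable \<mu>" unfolding form_def[abs_def] using 1 2 3 by measurable
qed

text \<open>Each term is dominated by a product of two L2 functions: the drift puts the weight on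
  \<open>z\<close>, and the last term gives one factor \<open>sqrt \<bar>a0 x\<bar>\<close> to each
  of \<open>y\<close> and \<open>z\<close>.\<close>

lemma form_bound:
  obtains K where "K \<ge> 0" "\<And>y g z h. H01_grad \<Omega> y g \<Longrightarrow> H01_grad \<Omega> z h \<Longrightarrow>
      integrable \<mu> (form g y h z) \<and> \<bar>\<integral>x. form g y h z x \<partial>\<mu>\<bar> \<le> K * l2 \<mu> g * l2 \<mu> h"
proof -
  obtain K where K: "K \<ge> 0"
    "AE x in \<mu>. \<forall>g h. \<bar>\<Sum>i\<in>UNIV. \<Sum>j\<in>UNIV. a i j x * g $ i * h $ j\<bar> \<le> K * (norm g * norm h)"
    by (rule a_bound)
  show thesis
  proof (rule that[of "K + \<kappa> Wb + \<kappa> W0 * \<kappa> W0"])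
    show "0 \<le> K + \<kappa> Wb + \<kappa> W0 * \<kappa> W0" using K(1) by (simp add: \<kappa>_nonneg)
    fix y g z h assume yg: "H01_grad \<Omega> y g" and zh: "H01_grad \<Omega> z h"
    have H: "H01 \<Omega> y" "H01 \<Omega> z" using yg zh by (auto simp: H01_def)
    have n: "H01_norm \<Omega> y = l2 \<mu> g" "H01_norm \<Omega> z = l2 \<mu> h" using H01_norm_grad yg zh by auto
    note L = H01_grad_L2(2)[OF yg] H01_grad_L2(2)[OF zh]
    have A: "integrable \<mu> (\<lambda>x. \<Sum>i\<in>UNIV. \<Sum>j\<in>UNIV. a i j x * g x $ i * h x $ j)"
      "\<bar>\<integral>x. (\<Sum>i\<in>UNIV. \<Sum>j\<in>UNIV. a i j x * g x $ i * h x $ j) \<partial>\<mu>\<bar> \<le> K * (l2 \<mu> g * l2 \<mu> h)"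
      by (rule integrable_dominated_product[OF form_measurable(1)[OF yg zh] _ L K(1)], use K(2) in force)+
    have Bd: "AE x in \<mu>. \<bar>(b x \<bullet> g x) * z x\<bar> \<le> 1 * (norm (g x) * norm (norm (b x) * z x))"
    proof (rule AE_I2)
      fix x
      have "\<bar>b x \<bullet> g x\<bar> * \<bar>z x\<bar> \<le> norm (b x) * norm (g x) * \<bar>z x\<bar>"
        by (intro mult_right_mono Cauchy_Schwarz_ineq2) auto
      then show "\<bar>(b x \<bullet> g x) * z x\<bar> \<le> 1 * (norm (g x) * norm (norm (b x) * z x))"
        by (simp add: abs_mult mult_ac)
    qed
    have B: "integrable \<mu> (\<lambda>x. (b x \<bullet> g x) * z x)"
      "\<bar>\<integral>x. (b x \<bullet> g x) * z x \<partial>\<mu>\<bar> \<le> 1 * (l2 \<mu> g * l2 \<mu> (\<lambda>x. norm (b x) * z x))"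
      by (rule integrable_dominated_product[OF form_measurable(2)[OF yg zh] Bd L(1) weighted_b(1)[OF H(2)]], simp)+
    have "l2 \<mu> g * l2 \<mu> (\<lambda>x. norm (b x) * z x) \<le> l2 \<mu> g * (\<kappa> Wb * l2 \<mu> h)"
      using weighted_b(2)[OF H(2)] by (intro mult_left_mono) (auto simp: n l2_nonneg)
    then have B2: "\<bar>\<integral>x. (b x \<bullet> g x) * z x \<partial>\<mu>\<bar> \<le> \<kappa> Wb * l2 \<mu> g * l2 \<mu> h" using B(2) by (simp add: mult_ac)
    have Cd: "AE x in \<mu>. \<bar>a0 x * y x * z x\<bar> \<le> 1 * (norm (sqrt \<bar>a0 x\<bar> * y x) * norm (sqrt \<bar>a0 x\<bar> * z x))"
    proof (rule AE_I2)
      fix x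
      have "\<bar>a0 x\<bar> = sqrt \<bar>a0 x\<bar> * sqrt \<bar>a0 x\<bar>" by simp
      then show "\<bar>a0 x * y x * z x\<bar> \<le> 1 * (norm (sqrt \<bar>a0 x\<bar> * y x) * norm (sqrt \<bar>a0 x\<bar> * z x))"
        by (simp add: abs_mult mult_ac)
    qed
    have C: "integrable \<mu> (\<lambda>x. a0 x * y x * z x)"
      "\<bar>\<integral>x. a0 x * y x * z x \<partial>\<mu>\<bar> \<le> 1 * (l2 \<mu> (\<lambda>x. sqrt \<bar>a0 x\<bar> * y x) * l2 \<mu> (\<lambda>x. sqrt \<bar>a0 x\<bar> * z x))"
      by (rule integrable_dominated_product[OF form_measurable(3)[OF yg zh] Cd weighted_a0(1)[OF H(1)] weighted_a0(1)[OF H(2)]], simp)+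
    have "l2 \<mu> (\<lambda>x. sqrt \<bar>a0 x\<bar> * y x) * l2 \<mu> (\<lambda>x. sqrt \<bar>a0 x\<bar> * z x) \<le> (\<kappa> W0 * l2 \<mu> g) * (\<kappa> W0 * l2 \<mu> h)"
      using weighted_a0(2)[OF H(1)] weighted_a0(2)[OF H(2)]
      by (intro mult_mono) (auto simp: n l2_nonneg \<kappa>_nonneg)
    then have C2: "\<bar>\<integral>x. a0 x * y x * z x \<partial>\<mu>\<bar> \<le> \<kappa> W0 * \<kappa> W0 * l2 \<mu> g * l2 \<mu> h" using C(2) by (simp add: mult_ac)
    have i: "integrable \<mu> (form g y h z)" unfolding form_def[abs_def] using A(1) B(1) C(1) by simp
    have "(\<integral>x. form g y h z x \<partial>\<mu>) = (\<integral>x. (\<Sum>i\<in>UNIV. \<Sum>j\<in>UNIV. a i j x * g x $ i * h x $ j) \<partial>\<mu>)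
        + (\<integral>x. (b x \<bullet> g x) * z x \<partial>\<mu>) + (\<integral>x. a0 x * y x * z x \<partial>\<mu>)"
      unfolding form_def using A(1) B(1) C(1) by (subst Bochner_Integration.integral_add; simp)+
    then have "\<bar>\<integral>x. form g y h z x \<partial>\<mu>\<bar> \<le> K * (l2 \<mu> g * l2 \<mu> h) + \<kappa> Wb * l2 \<mu> g * l2 \<mu> h + \<kappa> W0 * \<kappa> W0 * l2 \<mu> g * l2 \<mu> h"
      using A(2) B2 C2 by linarith
    with i show "integrable \<mu> (form g y h z) \<and> \<bar>\<integral>x. form g y h z x \<partial>\<mu>\<bar> \<le> (K + \<kappa> Wb + \<kappa> W0 * \<kappa> W0) * l2 \<mu> g * l2 \<mu> h"
      by (simp add: algebra_simps)
  qed
qed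

lemma form_integrable: "H01_grad \<Omega> y g \<Longrightarrow> H01_grad \<Omega> z h \<Longrightarrow> integrable \<mu> (form g y h z)"
  using form_bound by metis

lemma opA_integrable: "H01 \<Omega> y \<Longrightarrow> H01 \<Omega> z \<Longrightarrow> integrable \<mu> (opA_integrand a b a0 \<Omega> y z)"
  unfolding opA_form by (intro form_integrable H01_wgrad)

lemma opA_bound:
  obtains K where "K \<ge> 0" "\<And>y z. H01 \<Omega> y \<Longrightarrow> H01 \<Omega> z \<Longrightarrow> \<bar>opA a b a0 \<Omega> y z\<bar> \<le> K * H01_norm \<Omega> y * H01_norm \<Omega> z"
proof -
  obtain K where K: "K \<ge> 0" "\<And>y g z h. H01_grad \<Omega> y g \<Longrightarrow> H01_grad \<Omega> z h \<Longrightarrow>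
      integrable \<mu> (form g y h z) \<and> \<bar>\<integral>x. form g y h z x \<partial>\<mu>\<bar> \<le> K * l2 \<mu> g * l2 \<mu> h" by (rule form_bound) blast
  show thesis
    by (rule that[OF K(1)]) (use K(2)[OF H01_wgrad H01_wgrad] in \<open>auto simp: opA_def opA_form H01_norm_eq\<close>)
qed

lemma opA_eq:
  assumes "H01_grad \<Omega> y g" "H01_grad \<Omega> z h"
  shows "opA a b a0 \<Omega> y z = (\<integral>x. form g y h z x \<partial>\<mu>)"
proof -
  have "H01 \<Omega> y" "H01 \<Omega> z" using assms by (auto simp: H01_def)
  note H = this[THEN H01_wgrad]
  show ?thesis unfolding opA_def opA_form
  proof (rule integral_cong_AE[OF form_measurable(4)[OF H] form_measurable(4)[OF assms]])
    show "AE x in \<mu>. form (wgrad \<Omega> y) y (wgrad \<Omega> z) z x = form g y h z x"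
      using wgrad_AE_eq[OF assms(1)] wgrad_AE_eq[OF assms(2)] by eventually_elim (simp add: form_def)
  qed
qed

lemma opA_bounded_functional:
  assumes w: "H01 \<Omega> w"
  shows "H.bounded_functional (opA a b a0 \<Omega> w)" "H.bounded_functional (\<lambda>y. opA a b a0 \<Omega> y w)"
proof -
  obtain K where K: "\<And>y z. H01 \<Omega> y \<Longrightarrow> H01 \<Omega> z \<Longrightarrow> \<bar>opA a b a0 \<Omega> y z\<bar> \<le> K * H01_norm \<Omega> y * H01_norm \<Omega> z"
    using opA_bound by metis
  note W = H01_wgrad[OF w]
  have right: "opA a b a0 \<Omega> w (\<lambda>x. y x + z x) = opA a b a0 \<Omega> w y + opA a b a0 \<Omega> w z"
    and left: "opA a b a0 \<Omega> (\<lambda>x. y x + z x) w = opA a b a0 \<Omega> y w + opA a b a0 \<Omega> z w"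
    if yz: "H01 \<Omega> y" "H01 \<Omega> z" for y z
  proof -
    note Y = H01_wgrad[OF yz(1)] and Z = H01_wgrad[OF yz(2)]
    have "form (wgrad \<Omega> w) w (\<lambda>x. wgrad \<Omega> y x + wgrad \<Omega> z x) (\<lambda>x. y x + z x) x
        = form (wgrad \<Omega> w) w (wgrad \<Omega> y) y x + form (wgrad \<Omega> w) w (wgrad \<Omega> z) z x" for x
      by (simp add: form_def algebra_simps sum.distrib)
    then show "opA a b a0 \<Omega> w (\<lambda>x. y x + z x) = opA a b a0 \<Omega> w y + opA a b a0 \<Omega> w z"
      using form_integrable[OF W Y] form_integrable[OF W Z]
      by (simp add: opA_eq[OF W H01_grad_add[OF Y Z]] opA_eq[OF W Y] opA_eq[OF W Z])
    have "form (\<lambda>x. wgrad \<Omega> y x + wgrad \<Omega> z x) (\<lambda>x. y x + z x) (wgrad \<Omega> w) w x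
        = form (wgrad \<Omega> y) y (wgrad \<Omega> w) w x + form (wgrad \<Omega> z) z (wgrad \<Omega> w) w x" for x
      by (simp add: form_def algebra_simps sum.distrib inner_add_right)
    then show "opA a b a0 \<Omega> (\<lambda>x. y x + z x) w = opA a b a0 \<Omega> y w + opA a b a0 \<Omega> z w"
      using form_integrable[OF Y W] form_integrable[OF Z W]
      by (simp add: opA_eq[OF H01_grad_add[OF Y Z] W] opA_eq[OF Y W] opA_eq[OF Z W])
  qed
  have scale: "opA a b a0 \<Omega> w (\<lambda>x. c * y x) = c * opA a b a0 \<Omega> w y"
    "opA a b a0 \<Omega> (\<lambda>x. c * y x) w = c * opA a b a0 \<Omega> y w" if y: "H01 \<Omega> y" for c y
  proof -
    note Y = H01_wgrad[OF y]
    have "form (wgrad \<Omega> w) w (\<lambda>x. c *\<^sub>R wgrad \<Omega> y x) (\<lambda>x. c * y x) x = c * form (wgrad \<Omega> w) w (wgrad \<Omega> y) y x"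
      "form (\<lambda>x. c *\<^sub>R wgrad \<Omega> y x) (\<lambda>x. c * y x) (wgrad \<Omega> w) w x = c * form (wgrad \<Omega> y) y (wgrad \<Omega> w) w x" for x
      by (simp_all add: form_def algebra_simps sum_distrib_left)
    then show "opA a b a0 \<Omega> w (\<lambda>x. c * y x) = c * opA a b a0 \<Omega> w y"
      "opA a b a0 \<Omega> (\<lambda>x. c * y x) w = c * opA a b a0 \<Omega> y w"
      by (simp_all add: opA_eq[OF W H01_grad_cmult[OF Y]] opA_eq[OF W Y] opA_eq[OF H01_grad_cmult[OF Y] W] opA_eq[OF Y W])
  qed
  have "\<bar>opA a b a0 \<Omega> w z\<bar> \<le> K * H01_norm \<Omega> w * H01_norm \<Omega> z"
    "\<bar>opA a b a0 \<Omega> z w\<bar> \<le> K * H01_norm \<Omega> w * H01_norm \<Omega> z" if "H01 \<Omega> z" for z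
    using K[OF w that] K[OF that w] by (auto simp: mult_ac)
  then show "H.bounded_functional (opA a b a0 \<Omega> w)" "H.bounded_functional (\<lambda>y. opA a b a0 \<Omega> y w)"
    unfolding H.bounded_functional_def using left right scale by blast+
qed

text \<open>\<open>N\<close> is fixed before \<phi>, and \<open>\<beta>\<close> is only an upper
  bound, so one \<open>N\<close> serves all test functions and all interpolated operators. The
  smallness condition says that \<open>\<kappa>\<close> is at most \<open>\<Lambda> / 2\<close> for
  any weight of integral at most \<open>\<beta> / N\<close>.\<close>

lemma apriori_test:
  assumes L: "\<Lambda> > 0" and ellip: "AE x in \<mu>. \<forall>\<xi>::real^'n. (\<Sum>i\<in>UNIV. \<Sum>j\<in>UNIV. a i j x * \<xi> $ i * \<xi> $ j) \<ge> \<Lambda> * (norm \<xi>)\<^sup>2"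
    and \<beta>: "(\<integral>x. Wb x \<partial>\<mu>) \<le> \<beta>" and N: "N > 0"
    and small: "S powr (1 / real m) * (\<beta> / real N) powr (1 - 1 / real m) \<le> (\<Lambda> / 2)\<^sup>2"
    and \<phi>: "test_fun \<Omega> \<phi>" and M: "M \<ge> 0"
    and op: "\<And>z. H01 \<Omega> z \<Longrightarrow> \<bar>opA a b a0 \<Omega> \<phi> z\<bar> \<le> M * H01_norm \<Omega> z"
  shows "H01_norm \<Omega> \<phi> \<le> (2 ^ Suc N - 1) * (2 * M / \<Lambda>)"
proof -
  have [measurable]: "\<phi> \<in> borel_measurable \<mu>" "grad \<phi> \<in> borel_measurable \<mu>" "Wb \<in> borel_measurable \<mu>"
    using test_L2[OF \<phi>] Wb(1) by (auto simp: L2_def)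
  obtain B where B: "B > 0" "\<And>x. \<bar>\<phi> x\<bar> \<le> B" by (rule test_fun_bound[OF \<phi>]) blast
  \<comment> \<open>Strictly above the range of \<phi>, so that \<open>trunc_deriv T\<close> equals
    one at all its values and never one half.\<close>
  define T where "T = B + 1"
  have "\<bar>\<phi> x\<bar> < T" for x using B(2)[of x] by (simp add: T_def)
  then have T: "0 \<le> T" "\<And>x. \<bar>\<phi> x\<bar> < T" using B(1) by (auto simp: T_def)
  \<comment> \<open>Points where the gradient vanishes are discarded: they do not contribute to the
    drift, and a level set of positive measure would make \<open>E\<close> jump.\<close>
  define V where "V t x = (if grad \<phi> x \<noteq> 0 \<and> t < \<bar>\<phi> x\<bar> then Wb x else 0)" for t x
  have Vm[measurable]: "V t \<in> borel_measurable \<mu>" for t unfolding V_def by measurable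
  have Vi: "integrable \<mu> (V t)" for t
    by (rule Bochner_Integration.integrable_bound[OF Wb(1) Vm]) (auto simp: V_def Wb(2))
  have off_level: "AE x in \<mu>. grad \<phi> x \<noteq> 0 \<longrightarrow> \<bar>\<phi> x\<bar> \<noteq> t" for t
    using grad_eq_0_on_level_set[OF \<phi>, of t] grad_eq_0_on_level_set[OF \<phi>, of "- t"] by eventually_elim auto
  define E where "E t = (\<integral>x. V t x \<partial>\<mu>)" for t
  have Econt: "continuous_on {0..T} E"
  proof (unfold continuous_on_sequentially, intro allI ballI impI, elim conjE)
    fix u :: "nat \<Rightarrow> real" and t assume u: "u \<longlonglongrightarrow> t"
    have "(\<lambda>n. E (u n)) \<longlonglongrightarrow> E t" unfolding E_def
    proof (rule integral_dominated_convergence[OF Vm Vm Wb(1)])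
      show "AE x in \<mu>. (\<lambda>n. V (u n) x) \<longlonglongrightarrow> V t x"
        using off_level[of t]
      proof eventually_elim
        fix x assume ol: "grad \<phi> x \<noteq> 0 \<longrightarrow> \<bar>\<phi> x\<bar> \<noteq> t"
        have "\<forall>\<^sub>F n in sequentially. V (u n) x = V t x"
        proof (cases "grad \<phi> x = 0")
          case False
          then consider "t < \<bar>\<phi> x\<bar>" | "\<bar>\<phi> x\<bar> < t" using ol by linarith
          then show ?thesis
          proof cases
            case 1
            show ?thesis using order_tendstoD(2)[OF u 1] by eventually_elim (use 1 in \<open>auto simp: V_def\<close>)
          next
            case 2
            show ?thesis using order_tendstoD(1)[OF u 2] by eventually_elim (use 2 in \<open>auto simp: V_def\<close>)
          qed
        qed (simp add: V_def)
        then show "(\<lambda>n. V (u n) x) \<longlonglongrightarrow> V t x" by (rule tendsto_eventually)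
      qed
      show "AE x in \<mu>. norm (V (u n) x) \<le> Wb x" for n by (auto simp: V_def Wb(2))
    qed
    then show "(E \<circ> u) \<longlonglongrightarrow> E t" by (simp add: comp_def)
  qed
  have Emono: "E t \<le> E r" if "r \<le> t" for r t
    unfolding E_def by (intro integral_mono Vi) (use that in \<open>auto simp: V_def Wb(2)\<close>)
  have "V T x = 0" for x using T(2)[of x] by (simp add: V_def)
  then have ET: "E T = 0" by (simp add: E_def)
  have E0: "E 0 \<le> \<beta>"
  proof -
    have "E 0 \<le> (\<integral>x. Wb x \<partial>\<mu>)" unfolding E_def by (intro integral_mono Vi Wb) (auto simp: V_def Wb(2))
    with \<beta> show ?thesis by simp
  qed
  obtain t :: "nat \<Rightarrow> real" where t: "t 0 = T" "t (Suc N) = 0" "\<And>i. 0 \<le> t i" "\<And>i. t (Suc i) \<le> t i"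
    "\<And>i. E (t (Suc i)) - E (t i) \<le> E 0 / real N"
    using equidistributed_levels[OF Econt T(1) ET Emono N] by blast
  \<comment> \<open>Slice \<open>i\<close> lies between the levels \<open>t (Suc i)\<close> and
    \<open>t i\<close>. Differences of truncations telescope, both for the functions and for their
    gradients.\<close>
  define d where "d i x = trunc_deriv (t i) (\<phi> x) - trunc_deriv (t (Suc i)) (\<phi> x)" for i x
  define y where "y i x = trunc (t i) (\<phi> x) - trunc (t (Suc i)) (\<phi> x)" for i x
  define g where "g i x = d i x *\<^sub>R grad \<phi> x" for i x
  define X where "X i = l2 \<mu> (g i)" for i
  have H: "H01_grad \<Omega> (y i) (g i)" for i
    using H01_grad_diff[OF H01_grad_trunc[OF \<phi>, of "t i"] H01_grad_trunc[OF \<phi>, of "t (Suc i)"]]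
    unfolding y_def[abs_def] g_def[abs_def] d_def by (simp add: scaleR_diff_left)
  have Hy: "H01 \<Omega> (y i)" for i using H by (auto simp: H01_def)
  have X: "X i = H01_norm \<Omega> (y i)" "0 \<le> X i" for i using H01_norm_grad[OF H] by (auto simp: X_def l2_nonneg)
  have Lg: "L2 \<mu> (g i)" for i by (rule H01_grad_L2(2)[OF H])
  note slice = trunc_slice[OF t(3) t(4), folded d_def y_def]
  \<comment> \<open>The band is closed as \<open>d i\<close> may be nonzero on both of its levels;
    up to a null set this is still the difference of two \<open>V\<close>.\<close>
  define W where "W i x = (if grad \<phi> x \<noteq> 0 \<and> t (Suc i) \<le> \<bar>\<phi> x\<bar> \<and> \<bar>\<phi> x\<bar> \<le> t i then Wb x else 0)" for i x
  have Wm: "W i \<in> borel_measurable \<mu>" for i unfolding W_def by measurable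
  have Wi: "integrable \<mu> (W i)" for i
    by (rule Bochner_Integration.integrable_bound[OF Wb(1) Wm]) (auto simp: W_def Wb(2))
  have W0: "0 \<le> W i x" for i x by (simp add: W_def Wb(2))
  \<comment> \<open>This is \<open>norm (b x)\<close> cut down to the band, and it still equals
    \<open>norm (b x)\<close> wherever \<open>g i\<close> is nonzero. The smallness of
    \<open>b\<close> is attached to the slice \<open>i\<close> of the gradient and works against
    every tested slice \<open>j\<close>.\<close>
  define \<omega> where "\<omega> i x = W i x powr ((1 - 1 / real m) / 2)" for i x
  have \<omega>_b: "g i x \<noteq> 0 \<Longrightarrow> \<omega> i x = norm (b x)" for i x
    using slice(4)[of i "\<phi> x"] unfolding \<omega>_def W_def g_def d_def[symmetric] by (auto simp: Wb_powr d_def)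
  have \<omega>0: "0 \<le> \<omega> i x" for i x by (simp add: \<omega>_def)
  have \<omega>L: "L2 \<mu> (\<lambda>x. \<omega> i x * y j x)" "l2 \<mu> (\<lambda>x. \<omega> i x * y j x) \<le> \<Lambda> / 2 * X j" for i j
  proof -
    have "(\<integral>x. W i x \<partial>\<mu>) = (\<integral>x. V (t (Suc i)) x - V (t i) x \<partial>\<mu>)"
    proof (rule integral_cong_AE[OF Wm])
      show "AE x in \<mu>. W i x = V (t (Suc i)) x - V (t i) x"
        using off_level[of "t (Suc i)"] by eventually_elim (use t(4)[of i] in \<open>auto simp: W_def V_def\<close>)
    qed measurable
    also have "\<dots> = E (t (Suc i)) - E (t i)" unfolding E_def by (intro Bochner_Integration.integral_diff Vi)
    also have "\<dots> \<le> \<beta> / real N" by (rule order_trans[OF t(5) divide_right_mono[OF E0]]) simp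
    finally have "(\<integral>x. W i x \<partial>\<mu>) \<le> \<beta> / real N" .
    then have "(\<integral>x. W i x \<partial>\<mu>) powr (1 - 1 / real m) \<le> (\<beta> / real N) powr (1 - 1 / real m)"
      using m by (intro powr_mono2 Bochner_Integration.integral_nonneg W0) auto
    then have "S powr (1 / real m) * (\<integral>x. W i x \<partial>\<mu>) powr (1 - 1 / real m) \<le> (\<Lambda> / 2)\<^sup>2"
      using small by (intro order_trans[OF mult_left_mono small]) auto
    then have "\<kappa> (W i) \<le> \<Lambda> / 2" unfolding \<kappa>_def using L by (intro real_le_lsqrt) auto
    then have "\<kappa> (W i) * X j \<le> \<Lambda> / 2 * X j" by (intro mult_right_mono X)
    then show "L2 \<mu> (\<lambda>x. \<omega> i x * y j x)" "l2 \<mu> (\<lambda>x. \<omega> i x * y j x) \<le> \<Lambda> / 2 * X j"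
      using weighted[OF Hy Wi W0, of i j] unfolding \<omega>_def X(1) by auto
  qed
  have main: "\<Lambda> * (X j)\<^sup>2 \<le> M * X j + (\<Sum>i\<le>j. X i * (\<Lambda> / 2 * X j))" if "j \<le> N" for j
  proof -
    let ?f = "form (grad \<phi>) \<phi> (g j) (y j)"
    have fi: "integrable \<mu> ?f" by (rule form_integrable[OF H01_grad_test[OF \<phi>] H])
    have pw: "AE x in \<mu>. \<Lambda> * (norm (g j x))\<^sup>2 - (\<Sum>i\<le>j. norm (g i x) * norm (\<omega> i x * y j x)) \<le> ?f x"
      using ellip a0_nonneg
    proof eventually_elim
      fix x assume el: "\<forall>\<xi>::real^'n. (\<Sum>i\<in>UNIV. \<Sum>j\<in>UNIV. a i j x * \<xi> $ i * \<xi> $ j) \<ge> \<Lambda> * (norm \<xi>)\<^sup>2"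
        and a0: "0 \<le> a0 x"
      let ?G = "grad \<phi> x"
      have dj: "0 \<le> d j x" "d j x \<le> 1" using slice(1,2)[of j "\<phi> x"] by (simp_all add: d_def)
      have "(\<Sum>i\<in>UNIV. \<Sum>k\<in>UNIV. a i k x * ?G $ i * g j x $ k) = d j x * (\<Sum>i\<in>UNIV. \<Sum>k\<in>UNIV. a i k x * ?G $ i * ?G $ k)"
        by (simp add: g_def sum_distrib_left mult_ac)
      also have "\<dots> \<ge> d j x * (\<Lambda> * (norm ?G)\<^sup>2)" using el dj by (intro mult_left_mono) auto
      \<comment> \<open>Testing produces one factor \<open>d j x\<close>, the square of
        \<open>g j x\<close> two. They differ at a level, where \<open>d j x\<close> may be one
        half, and \<open>0 \<le> d j x \<le> 1\<close> gives the right direction.\<close>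
      also have "d j x * (\<Lambda> * (norm ?G)\<^sup>2) \<ge> (d j x)\<^sup>2 * (\<Lambda> * (norm ?G)\<^sup>2)"
        using dj L by (intro mult_right_mono) (auto simp: power2_eq_square mult_left_le)
      finally have A: "\<Lambda> * (norm (g j x))\<^sup>2 \<le> (\<Sum>i\<in>UNIV. \<Sum>k\<in>UNIV. a i k x * ?G $ i * g j x $ k)"
        by (simp add: g_def power_mult_distrib mult_ac)
      have C: "0 \<le> a0 x * \<phi> x * y j x" using a0 slice(3)[of "\<phi> x" j] by (simp add: mult.assoc y_def)
      have Bt: "\<bar>(b x \<bullet> ?G) * y j x\<bar> \<le> (\<Sum>i\<le>j. norm (g i x) * norm (\<omega> i x * y j x))"
      proof (cases "y j x = 0")
        case False
        \<comment> \<open>Where the tested slice is nonzero, \<phi> lies above its lower level. All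
          lower slices are flat there, so the slices up to \<open>j\<close> already make up the
          whole gradient.\<close>
        then have "t (Suc j) < \<bar>\<phi> x\<bar>" using slice(5)[of j "\<phi> x"] by (simp add: y_def)
        then have "(\<Sum>i\<le>j. d i x) = 1"
          unfolding d_def using sum_telescope[of "\<lambda>i. trunc_deriv (t i) (\<phi> x)" j] T(2)[of x] t(1,3)
          by (simp add: trunc_deriv_inside trunc_deriv_outside)
        then have "?G = (\<Sum>i\<le>j. g i x)" by (simp add: g_def flip: scaleR_sum_left)
        then have "\<bar>(b x \<bullet> ?G) * y j x\<bar> = \<bar>\<Sum>i\<le>j. (b x \<bullet> g i x) * y j x\<bar>"
          by (simp add: inner_sum_right sum_distrib_right)
        also have "\<dots> \<le> (\<Sum>i\<le>j. \<bar>(b x \<bullet> g i x) * y j x\<bar>)" by (rule sum_abs)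
        also have "\<dots> \<le> (\<Sum>i\<le>j. norm (g i x) * norm (\<omega> i x * y j x))"
        proof (rule sum_mono)
          fix i
          have "\<bar>b x \<bullet> g i x\<bar> \<le> \<omega> i x * norm (g i x)"
            using Cauchy_Schwarz_ineq2[of "b x" "g i x"] \<omega>_b[of i x] by (cases "g i x = 0") auto
          then have "\<bar>b x \<bullet> g i x\<bar> * \<bar>y j x\<bar> \<le> \<omega> i x * norm (g i x) * \<bar>y j x\<bar>" by (rule mult_right_mono) simp
          then show "\<bar>(b x \<bullet> g i x) * y j x\<bar> \<le> norm (g i x) * norm (\<omega> i x * y j x)"
            by (simp add: abs_mult \<omega>0 mult_ac)
        qed
        finally show ?thesis .
      qed simp
      show "\<Lambda> * (norm (g j x))\<^sup>2 - (\<Sum>i\<le>j. norm (g i x) * norm (\<omega> i x * y j x)) \<le> ?f x"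
        using A C Bt unfolding form_def by linarith
    qed
    have i1: "integrable \<mu> (\<lambda>x. norm (g i x) * norm (\<omega> i x * y j x))" for i
      by (rule L2_norm_mult[OF Lg \<omega>L(1)])
    have i2: "integrable \<mu> (\<lambda>x. (norm (g j x))\<^sup>2)" by (rule L2_integrable[OF Lg])
    have "\<Lambda> * (X j)\<^sup>2 - (\<Sum>i\<le>j. \<integral>x. norm (g i x) * norm (\<omega> i x * y j x) \<partial>\<mu>)
        = (\<integral>x. \<Lambda> * (norm (g j x))\<^sup>2 - (\<Sum>i\<le>j. norm (g i x) * norm (\<omega> i x * y j x)) \<partial>\<mu>)"
      using i1 i2 by (simp add: X_def l2_power2 Bochner_Integration.integral_diff Bochner_Integration.integral_sum)
    also have "\<dots> \<le> (\<integral>x. ?f x \<partial>\<mu>)" using i1 i2 fi pw by (intro integral_mono_AE) auto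
    also have "\<dots> \<le> M * X j" using op[OF Hy[of j]] opA_eq[OF H01_grad_test[OF \<phi>] H[of j]] by (simp add: X(1))
    finally have "\<Lambda> * (X j)\<^sup>2 \<le> M * X j + (\<Sum>i\<le>j. \<integral>x. norm (g i x) * norm (\<omega> i x * y j x) \<partial>\<mu>)" by simp
    also have "(\<Sum>i\<le>j. \<integral>x. norm (g i x) * norm (\<omega> i x * y j x) \<partial>\<mu>) \<le> (\<Sum>i\<le>j. X i * (\<Lambda> / 2 * X j))"
    proof (rule sum_mono)
      fix i
      have "(\<integral>x. norm (g i x) * norm (\<omega> i x * y j x) \<partial>\<mu>) \<le> X i * l2 \<mu> (\<lambda>x. \<omega> i x * y j x)"
        unfolding X_def by (rule Cauchy_Schwarz_L2[OF Lg \<omega>L(1)])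
      also have "\<dots> \<le> X i * (\<Lambda> / 2 * X j)" by (intro mult_left_mono \<omega>L(2) X(2))
      finally show "(\<integral>x. norm (g i x) * norm (\<omega> i x * y j x) \<partial>\<mu>) \<le> X i * (\<Lambda> / 2 * X j)" .
    qed
    finally show ?thesis by simp
  qed
  \<comment> \<open>The telescoping sum ends at level 0, where \<open>trunc_deriv\<close> is zero
    everywhere.\<close>
  have "(\<Sum>i\<le>N. d i x) = 1" for x
    unfolding d_def using sum_telescope[of "\<lambda>i. trunc_deriv (t i) (\<phi> x)" N] T(2)[of x] t(1,2)
    by (simp add: trunc_deriv_inside trunc_deriv_0)
  then have gsum: "grad \<phi> = (\<lambda>x. \<Sum>i\<le>N. g i x)" by (auto simp: g_def simp flip: scaleR_sum_left)
  have "l2 \<mu> (\<lambda>x. \<Sum>i\<le>n. g i x) \<le> (\<Sum>i\<le>n. X i)" for n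
  proof (induction n)
    case (Suc n)
    have "l2 \<mu> (\<lambda>x. (\<Sum>i\<le>n. g i x) + g (Suc n) x) \<le> l2 \<mu> (\<lambda>x. \<Sum>i\<le>n. g i x) + l2 \<mu> (g (Suc n))"
      by (intro l2_triangle L2_sum Lg)
    then show ?case using Suc by (simp add: X_def)
  qed (simp add: X_def)
  from this[of N] have "H01_norm \<Omega> \<phi> \<le> (\<Sum>i\<le>N. X i)"
    using H01_norm_grad[OF H01_grad_test[OF \<phi>]] gsum by simp
  also have "\<dots> \<le> (2 ^ Suc N - 1) * (2 * M / \<Lambda>)"
    by (rule slice_recursion[OF X(2) L M main]) auto
  finally show ?thesis .
qed

text \<open>An approximating test function satisfies the hypothesis with \<open>M\<close> enlarged
  by \<open>K\<close> times its distance to \<open>y\<close>. The estimate is linear in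
  \<open>M\<close>, so the error disappears in the limit.\<close>

lemma apriori:
  assumes L: "\<Lambda> > 0" and ellip: "AE x in \<mu>. \<forall>\<xi>::real^'n. (\<Sum>i\<in>UNIV. \<Sum>j\<in>UNIV. a i j x * \<xi> $ i * \<xi> $ j) \<ge> \<Lambda> * (norm \<xi>)\<^sup>2"
    and \<beta>: "(\<integral>x. Wb x \<partial>\<mu>) \<le> \<beta>" and N: "N > 0"
    and small: "S powr (1 / real m) * (\<beta> / real N) powr (1 - 1 / real m) \<le> (\<Lambda> / 2)\<^sup>2"
    and y: "H01 \<Omega> y" and M: "M \<ge> 0"
    and op: "\<And>z. H01 \<Omega> z \<Longrightarrow> \<bar>opA a b a0 \<Omega> y z\<bar> \<le> M * H01_norm \<Omega> z"
  shows "H01_norm \<Omega> y \<le> (2 ^ Suc N - 1) * (2 * M / \<Lambda>)"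
proof -
  obtain K where K: "K \<ge> 0" "\<And>y z. H01 \<Omega> y \<Longrightarrow> H01 \<Omega> z \<Longrightarrow> \<bar>opA a b a0 \<Omega> y z\<bar> \<le> K * H01_norm \<Omega> y * H01_norm \<Omega> z"
    using opA_bound by metis
  obtain \<phi> where \<phi>: "\<And>k. test_fun \<Omega> (\<phi> k)" "(\<lambda>k. l2 \<mu> (\<lambda>x. \<phi> k x - y x)) \<longlonglongrightarrow> 0"
    "(\<lambda>k. H01_norm \<Omega> (\<lambda>x. \<phi> k x - y x)) \<longlonglongrightarrow> 0"
    using H01_test_approx[OF y] by blast
  define e where "e k = H01_norm \<Omega> (\<lambda>x. \<phi> k x - y x)" for k
  have e: "e k \<ge> 0" for k by (simp add: e_def H01_norm_eq l2_nonneg)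
  have p: "H01 \<Omega> (\<phi> k)" for k by (rule H01_test[OF \<phi>(1)])
  have "H01_norm \<Omega> y \<le> (2 ^ Suc N - 1) * (2 * (M + K * e k) / \<Lambda>) + e k" for k
  proof -
    have "H01_norm \<Omega> (\<phi> k) \<le> (2 ^ Suc N - 1) * (2 * (M + K * e k) / \<Lambda>)"
    proof (rule apriori_test[OF L ellip \<beta> N small \<phi>(1)])
      show "0 \<le> M + K * e k" using M K(1) e by simp
      fix z assume z: "H01 \<Omega> z"
      have "opA a b a0 \<Omega> (\<phi> k) z = opA a b a0 \<Omega> y z + opA a b a0 \<Omega> (\<lambda>x. \<phi> k x - y x) z"
        using H.functional_diff[OF opA_bounded_functional(2)[OF z] p y] by simp
      then show "\<bar>opA a b a0 \<Omega> (\<phi> k) z\<bar> \<le> (M + K * e k) * H01_norm \<Omega> z"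
        using op[OF z] K(2)[OF H01_diff[OF p y] z, of k] by (simp add: e_def algebra_simps)
    qed
    moreover have "H01_norm \<Omega> (\<lambda>x. \<phi> k x + (y x - \<phi> k x)) \<le> H01_norm \<Omega> (\<phi> k) + H01_norm \<Omega> (\<lambda>x. y x - \<phi> k x)"
      by (rule H.nm_triangle[OF p H01_diff[OF y p]])
    ultimately show ?thesis using H.nm_commute[OF p y, of k] by (simp add: e_def)
  qed
  moreover have "(\<lambda>k. (2 ^ Suc N - 1) * (2 * (M + K * e k) / \<Lambda>) + e k) \<longlonglongrightarrow> (2 ^ Suc N - 1) * (2 * (M + K * 0) / \<Lambda>) + 0"
    unfolding e_def by (intro tendsto_intros \<phi>(3)) (use L in auto)
  ultimately show ?thesis by (intro LIMSEQ_le_const[where X = "\<lambda>k. (2 ^ Suc N - 1) * (2 * (M + K * e k) / \<Lambda>) + e k"]) auto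
qed

end

section \<open>The isomorphism theorem\<close>

lemma integrable_powr_mono:
  fixes f :: "'a \<Rightarrow> real"
  assumes "finite_measure M" "f \<in> borel_measurable M" "integrable M (\<lambda>x. \<bar>f x\<bar> powr p)" "0 \<le> r" "r \<le> p"
  shows "integrable M (\<lambda>x. \<bar>f x\<bar> powr r)"
proof -
  interpret finite_measure M by fact
  note assms(2)[measurable]
  show ?thesis
  proof (rule Bochner_Integration.integrable_bound)
    show "integrable M (\<lambda>x. 1 + \<bar>f x\<bar> powr p)" using assms(3) by simp
    have "\<bar>f x\<bar> powr r \<le> 1 + \<bar>f x\<bar> powr p" for x
    proof (cases "\<bar>f x\<bar> \<le> 1")
      case True
      then have "\<bar>f x\<bar> powr r \<le> 1" using assms(4) by (intro powr_le1) auto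
      then show ?thesis by (simp add: add_increasing2)
    next
      case False
      then have "\<bar>f x\<bar> powr r \<le> \<bar>f x\<bar> powr p" using assms(5) by (intro powr_mono) auto
      then show ?thesis by linarith
    qed
    then show "AE x in M. norm (\<bar>f x\<bar> powr r) \<le> norm (1 + \<bar>f x\<bar> powr p)" by (auto simp: abs_of_nonneg)
  qed measurable
qed

lemma integrable_norm_vec_powr:
  fixes b :: "'a \<Rightarrow> real^'n::finite"
  assumes "\<And>i. integrable M (\<lambda>x. \<bar>b x $ i\<bar> powr r)" "b \<in> borel_measurable M" "0 \<le> r"
  shows "integrable M (\<lambda>x. norm (b x) powr r)"
proof (rule Bochner_Integration.integrable_bound)
  show "integrable M (\<lambda>x. real CARD('n) powr r * (\<Sum>i\<in>UNIV. \<bar>b x $ i\<bar> powr r))"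
    using assms(1) by (intro integrable_mult_right Bochner_Integration.integrable_sum) auto
  note assms(2)[measurable]
  show "(\<lambda>x. norm (b x) powr r) \<in> borel_measurable M" by measurable
  have "norm v powr r \<le> real CARD('n) powr r * (\<Sum>i\<in>UNIV. \<bar>v $ i\<bar> powr r)" for v :: "real^'n"
  proof -
    \<comment> \<open>A component of largest absolute value: the norm is at most the number of
      components times it.\<close>
    obtain k where k: "\<And>i. \<bar>v $ i\<bar> \<le> \<bar>v $ k\<bar>"
    proof -
      have "finite (range (\<lambda>i. \<bar>v $ i\<bar>))" "range (\<lambda>i. \<bar>v $ i\<bar>) \<noteq> {}" by auto
      from Max_in[OF this] obtain k where "Max (range (\<lambda>i. \<bar>v $ i\<bar>)) = \<bar>v $ k\<bar>" by blast
      then show thesis by (intro that[of k]) (metis Max_ge finite_imageI finite_class.finite_UNIV rangeI)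
    qed
    have "norm v \<le> (\<Sum>i\<in>UNIV. \<bar>v $ i\<bar>)" by (rule norm_le_l1_cart)
    also have "\<dots> \<le> (\<Sum>i\<in>(UNIV::'n set). \<bar>v $ k\<bar>)" by (intro sum_mono k)
    finally have "norm v powr r \<le> (real CARD('n) * \<bar>v $ k\<bar>) powr r"
      using assms(3) by (intro powr_mono2) auto
    also have "\<dots> = real CARD('n) powr r * \<bar>v $ k\<bar> powr r" by (simp add: powr_mult)
    also have "\<dots> \<le> real CARD('n) powr r * (\<Sum>i\<in>UNIV. \<bar>v $ i\<bar> powr r)"
      by (intro mult_left_mono member_le_sum[of k UNIV "\<lambda>i. \<bar>v $ i\<bar> powr r"]) auto
    finally show ?thesis .
  qed
  moreover have "0 \<le> real CARD('n) powr r * (\<Sum>i\<in>UNIV. \<bar>v $ i\<bar> powr r)" for v :: "real^'n"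
    by (intro mult_nonneg_nonneg sum_nonneg) auto
  ultimately show "AE x in M. norm (norm (b x) powr r) \<le> norm (real CARD('n) powr r * (\<Sum>i\<in>UNIV. \<bar>b x $ i\<bar> powr r))"
    by (auto simp: abs_of_nonneg)
qed

lemma quadratic_form_interpolation:
  fixes \<xi> \<eta> :: "real^'n::finite"
  shows "(\<Sum>i\<in>UNIV. \<Sum>j\<in>UNIV. ((1 - t) * (if i = j then 1 else 0) + t * c i j) * \<xi> $ i * \<eta> $ j)
    = (1 - t) * (\<xi> \<bullet> \<eta>) + t * (\<Sum>i\<in>UNIV. \<Sum>j\<in>UNIV. c i j * \<xi> $ i * \<eta> $ j)"
proof -
  have "(\<Sum>i\<in>UNIV. \<Sum>j\<in>UNIV. ((1 - t) * (if i = j then 1 else 0) + t * c i j) * \<xi> $ i * \<eta> $ j)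
      = (\<Sum>i\<in>UNIV. \<Sum>j\<in>UNIV. (if i = j then (1 - t) * (\<xi> $ i * \<eta> $ j) else 0) + t * (c i j * \<xi> $ i * \<eta> $ j))"
    by (intro sum.cong refl) (auto simp: algebra_simps)
  also have "\<dots> = (1 - t) * (\<xi> \<bullet> \<eta>) + t * (\<Sum>i\<in>UNIV. \<Sum>j\<in>UNIV. c i j * \<xi> $ i * \<eta> $ j)"
    by (simp add: sum.distrib sum_distrib_left inner_vec_def)
  finally show ?thesis .
qed

text \<open>Every form on the segment belongs to an operator of the same kind, with the matrix
  between identity and \<open>a\<close>, and with \<open>b\<close> and \<open>a0\<close> multiplied
  by \<open>t\<close>. Its ellipticity constant is at least \<open>min 1 \<Lambda>\<close> and its
  drift weight is at most \<open>Wb\<close>, so one \<open>N\<close> serves all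
  \<open>t\<close>.\<close>

lemma (in elliptic_coeffs) interpolated_apriori:
  assumes L: "\<Lambda> > 0" and ellip: "AE x in \<mu>. \<forall>\<xi>::real^'n. (\<Sum>i\<in>UNIV. \<Sum>j\<in>UNIV. a i j x * \<xi> $ i * \<xi> $ j) \<ge> \<Lambda> * (norm \<xi>)\<^sup>2"
  obtains C where "C \<ge> 0" "\<And>t y M. 0 \<le> t \<Longrightarrow> t \<le> 1 \<Longrightarrow> H01 \<Omega> y \<Longrightarrow> M \<ge> 0 \<Longrightarrow>
      (\<And>z. H01 \<Omega> z \<Longrightarrow> \<bar>(1 - t) * (\<integral>x. wgrad \<Omega> y x \<bullet> wgrad \<Omega> z x \<partial>\<mu>) + t * opA a b a0 \<Omega> y z\<bar> \<le> M * H01_norm \<Omega> z) \<Longrightarrow>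
      H01_norm \<Omega> y \<le> C * M"
proof -
  define \<Lambda>' where "\<Lambda>' = min 1 \<Lambda>"
  have L': "\<Lambda>' > 0" using L by (simp add: \<Lambda>'_def)
  define \<beta> where "\<beta> = (\<integral>x. Wb x \<partial>\<mu>)"
  \<comment> \<open>The exponent \<open>1 - 1 / real m\<close> is positive, so enough slices make
    the drift on each of them as small as \<open>apriori\<close> demands.\<close>
  have "(\<lambda>N. S powr (1 / real m) * (\<beta> / real N) powr (1 - 1 / real m)) \<longlonglongrightarrow> S powr (1 / real m) * 0"
  proof (intro tendsto_intros)
    have "(\<lambda>N. \<beta> / real N) \<longlonglongrightarrow> 0" by (rule lim_const_over_n)
    moreover have "\<forall>\<^sub>F N in sequentially. 0 \<le> \<beta> / real N" by (simp add: \<beta>_def Wb(2))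
    ultimately have "(\<lambda>N. (\<beta> / real N) powr (1 - 1 / real m)) \<longlonglongrightarrow> 0 powr (1 - 1 / real m)"
      using m by (intro tendsto_powr' tendsto_const) auto
    then show "(\<lambda>N. (\<beta> / real N) powr (1 - 1 / real m)) \<longlonglongrightarrow> 0" by simp
  qed
  then have "\<forall>\<^sub>F N in sequentially. S powr (1 / real m) * (\<beta> / real N) powr (1 - 1 / real m) < (\<Lambda>' / 2)\<^sup>2"
    using L' by (auto dest: order_tendstoD(2)[where a = "(\<Lambda>' / 2)\<^sup>2"])
  then have "\<forall>\<^sub>F N in sequentially. S powr (1 / real m) * (\<beta> / real N) powr (1 - 1 / real m) < (\<Lambda>' / 2)\<^sup>2 \<and> N > 0"
    using eventually_gt_at_top[of "0::nat"] by (rule eventually_conj)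
  then obtain N where N: "N > 0" "S powr (1 / real m) * (\<beta> / real N) powr (1 - 1 / real m) \<le> (\<Lambda>' / 2)\<^sup>2"
    unfolding eventually_sequentially by (meson less_imp_le order_refl)
  show thesis
  proof (rule that[of "(2 ^ Suc N - 1) * (2 / \<Lambda>')"])
    have "(1::real) \<le> 2 ^ Suc N" by (rule one_le_power) simp
    then show "0 \<le> (2 ^ Suc N - 1) * (2 / \<Lambda>')" using L' by (intro mult_nonneg_nonneg) auto
    fix t :: real and y M
    assume t: "0 \<le> t" "t \<le> 1" and y: "H01 \<Omega> y" and M: "M \<ge> 0"
      and op: "\<And>z. H01 \<Omega> z \<Longrightarrow> \<bar>(1 - t) * (\<integral>x. wgrad \<Omega> y x \<bullet> wgrad \<Omega> z x \<partial>\<mu>) + t * opA a b a0 \<Omega> y z\<bar> \<le> M * H01_norm \<Omega> z"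
    define a' where "a' i j x = (1 - t) * (if i = j then 1 else 0) + t * a i j x" for i j x
    define b' where "b' x = t *\<^sub>R b x" for x
    define a0' where "a0' x = t * a0 x" for x
    define r where "r = real m / (real m - 1)"
    have r: "r \<ge> 0" using m by (simp add: r_def)
    have t1: "t powr s \<le> 1" if "s \<ge> 0" for s using t that by (intro powr_le1) auto
    have b'_le: "norm (b' x) powr (2 * r) \<le> Wb x" for x
      using t t1[of "2 * r"] r by (simp add: b'_def Wb_def powr_mult mult_left_le_one_le r_def)
    interpret T: elliptic_coeffs \<Omega> m S a' b' a0'
    proof
      show "Linf \<Omega> (a' i j)" for i j
      proof -
        have [measurable]: "a i j \<in> borel_measurable \<mu>" using a_Linf by (simp add: Linf_def)
        obtain K where K: "AE x in \<mu>. \<bar>a i j x\<bar> \<le> K" using a_Linf by (auto simp: Linf_def)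
        have "AE x in \<mu>. \<bar>a' i j x\<bar> \<le> 1 + \<bar>K\<bar>"
          using K
        proof eventually_elim
          fix x assume k: "\<bar>a i j x\<bar> \<le> K"
          have "\<bar>a' i j x\<bar> \<le> \<bar>(1 - t) * (if i = j then 1 else 0)\<bar> + \<bar>t * a i j x\<bar>"
            unfolding a'_def by (rule abs_triangle_ineq)
          also have "\<dots> \<le> 1 + \<bar>K\<bar>"
          proof (rule add_mono)
            show "\<bar>(1 - t) * (if i = j then 1 else 0)\<bar> \<le> 1" using t by simp
            have "\<bar>t * a i j x\<bar> \<le> 1 * \<bar>a i j x\<bar>" unfolding abs_mult using t by (intro mult_right_mono) auto
            then show "\<bar>t * a i j x\<bar> \<le> \<bar>K\<bar>" using k by linarith
          qed
          finally show "\<bar>a' i j x\<bar> \<le> 1 + \<bar>K\<bar>" .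
        qed
        moreover have "a' i j \<in> borel_measurable \<mu>" unfolding a'_def[abs_def] by measurable
        ultimately show ?thesis unfolding Linf_def by blast
      qed
      show "b' \<in> borel_measurable \<mu>" "a0' \<in> borel_measurable \<mu>"
        unfolding b'_def[abs_def] a0'_def[abs_def] using b_meas a0_meas by measurable
      then have m': "(\<lambda>x. norm (b' x) powr (2 * r)) \<in> borel_measurable \<mu>" "(\<lambda>x. \<bar>a0' x\<bar> powr r) \<in> borel_measurable \<mu>"
        by measurable
      show "integrable \<mu> (\<lambda>x. norm (b' x) powr (2 * (real m / (real m - 1))))"
        unfolding r_def[symmetric]
        by (rule Bochner_Integration.integrable_bound[OF Wb(1) m'(1)]) (use b'_le Wb(2) in auto)
      show "integrable \<mu> (\<lambda>x. \<bar>a0' x\<bar> powr (real m / (real m - 1)))"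
        using a0_int t by (simp add: a0'_def abs_mult powr_mult)
      show "AE x in \<mu>. 0 \<le> a0' x" using a0_nonneg t by (auto simp: a0'_def elim: AE_mp)
    qed
    have form': "T.form g u h z x = (1 - t) * (g x \<bullet> h x) + t * form g u h z x" for g h :: "real^'n \<Rightarrow> real^'n" and u z x
      unfolding T.form_def form_def a'_def quadratic_form_interpolation by (simp add: b'_def a0'_def algebra_simps)
    have "H01_norm \<Omega> y \<le> (2 ^ Suc N - 1) * (2 * M / \<Lambda>')"
    proof (rule T.apriori[OF L' _ _ N y M])
      show "AE x in \<mu>. \<forall>\<xi>::real^'n. \<Lambda>' * (norm \<xi>)\<^sup>2 \<le> (\<Sum>i\<in>UNIV. \<Sum>j\<in>UNIV. a' i j x * \<xi> $ i * \<xi> $ j)"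
        using ellip
      proof (eventually_elim, intro allI)
        fix x and \<xi> :: "real^'n"
        assume e: "\<forall>\<xi>::real^'n. \<Lambda> * (norm \<xi>)\<^sup>2 \<le> (\<Sum>i\<in>UNIV. \<Sum>j\<in>UNIV. a i j x * \<xi> $ i * \<xi> $ j)"
        have "\<Lambda>' * (norm \<xi>)\<^sup>2 = (1 - t) * (\<Lambda>' * (norm \<xi>)\<^sup>2) + t * (\<Lambda>' * (norm \<xi>)\<^sup>2)" by (simp add: algebra_simps)
        also have "\<dots> \<le> (1 - t) * (1 * (norm \<xi>)\<^sup>2) + t * (\<Lambda> * (norm \<xi>)\<^sup>2)"
          using t by (intro add_mono mult_left_mono mult_right_mono) (auto simp: \<Lambda>'_def)
        also have "\<dots> \<le> (1 - t) * (\<xi> \<bullet> \<xi>) + t * (\<Sum>i\<in>UNIV. \<Sum>j\<in>UNIV. a i j x * \<xi> $ i * \<xi> $ j)"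
          using e t by (intro add_mono mult_left_mono) (auto simp: power2_norm_eq_inner)
        also have "\<dots> = (\<Sum>i\<in>UNIV. \<Sum>j\<in>UNIV. a' i j x * \<xi> $ i * \<xi> $ j)"
          unfolding a'_def quadratic_form_interpolation ..
        finally show "\<Lambda>' * (norm \<xi>)\<^sup>2 \<le> (\<Sum>i\<in>UNIV. \<Sum>j\<in>UNIV. a' i j x * \<xi> $ i * \<xi> $ j)" .
      qed
      show "(\<integral>x. T.Wb x \<partial>\<mu>) \<le> \<beta>"
        unfolding \<beta>_def by (intro integral_mono T.Wb(1) Wb(1)) (use b'_le in \<open>simp add: T.Wb_def r_def\<close>)
      fix z assume z: "H01 \<Omega> z"
      have "opA a' b' a0' \<Omega> y z = (\<integral>x. (1 - t) * (wgrad \<Omega> y x \<bullet> wgrad \<Omega> z x) + t * form (wgrad \<Omega> y) y (wgrad \<Omega> z) z x \<partial>\<mu>)"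
        using T.opA_eq[OF H01_wgrad[OF y] H01_wgrad[OF z]] by (simp add: form')
      also have "\<dots> = (1 - t) * (\<integral>x. wgrad \<Omega> y x \<bullet> wgrad \<Omega> z x \<partial>\<mu>) + t * opA a b a0 \<Omega> y z"
        using form_integrable[OF H01_wgrad[OF y] H01_wgrad[OF z]] L2_inner[OF wgrad_L2[OF y] wgrad_L2[OF z]]
          opA_eq[OF H01_wgrad[OF y] H01_wgrad[OF z]] by simp
      finally show "\<bar>opA a' b' a0' \<Omega> y z\<bar> \<le> M * H01_norm \<Omega> z" using op[OF z] by simp
    qed
    moreover have "A * (2 * M / \<Lambda>') = A * (2 / \<Lambda>') * M" for A by simp
    ultimately show "H01_norm \<Omega> y \<le> (2 ^ Suc N - 1) * (2 / \<Lambda>') * M" by (simp only:)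
  qed
qed

text \<open>In three dimensions \<open>m = 3\<close> turns the required exponents into exactly 3 and
  3/2, the limiting cases allowed. In two dimensions every \<open>m\<close> is available and
  \<open>m / (m - 1)\<close> decreases to 1, so the strict inequalities for \<open>p\<close> and
  \<open>q\<close> leave room.\<close>

lemma sobolev_set_exists:
  fixes \<Omega> :: "(real^'n::finite) set"
  assumes dim: "CARD('n) = 2 \<or> CARD('n) = 3" and \<Omega>: "open \<Omega>" "bounded \<Omega>"
    and p: "(CARD('n) = 3 \<longrightarrow> p \<ge> 3) \<and> (CARD('n) = 2 \<longrightarrow> p > 2)"
    and q: "(CARD('n) = 2 \<longrightarrow> q > 1) \<and> (CARD('n) = 3 \<longrightarrow> q \<ge> 3/2)"
  obtains m :: nat and S :: real where "sobolev_set \<Omega> m S" "2 * (real m / (real m - 1)) \<le> p" "real m / (real m - 1) \<le> q"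
  using dim
proof
  assume 3: "CARD('n) = 3"
  have "sobolev_set \<Omega> 3 4096"
    by unfold_locales (use \<Omega> sobolev_3[OF 3 \<Omega>(2,1)] in auto)
  then show thesis by (rule that) (use 3 p q in auto)
next
  assume 2: "CARD('n) = 2"
  define c where "c = min (p / 2) q"
  have c: "c > 1" using p q 2 by (auto simp: c_def)
  \<comment> \<open>\<open>m / (m - 1) \<le> c\<close> amounts to
    \<open>m \<ge> c / (c - 1)\<close>; the added 2 ensures \<open>m \<ge> 2\<close>.\<close>
  define m where "m = nat \<lceil>c / (c - 1)\<rceil> + 2"
  have "real m \<ge> c / (c - 1)" unfolding m_def by linarith
  then have "real m \<le> c * (real m - 1)" using c by (simp add: field_simps)
  moreover have m1: "real m - 1 > 0" by (simp add: m_def)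
  ultimately have mc: "real m / (real m - 1) \<le> c" by (simp add: divide_le_eq)
  have sob: "sobolev_set \<Omega> m ((fact m)\<^sup>2 * measure lebesgue \<Omega>)"
  proof
    show "m \<ge> 2" by (simp add: m_def)
  qed (use \<Omega> sobolev_2[OF 2 \<Omega>(2,1)] in auto)
  have "c \<le> p / 2" "c \<le> q" by (simp_all add: c_def)
  then show thesis by (intro that[OF sob]) (use mc in linarith)+
qed

theorem theorem2p2:
  fixes \<Omega> :: "(real^'n::finite) set"
    and a :: "'n \<Rightarrow> 'n \<Rightarrow> real^'n \<Rightarrow> real"
    and b :: "real^'n \<Rightarrow> real^'n"
    and a0 :: "real^'n \<Rightarrow> real"
    and \<Lambda> p q :: real
  assumes dim: "CARD('n) = 2 \<or> CARD('n) = 3"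
    and dom: "lipschitz_domain \<Omega>"
    and a_Linf: "\<And>i j. Linf \<Omega> (a i j)"
    and Lam_pos: "\<Lambda> > 0"
    and ellip: "AE x in lebesgue_on \<Omega>. \<forall>\<xi>::real^'n.
                  (\<Sum>i\<in>UNIV. \<Sum>j\<in>UNIV. a i j x * \<xi> $ i * \<xi> $ j) \<ge> \<Lambda> * (norm \<xi>)\<^sup>2"
    and p_cond: "(CARD('n) = 3 \<longrightarrow> p \<ge> 3) \<and> (CARD('n) = 2 \<longrightarrow> p > 2)"
    and b_Lp: "\<And>i. Lp p \<Omega> (\<lambda>x. b x $ i)"
    and q_cond: "(CARD('n) = 2 \<longrightarrow> q > 1) \<and> (CARD('n) = 3 \<longrightarrow> q \<ge> 3/2)"
    and a0_Lq: "Lp q \<Omega> a0"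
    and a0_nonneg: "AE x in lebesgue_on \<Omega>. a0 x \<ge> 0"
  shows
    \<comment> \<open>\<A> is well defined and bounded from H_0^1 to H^{-1}\<close>
    "(\<forall>y z. H01 \<Omega> y \<longrightarrow> H01 \<Omega> z \<longrightarrow> integrable (lebesgue_on \<Omega>) (opA_integrand a b a0 \<Omega> y z))
     \<and> (\<forall>y. H01 \<Omega> y \<longrightarrow> Hminus1 \<Omega> (opA a b a0 \<Omega> y))
     \<and> (\<exists>C. \<forall>y z. H01 \<Omega> y \<longrightarrow> H01 \<Omega> z \<longrightarrow>
            \<bar>opA a b a0 \<Omega> y z\<bar> \<le> C * H01_norm \<Omega> y * H01_norm \<Omega> z)
     \<comment> \<open>injective\<close>
     \<and> (\<forall>y. H01 \<Omega> y \<longrightarrow> (\<forall>z. H01 \<Omega> z \<longrightarrow> opA a b a0 \<Omega> y z = 0) \<longrightarrow>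
            (AE x in lebesgue_on \<Omega>. y x = 0))
     \<comment> \<open>surjective\<close>
     \<and> (\<forall>F. Hminus1 \<Omega> F \<longrightarrow> (\<exists>y. H01 \<Omega> y \<and> (\<forall>z. H01 \<Omega> z \<longrightarrow> opA a b a0 \<Omega> y z = F z)))
     \<comment> \<open>bounded inverse\<close>
     \<and> (\<exists>C. \<forall>y M. H01 \<Omega> y \<longrightarrow> (\<forall>z. H01 \<Omega> z \<longrightarrow> \<bar>opA a b a0 \<Omega> y z\<bar> \<le> M * H01_norm \<Omega> z) \<longrightarrow>
            H01_norm \<Omega> y \<le> C * M)"
proof -
  have \<Omega>: "open \<Omega>" "bounded \<Omega>" using dom by (auto simp: lipschitz_domain_def)
  obtain m :: nat and S :: real where mS: "sobolev_set \<Omega> m S" "2 * (real m / (real m - 1)) \<le> p" "real m / (real m - 1) \<le> q"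
    by (rule sobolev_set_exists[OF dim \<Omega> p_cond q_cond])
  interpret sobolev_set \<Omega> m S by fact
  have bm: "b \<in> borel_measurable \<mu>" using b_Lp by (simp add: Lp_def borel_measurable_vec_iff)
  have m0: "0 \<le> real m / (real m - 1)" using m by simp
  interpret elliptic_coeffs \<Omega> m S a b a0
  proof
    show "integrable \<mu> (\<lambda>x. norm (b x) powr (2 * (real m / (real m - 1))))"
      by (rule integrable_norm_vec_powr[OF integrable_powr_mono[OF finite_measure_axioms _ _ _ mS(2)] bm])
         (use b_Lp m0 in \<open>auto simp: Lp_def\<close>)
    show "integrable \<mu> (\<lambda>x. \<bar>a0 x\<bar> powr (real m / (real m - 1)))"
      by (rule integrable_powr_mono[OF finite_measure_axioms _ _ m0 mS(3)]) (use a0_Lq in \<open>auto simp: Lp_def\<close>)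
  qed (use a_Linf bm a0_Lq a0_nonneg in \<open>auto simp: Lp_def\<close>)
  have nn: "0 \<le> H01_norm \<Omega> z" for z by (simp add: H01_norm_eq l2_nonneg)
  have bf: "H.bounded_functional F \<longleftrightarrow> Hminus1 \<Omega> F" for F
    unfolding H.bounded_functional_def Hminus1_def ..
  obtain K where K: "K \<ge> 0" "\<And>y z. H01 \<Omega> y \<Longrightarrow> H01 \<Omega> z \<Longrightarrow> \<bar>opA a b a0 \<Omega> y z\<bar> \<le> K * H01_norm \<Omega> y * H01_norm \<Omega> z"
    using opA_bound by metis
  obtain C where C: "C \<ge> 0" "\<And>t y M. 0 \<le> t \<Longrightarrow> t \<le> 1 \<Longrightarrow> H01 \<Omega> y \<Longrightarrow> M \<ge> 0 \<Longrightarrow>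
      (\<And>z. H01 \<Omega> z \<Longrightarrow> \<bar>(1 - t) * (\<integral>x. wgrad \<Omega> y x \<bullet> wgrad \<Omega> z x \<partial>\<mu>) + t * opA a b a0 \<Omega> y z\<bar> \<le> M * H01_norm \<Omega> z) \<Longrightarrow>
      H01_norm \<Omega> y \<le> C * M"
    by (rule interpolated_apriori[OF Lam_pos ellip]) blast
  \<comment> \<open>The endpoint \<open>t = 1\<close> of the segment.\<close>
  have ap: "H01_norm \<Omega> y \<le> C * M"
    if "H01 \<Omega> y" "M \<ge> 0" "\<And>z. H01 \<Omega> z \<Longrightarrow> \<bar>opA a b a0 \<Omega> y z\<bar> \<le> M * H01_norm \<Omega> z" for y M
    using C(2)[of 1 y M] that by simp
  have inj: "AE x in \<mu>. y x = 0" if y: "H01 \<Omega> y" and 0: "\<forall>z. H01 \<Omega> z \<longrightarrow> opA a b a0 \<Omega> y z = 0" for y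
  proof -
    \<comment> \<open>A kernel element satisfies the a priori hypothesis with \<open>M = 0\<close>;
      Poincare's inequality then passes from the gradient to the function.\<close>
    have "H01_norm \<Omega> y \<le> C * 0" by (rule ap[OF y]) (use 0 in auto)
    then have "l2 \<mu> y \<le> 0" using poincare[OF y] nn[of y] by simp
    then have "l2 \<mu> y = 0" using l2_nonneg[of \<mu> y] by linarith
    then show ?thesis using l2_eq_0[OF H01_L2[OF y]] by blast
  qed
  have surj: "\<exists>y. H01 \<Omega> y \<and> (\<forall>z. H01 \<Omega> z \<longrightarrow> opA a b a0 \<Omega> y z = F z)" if "Hminus1 \<Omega> F" for F
    by (rule H.method_of_continuity[OF opA_bounded_functional K(2,1) C(2,1)]) (use that bf in auto)
  have inv: "\<exists>C. \<forall>y M. H01 \<Omega> y \<longrightarrow> (\<forall>z. H01 \<Omega> z \<longrightarrow> \<bar>opA a b a0 \<Omega> y z\<bar> \<le> M * H01_norm \<Omega> z) \<longrightarrow> H01_norm \<Omega> y \<le> C * M"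
  proof (cases "\<forall>z. H01 \<Omega> z \<longrightarrow> H01_norm \<Omega> z = 0")
    case True
    \<comment> \<open>Here negative \<open>M\<close> satisfy the hypothesis as well, so the constant has to vanish.\<close>
    then show ?thesis by (intro exI[of _ 0]) auto
  next
    case False
    \<comment> \<open>An element of positive norm forces \<open>M \<ge> 0\<close> in the hypothesis,
      which the a priori bound presupposes.\<close>
    then obtain w where w: "H01 \<Omega> w" "H01_norm \<Omega> w > 0" using nn by (metis less_eq_real_def)
    have "H01_norm \<Omega> y \<le> C * M"
      if y: "H01 \<Omega> y" and op: "\<forall>z. H01 \<Omega> z \<longrightarrow> \<bar>opA a b a0 \<Omega> y z\<bar> \<le> M * H01_norm \<Omega> z" for y M
    proof (rule ap[OF y])
      have "0 \<le> M * H01_norm \<Omega> w" using op w(1) by (meson abs_ge_zero order_trans)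
      then show "M \<ge> 0" using w(2) by (simp add: zero_le_mult_iff)
    qed (use op in blast)
    then show ?thesis by blast
  qed
  show ?thesis
    using opA_integrable opA_bounded_functional(1) K(2) inj surj inv unfolding bf by blast
qed

end
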